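(* Let $s\in\mathbb R$, $p>0$ and $N\in\mathbb N$, $N\ge2$, and set $T_N(x)=\sum_{n=1}^N n^{-2s}e^{2\pi i n^2x}$. With implicit constants depending only on $s$ and $p$: \begin{itemize} \item if $s<1/4$: $\|T_N\|_p\simeq N^{1/2-2s}$ for $p<4$; $\|T_N\|_4\simeq N^{1/2-2s}(\log N)^{1/4}$; $\|T_N\|_p\simeq N^{1-2/p-2s}$ for $p>4$; \item if $s=1/4$: $\|T_N\|_p\simeq(\log N)^{1/2}$ for $p<4$; $\|T_N\|_p\simeq N^{1/2-2/p}$ for $p>4$; and $(\log N)^{1/2}\lesssim\|T_N\|_4\lesssim(\log N)^{3/4}$; \item if $1/4<s<1/2$: $\|T_N\|_p\simeq1$ for $p<\frac{2}{1-2s}$; $\|T_N\|_p\simeq N^{1-2/p-2s}$ for $p>\frac{2}{1-2s}$; and for $p=\frac2{1-2s}$, $(\log N)^{1/p}\lesssim\|T_N\|_p\lesssim(\log N)^{1/2}$; \item if $s\ge1/2$: $\|T_N\|_p\simeq1$ for all $p>0$. \end{itemize}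
   Context: $\|\cdot\|_p$ denotes the $L^p(\mathbb T)$ (quasi-)norm on $\mathbb T=\mathbb R/\mathbb Z$. $X\simeq Y$ means $cY\le X\le CY$ with $c,C>0$ independent of $N$. *)

theory Defs
  imports "HOL-Analysis.Analysis"
begin

definition TN :: "real \<Rightarrow> nat \<Rightarrow> real \<Rightarrow> complex" where
  "TN s N x = (\<Sum>n=1..N. complex_of_real ((real n) powr (- 2 * s)) *
                 exp (2 * pi * \<i> * complex_of_real (real n ^ 2 * x)))"

text \<open>L^p(T) quasi-norm, T = R/Z identified with [0,1] (Lebesgue measure).\<close>
definition Lp_norm :: "real \<Rightarrow> (real \<Rightarrow> complex) \<Rightarrow> real" where
  "Lp_norm p f = (\<integral>x\<in>{0..1}. norm (f x) powr p \<partial>lborel) powr (1/p)"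

definition lesssim :: "(nat \<Rightarrow> real) \<Rightarrow> (nat \<Rightarrow> real) \<Rightarrow> bool" where
  "lesssim f g \<longleftrightarrow> (\<exists>C>0. \<forall>N\<ge>2. f N \<le> C * g N)"

definition simeq :: "(nat \<Rightarrow> real) \<Rightarrow> (nat \<Rightarrow> real) \<Rightarrow> bool" where
  "simeq f g \<longleftrightarrow> (\<exists>c>0. \<exists>C>0. \<forall>N\<ge>2. c * g N \<le> f N \<and> f N \<le> C * g N)"

end

theory Submission
  imports Defs "HOL-Number_Theory.Totient" "HOL-Analysis.Kronecker_Approximation_Theorem"
begin

text \<open>
  Upper bounds. Squaring a quadratic exponential sum of length \<open>K\<close> with a tent weight produces linear
  exponential sums whose weights have small second differences, so no logarithm is lost: if
  \<open>2 x = a/q + \<beta>\<close> is the Dirichlet approximation with \<open>q \<le> 4 K\<close>, the square is \<open>O(min(K\<^sup>2, 1/|\<beta>|) / q)\<close>.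
  Integrating over all arcs gives the sharp \<open>L\<^sup>p\<close> norm of a tent sum for every \<open>p > 2\<close>. A sharp cutoff is a
  bounded number of tents plus averages of much shorter intervals, which an induction on the length absorbs;
  partial summation then handles dyadic blocks with weights \<open>n\<^sup>r\<close>. Away from the critical exponent the block
  norms form a geometric series. At the critical exponent the blocks have comparable norms, and
  \<open>\<integral> (1 + |P|\<^sup>2)\<^bsup>p/2\<^esup>\<close> is followed as blocks are added to the partial sum \<open>P\<close>: integration by parts bounds
  the first-order term by the second-order one, so \<open>J\<close> blocks cost only a factor \<open>J\<^bsup>1/2\<^esup>\<close>.

  Lower bounds. They come from Parseval (with Hoelder interpolation against an upper bound when \<open>p < 2\<close>), from
  the peak at \<open>x = 0\<close>, from testing against a sum of Fejer kernels at the critical exponent, and, for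
  \<open>p = 4\<close>, from counting solutions of \<open>a\<^sup>2 + b\<^sup>2 = c\<^sup>2 + d\<^sup>2\<close> with all variables of size \<open>N\<close>.
\<close>

section \<open>The characters and orthogonality\<close>

text \<open>The exponent 4 comes from the arcs. There are about q fractions with denominator q, and
  each contributes about K^(p-2) q^(-p/2) to the p-th moment of a tent sum, so the total follows the
  sum of q^(1-p/2): a power for p < 4, a logarithm at p = 4, bounded for p > 4. The block at scale
  2^j then has norm of order at most 2^((sg - 2 s) j) with sg = max(1/2, 1 - 2/p), up to a logarithm
  at p = 4, and the regimes of the theorem are the signs of sg - 2 s. The integral of |beta|^(-p/2)
  away from the centre of an arc is controlled by its centre only for p > 2. Upper bounds are
  therefore proved for p > 2 and descend to smaller p because norms on a probability space are
  monotone up to constants. At sg = 2 s the triangle inequality over log N blocks would cost log N.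
  The frequencies of block j have size 4^j: its antiderivative gains 4^(-j), while the derivative of
  all earlier blocks together is only of size 4^j, so the two effects balance in the integration by
  parts. Young's inequality with parameter 1/J then lets J steps multiply the energy by a bounded
  factor only.\<close>

definition ee :: "real \<Rightarrow> complex" where
  "ee t = cis (2 * pi * t)"

lemma norm_ee [simp]: "norm (ee t) = 1"
  by (simp add: ee_def)

lemma ee_0 [simp]: "ee 0 = 1"
  by (simp add: ee_def)

lemma ee_add: "ee (a + b) = ee a * ee b"
  by (simp add: ee_def cis_mult algebra_simps)

lemma ee_minus: "ee (- a) = cnj (ee a)"
  by (simp add: ee_def cis_cnj)

lemma ee_diff: "ee (a - b) = ee a * cnj (ee b)"
  using ee_add[of a "-b"] by (simp add: ee_minus)

lemma ee_of_int [simp]: "ee (of_int k) = 1"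
  unfolding ee_def by (metis cis_multiple_2pi Ints_of_int)

lemma ee_of_nat [simp]: "ee (of_nat k) = 1"
  using ee_of_int[of "int k"] by simp

lemma Re_ee: "Re (ee t) = cos (2 * pi * t)"
  by (simp add: ee_def)

lemma continuous_on_ee [continuous_intros]:
  "continuous_on A f \<Longrightarrow> continuous_on A (\<lambda>x. ee (f x))"
  unfolding ee_def by (intro continuous_intros)

lemma ee_has_vector_derivative:
  "((\<lambda>x. ee (c * x)) has_vector_derivative (2 * pi * c) *\<^sub>R (\<i> * ee (c * x))) (at x within A)"
proof -
  have "((\<lambda>z. exp (\<i> * (2 * pi * c * z))) has_field_derivative exp (\<i> * (2 * pi * c * of_real x)) * (\<i> * (2 * pi * c)))
      (at (of_real x))"
    by (auto intro!: derivative_eq_intros)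
  from has_vector_derivative_real_field[OF this] show ?thesis
    by (simp add: ee_def cis_conv_exp scaleR_conv_of_real mult_ac)
qed

lemma integral_ee:
  fixes k :: int
  shows "((\<lambda>x. ee (of_int k * x)) has_integral (if k = 0 then 1 else 0)) {0..1}"
proof (cases "k = 0")
  case True
  then show ?thesis using has_integral_const_real[of "1::complex" 0 1] by simp
next
  case False
  let ?F = "\<lambda>x. ee (of_int k * x) / (2 * pi * of_int k * \<i>)"
  have "((\<lambda>x. ee (of_int k * x)) has_integral (?F 1 - ?F 0)) {0..1}"
  proof (rule fundamental_theorem_of_calculus)
    fix x :: real
    have "(?F has_vector_derivative ((2 * pi * of_int k) *\<^sub>R (\<i> * ee (of_int k * x))) / (2 * pi * of_int k * \<i>))
          (at x within {0..1})"
      by (intro has_vector_derivative_divide ee_has_vector_derivative)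
    then show "(?F has_vector_derivative ee (of_int k * x)) (at x within {0..1})"
      using False by (simp add: scaleR_conv_of_real)
  qed auto
  then show ?thesis using False by simp
qed

section \<open>The Lp quasi-norms of continuous functions\<close>

lemma continuous_on_norm_powr:
  fixes f :: "real \<Rightarrow> complex"
  assumes "continuous_on A f" "p > 0"
  shows "continuous_on A (\<lambda>x. norm (f x) powr p)"
  using assms by (intro continuous_on_powr' continuous_intros) auto

lemma integrable_norm_powr:
  fixes f :: "real \<Rightarrow> complex"
  assumes "continuous_on {0..1} f" "p > 0"
  shows "(\<lambda>x. norm (f x) powr p) integrable_on {0..1}"
  by (intro integrable_continuous_real continuous_on_norm_powr assms)

lemma integral_norm_powr_nonneg [simp]:
  "0 \<le> integral {0..1} (\<lambda>x. norm (f x :: complex) powr p)"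
  by (cases "(\<lambda>x. norm (f x) powr p) integrable_on {0..1}")
     (auto simp: integral_nonneg not_integrable_integral)

lemma Lp_norm_eq_integral:
  assumes "continuous_on {0..1} f" "p > 0"
  shows "Lp_norm p f = (integral {0..1} (\<lambda>x. norm (f x) powr p)) powr (1/p)"
proof -
  have "set_integrable lborel {0..1} (\<lambda>x. norm (f x) powr p)"
    unfolding set_integrable_def
    by (rule borel_integrable_compact) (use assms in \<open>auto intro: continuous_on_norm_powr\<close>)
  from set_borel_integral_eq_integral(2)[OF this] show ?thesis
    unfolding Lp_norm_def by simp
qed

lemma Lp_norm_nonneg [simp]: "0 \<le> Lp_norm p f"
  by (simp add: Lp_norm_def)

lemma Lp_norm_powr:
  assumes "continuous_on {0..1} f" "p > 0"
  shows "Lp_norm p f powr p = integral {0..1} (\<lambda>x. norm (f x) powr p)"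
  using assms by (simp add: Lp_norm_eq_integral powr_powr)

lemma Lp_norm_leI:
  assumes "continuous_on {0..1} f" "p > 0" "A \<ge> 0"
    and "integral {0..1} (\<lambda>x. norm (f x) powr p) \<le> A powr p"
  shows "Lp_norm p f \<le> A"
proof -
  have "Lp_norm p f \<le> (A powr p) powr (1/p)"
    unfolding Lp_norm_eq_integral[OF assms(1,2)]
    by (rule powr_mono2) (use assms in auto)
  then show ?thesis using assms by (simp add: powr_powr)
qed

lemma Lp_norm_geI:
  assumes "continuous_on {0..1} f" "p > 0" "A \<ge> 0"
    and "A powr p \<le> integral {0..1} (\<lambda>x. norm (f x) powr p)"
  shows "A \<le> Lp_norm p f"
proof -
  have "(A powr p) powr (1/p) \<le> Lp_norm p f"
    unfolding Lp_norm_eq_integral[OF assms(1,2)]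
    by (rule powr_mono2) (use assms in auto)
  then show ?thesis using assms by (simp add: powr_powr)
qed

lemma integral_norm_powr_le:
  assumes "continuous_on {0..1} f" "p > 0" "Lp_norm p f \<le> A"
  shows "integral {0..1} (\<lambda>x. norm (f x) powr p) \<le> A powr p"
  unfolding Lp_norm_powr[OF assms(1,2), symmetric]
  by (rule powr_mono2) (use assms in auto)

lemma Lp_norm_cong:
  assumes "\<And>x. f x = g x"
  shows "Lp_norm p f = Lp_norm p g"
  using assms by presburger

lemma Lp_norm_le_sup:
  assumes "continuous_on {0..1} f" "p > 0" "B \<ge> 0"
    and "\<And>x. x \<in> {0..1} \<Longrightarrow> norm (f x) \<le> B"
  shows "Lp_norm p f \<le> B"
proof (rule Lp_norm_leI)
  have "integral {0..1} (\<lambda>x. norm (f x) powr p) \<le> integral {0..1} (\<lambda>x::real. B powr p)"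
    by (intro integral_le integrable_norm_powr powr_mono2) (use assms in auto)
  then show "integral {0..1} (\<lambda>x. norm (f x) powr p) \<le> B powr p" by simp
qed (use assms in auto)

lemma Lp_norm_scale:
  assumes "continuous_on {0..1} f" "p > 0"
  shows "Lp_norm p (\<lambda>x. c * f x) = norm c * Lp_norm p f"
proof -
  have c: "continuous_on {0..1} (\<lambda>x. c * f x)" using assms by (intro continuous_intros)
  have "integral {0..1} (\<lambda>x. norm (c * f x) powr p) = norm c powr p * integral {0..1} (\<lambda>x. norm (f x) powr p)"
    by (simp add: norm_mult powr_mult)
  then show ?thesis
    unfolding Lp_norm_eq_integral[OF c assms(2)] Lp_norm_eq_integral[OF assms]
    using assms by (simp add: powr_mult powr_powr)
qed

text \<open>If \<open>u\<close> or \<open>v\<close> is 0 the claim reduces to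
  \<open>t powr p <= t\<close> on (0,1); otherwise it is convexity on the positive
  half-line.\<close>

lemma powr_convex_combination:
  fixes u v t p :: real
  assumes "p \<ge> 1" "u \<ge> 0" "v \<ge> 0" "0 < t" "t < 1"
  shows "(t * u + (1 - t) * v) powr p \<le> t * u powr p + (1 - t) * v powr p"
proof -
  have small: "a powr p \<le> a" if "0 < a" "a < 1" for a :: real
    using powr_mono'[of 1 p a] that assms by simp
  consider "u = 0" | "v = 0" | "u > 0" "v > 0" using assms by linarith
  then show ?thesis
  proof cases
    case 1
    then show ?thesis using small[of "1-t"] assms by (simp add: powr_mult mult_right_mono)
  next
    case 2
    then show ?thesis using small[of t] assms by (simp add: powr_mult mult_right_mono)
  next
    case 3
    have "convex_on {0<..} (\<lambda>x. x powr p)" by (rule powr_convex) (use assms in auto)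
    from convex_onD[OF this, of "1-t" u v] 3 assms show ?thesis by simp
  qed
qed

text \<open>Minkowski from convexity alone: \<open>f + g\<close> is \<open>a + b\<close> times a
  convex combination of \<open>f / a\<close> and \<open>g / b\<close>, whose p-th powers integrate
  to at most 1 when \<open>a\<close> and \<open>b\<close> dominate the two norms.\<close>

lemma Lp_norm_triangle:
  assumes f: "continuous_on {0..1} f" and g: "continuous_on {0..1} g" and p: "p \<ge> 1"
  shows "Lp_norm p (\<lambda>x. f x + g x) \<le> Lp_norm p f + Lp_norm p g"
proof (rule field_le_epsilon)
  fix e :: real assume e: "e > 0"
  \<comment> \<open>The slack \<open>e / 2\<close> keeps both normalising factors positive even when
    a norm vanishes.\<close>
  define a where "a = Lp_norm p f + e / 2"
  define b where "b = Lp_norm p g + e / 2"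
  define t where "t = a / (a + b)"
  have ab: "a > 0" "b > 0" using e by (auto simp: a_def b_def add_nonneg_pos)
  have t: "0 < t" "t < 1" "1 - t = b / (a + b)" using ab by (auto simp: t_def field_simps)
  have p0: "p > 0" using p by simp
  have fg: "continuous_on {0..1} (\<lambda>x. f x + g x)" using f g by (intro continuous_intros)
  have If: "integral {0..1} (\<lambda>x. norm (f x) powr p) \<le> a powr p"
    using e by (intro integral_norm_powr_le f p0) (auto simp: a_def)
  have Ig: "integral {0..1} (\<lambda>x. norm (g x) powr p) \<le> b powr p"
    using e by (intro integral_norm_powr_le g p0) (auto simp: b_def)
  have pt: "norm (f x + g x) powr p \<le> (a + b) powr p * (t * (norm (f x) powr p / a powr p)
      + (1 - t) * (norm (g x) powr p / b powr p))" for x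
  proof -
    have "norm (f x + g x) powr p \<le> (norm (f x) + norm (g x)) powr p"
      by (intro powr_mono2 norm_triangle_ineq) (use p in auto)
    also have "norm (f x) + norm (g x) = (a + b) * (t * (norm (f x) / a) + (1 - t) * (norm (g x) / b))"
    proof -
      have "(a + b) * (t * (norm (f x) / a)) = norm (f x)" "(a + b) * ((1 - t) * (norm (g x) / b)) = norm (g x)"
        using ab by (simp_all add: t(3)) (simp_all add: t_def)
      then show ?thesis by (simp only: distrib_left)
    qed
    also have "\<dots> powr p = (a + b) powr p * (t * (norm (f x) / a) + (1 - t) * (norm (g x) / b)) powr p"
      using ab t by (simp add: powr_mult)
    also have "\<dots> \<le> (a + b) powr p * (t * (norm (f x) / a) powr p + (1 - t) * (norm (g x) / b) powr p)"
      using ab t p by (intro mult_left_mono powr_convex_combination) auto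
    finally show ?thesis using ab by (simp add: powr_divide)
  qed
  have "integral {0..1} (\<lambda>x. norm (f x + g x) powr p) \<le> integral {0..1} (\<lambda>x. (a + b) powr p *
     (t * (norm (f x) powr p / a powr p) + (1 - t) * (norm (g x) powr p / b powr p)))"
    by (intro integral_le pt integrable_norm_powr fg p0 integrable_on_mult_right integrable_add
        integrable_on_divide f g)
  also have "\<dots> = (a + b) powr p *
     (t * (integral {0..1} (\<lambda>x. norm (f x) powr p) / a powr p) + (1 - t) * (integral {0..1} (\<lambda>x. norm (g x) powr p) / b powr p))"
    by (subst integral_mult_right, subst integral_add)
       (auto intro!: integrable_on_mult_right integrable_on_divide integrable_norm_powr f g p0)
  also have "\<dots> \<le> (a + b) powr p * (t * 1 + (1 - t) * 1)"
    using If Ig ab t by (intro mult_left_mono add_mono) auto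
  finally have "integral {0..1} (\<lambda>x. norm (f x + g x) powr p) \<le> (a + b) powr p" by simp
  then have "Lp_norm p (\<lambda>x. f x + g x) \<le> a + b"
    by (intro Lp_norm_leI fg p0) (use ab in auto)
  then show "Lp_norm p (\<lambda>x. f x + g x) \<le> Lp_norm p f + Lp_norm p g + e"
    by (simp add: a_def b_def)
qed

lemma Lp_norm_zero: "p > 0 \<Longrightarrow> Lp_norm p (\<lambda>x. 0) = 0"
  by (subst Lp_norm_eq_integral) auto

lemma Lp_norm_sum_le:
  assumes "finite A" "\<And>i. i \<in> A \<Longrightarrow> continuous_on {0..1} (f i)" "p \<ge> 1"
  shows "Lp_norm p (\<lambda>x. \<Sum>i\<in>A. f i x) \<le> (\<Sum>i\<in>A. Lp_norm p (f i))"
  using assms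
proof (induction A rule: finite_induct)
  case empty
  then show ?case by (simp add: Lp_norm_zero)
next
  case (insert i A)
  have "Lp_norm p (\<lambda>x. f i x + (\<Sum>i\<in>A. f i x)) \<le> Lp_norm p (f i) + Lp_norm p (\<lambda>x. \<Sum>i\<in>A. f i x)"
    by (intro Lp_norm_triangle continuous_intros) (use insert in auto)
  also have "\<dots> \<le> Lp_norm p (f i) + (\<Sum>i\<in>A. Lp_norm p (f i))"
    using insert by auto
  finally show ?case using insert by simp
qed

text \<open>Integrating u^p <= 1 + u^r for u = |f| / A, with A slightly above the larger norm, gives
  at most 2; this is the source of the harmless factor 2^(1/p).\<close>

lemma Lp_norm_mono_exponent:
  assumes f: "continuous_on {0..1} f" and p: "0 < p" "p \<le> r"
  shows "Lp_norm p f \<le> 2 powr (1/p) * Lp_norm r f"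
proof (rule field_le_epsilon)
  fix e :: real assume e: "e > 0"
  define c where "c = (2::real) powr (1/p)"
  have c0: "c > 0" by (simp add: c_def)
  define A where "A = Lp_norm r f + e / c"
  have A: "A > 0" using e c0 by (simp add: A_def add_nonneg_pos)
  have r: "r > 0" using p by simp
  have pt: "norm (f x) powr p \<le> A powr p * (1 + norm (f x) powr r / A powr r)" for x
  proof -
    have "norm (f x) / A \<ge> 0" using A by simp
    have "(norm (f x) / A) powr p \<le> 1 + (norm (f x) / A) powr r"
    proof (cases "norm (f x) / A \<le> 1")
      case True
      then have "(norm (f x) / A) powr p \<le> 1" using A p by (intro powr_le1) auto
      then show ?thesis by (smt (verit) powr_ge_zero)
    next
      case False
      then have "(norm (f x) / A) powr p \<le> (norm (f x) / A) powr r" using p by (intro powr_mono) auto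
      then show ?thesis by simp
    qed
    then show ?thesis using A by (simp add: powr_divide field_simps)
  qed
  have "integral {0..1} (\<lambda>x. norm (f x) powr p) \<le> integral {0..1} (\<lambda>x. A powr p * (1 + norm (f x) powr r / A powr r))"
    by (intro integral_le pt integrable_norm_powr f p integrable_on_mult_right integrable_add
        integrable_on_divide r integrable_const_ivl)
  also have "\<dots> = A powr p * (1 + integral {0..1} (\<lambda>x. norm (f x) powr r) / A powr r)"
    by (subst integral_mult_right, subst integral_add)
       (auto intro!: integrable_on_divide integrable_norm_powr f r)
  also have "\<dots> \<le> A powr p * (1 + 1)"
  proof -
    have "integral {0..1} (\<lambda>x. norm (f x) powr r) \<le> A powr r"
      using e c0 by (intro integral_norm_powr_le f r) (auto simp: A_def)
    then show ?thesis using A by (intro mult_left_mono add_mono) auto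
  qed
  also have "\<dots> = (c * A) powr p"
    using A p by (simp add: c_def powr_mult powr_powr)
  finally have "Lp_norm p f \<le> c * A"
    by (intro Lp_norm_leI f p) (use c0 A in auto)
  also have "\<dots> = c * Lp_norm r f + e" using c0 by (simp add: A_def field_simps)
  finally show "Lp_norm p f \<le> 2 powr (1/p) * Lp_norm r f + e" by (simp add: c_def)
qed

text \<open>Split the square of |f| at height \<open>l * X\<close>. Below it, |f|^2 is controlled by
  |f|^p, above it by |f|^r. The constant \<open>l\<close> is chosen so that the upper part accounts
  for at most half of the guaranteed L2 mass, which leaves the other half to the p-th power.\<close>

lemma Lp_norm_lower_interpolation:
  assumes f: "continuous_on {0..1} f" and p: "0 < p" "p \<le> 2" and r: "r > 2"
    and X: "X > 0" and c: "c > 0" and C: "C > 0"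
    and lower: "c * X \<le> Lp_norm 2 f" and upper: "Lp_norm r f \<le> C * X"
  defines "l \<equiv> (2 * C powr r / c\<^sup>2) powr (1 / (r - 2))"
  shows "(c\<^sup>2 / 2 * l powr (p - 2)) powr (1/p) * X \<le> Lp_norm p f"
proof -
  have l: "l > 0" using C c by (simp add: l_def)
  have lr: "l powr (2 - r) * C powr r = c\<^sup>2 / 2"
  proof -
    have "l powr (2 - r) = (2 * C powr r / c\<^sup>2) powr (-1)"
    proof -
      have "1 / (r - 2) * (2 - r) = -1" using r by (simp add: field_simps)
      then show ?thesis unfolding l_def powr_powr by simp
    qed
    then show ?thesis using C c by (simp add: powr_minus)
  qed
  let ?m = "l * X"
  have m: "?m > 0" using l X by simp
  have pt: "norm (f x) powr 2 \<le> ?m powr (2 - p) * norm (f x) powr p + ?m powr (2 - r) * norm (f x) powr r" for x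
  proof (cases "f x = 0")
    case False
    then have n: "norm (f x) > 0" by simp
    show ?thesis
    proof (cases "norm (f x) \<le> ?m")
      case True
      have "norm (f x) powr 2 = norm (f x) powr (2 - p) * norm (f x) powr p"
        using n by (simp flip: powr_add)
      also have "\<dots> \<le> ?m powr (2 - p) * norm (f x) powr p"
        using True p by (intro mult_right_mono powr_mono2) auto
      finally show ?thesis by (smt (verit) mult_nonneg_nonneg powr_ge_zero)
    next
      case False
      have "norm (f x) powr 2 = norm (f x) powr (2 - r) * norm (f x) powr r"
        using n by (simp flip: powr_add)
      also have "\<dots> \<le> ?m powr (2 - r) * norm (f x) powr r"
        using False m r by (intro mult_right_mono powr_mono2') auto
      finally show ?thesis by (smt (verit) mult_nonneg_nonneg powr_ge_zero)
    qed
  qed (use p r in auto)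
  define I where "I = integral {0..1} (\<lambda>x. norm (f x) powr p)"
  have r0: "r > 0" using r by simp
  have "(c * X) powr 2 \<le> Lp_norm 2 f powr 2"
    using lower c X by (intro powr_mono2) auto
  also have "\<dots> = integral {0..1} (\<lambda>x. norm (f x) powr 2)"
    by (rule Lp_norm_powr) (use f in auto)
  also have "\<dots> \<le> integral {0..1} (\<lambda>x. ?m powr (2 - p) * norm (f x) powr p + ?m powr (2 - r) * norm (f x) powr r)"
    by (intro integral_le pt integrable_norm_powr f p r0 integrable_on_mult_right integrable_add) auto
  also have "\<dots> = ?m powr (2 - p) * I + ?m powr (2 - r) * integral {0..1} (\<lambda>x. norm (f x) powr r)"
    unfolding I_def
    by (subst integral_add) (auto intro!: integrable_on_mult_right integrable_norm_powr f r0 p)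
  also have "\<dots> \<le> ?m powr (2 - p) * I + ?m powr (2 - r) * (C * X) powr r"
    by (intro add_mono mult_left_mono integral_norm_powr_le f r0 upper) auto
  also have "?m powr (2 - r) * (C * X) powr r = c\<^sup>2 / 2 * X powr 2"
  proof -
    have "?m powr (2 - r) * (C * X) powr r = (l powr (2 - r) * C powr r) * (X powr (2 - r) * X powr r)"
      using l X C by (simp add: powr_mult)
    then show ?thesis using X by (simp add: lr flip: powr_add)
  qed
  finally have "c\<^sup>2 / 2 * X powr 2 \<le> ?m powr (2 - p) * I"
    using c X by (simp add: powr_mult field_simps)
  then have "c\<^sup>2 / 2 * X powr 2 * ?m powr (p - 2) \<le> ?m powr (2 - p) * I * ?m powr (p - 2)"
    by (intro mult_right_mono) auto
  also have "\<dots> = I * (?m powr (2 - p) * ?m powr (p - 2))" by simp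
  also have "\<dots> = I" using m l X by (simp flip: powr_add)
  also have "c\<^sup>2 / 2 * X powr 2 * ?m powr (p - 2) = c\<^sup>2 / 2 * l powr (p - 2) * (X powr 2 * X powr (p - 2))"
    using l X by (simp add: powr_mult)
  also have "X powr 2 * X powr (p - 2) = X powr p" using powr_add[of X 2 "p - 2"] by simp
  finally have "((c\<^sup>2 / 2 * l powr (p - 2)) powr (1/p) * X) powr p \<le> I"
    using p X c l by (simp add: powr_mult powr_powr)
  then show ?thesis unfolding I_def
    by (intro Lp_norm_geI f p) (use X in auto)
qed

section \<open>Weyl differencing for tent weights\<close>

text \<open>The cubic Taylor remainder is at most |u|^3 / 6 <= 2 |u| / 3 on this range, which
  contains [-pi/2, pi/2].\<close>

lemma abs_sin_ge:
  fixes u :: real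
  assumes "\<bar>u\<bar> \<le> 2"
  shows "\<bar>u\<bar> / 3 \<le> \<bar>sin u\<bar>"
proof -
  have "\<bar>sin u - (\<Sum>m<3. sin_coeff m * u ^ m)\<bar> \<le> inverse (fact 3) * \<bar>u\<bar> ^ 3"
    by (rule Maclaurin_sin_bound)
  moreover have "(\<Sum>m<3. sin_coeff m * u ^ m) = u"
    by (simp only: numeral_3_eq_3 sum.lessThan_Suc) (simp add: sin_coeff_def)
  moreover have "inverse (fact 3 :: real) = 1 / 6" by (simp add: fact_numeral)
  ultimately have "\<bar>sin u - u\<bar> \<le> 1 / 6 * \<bar>u\<bar> ^ 3" by (simp only:)
  then have 1: "\<bar>u\<bar> - 1 / 6 * \<bar>u\<bar> ^ 3 \<le> \<bar>sin u\<bar>" by linarith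
  have "\<bar>u\<bar> * \<bar>u\<bar>\<^sup>2 \<le> \<bar>u\<bar> * 2\<^sup>2" using assms by (intro mult_left_mono power_mono) auto
  then have "\<bar>u\<bar> ^ 3 \<le> 4 * \<bar>u\<bar>" by (simp add: power3_eq_cube power2_eq_square)
  with 1 show ?thesis by linarith
qed

lemma norm_one_minus_ee: "norm (1 - ee t) = 2 * \<bar>sin (pi * t)\<bar>"
proof -
  have *: "(1 - c)\<^sup>2 + s\<^sup>2 = 2 * (1 - c)" if "s\<^sup>2 + c\<^sup>2 = 1" for s c :: real
    using that by (simp add: power2_eq_square algebra_simps)
  have "(norm (1 - ee t))\<^sup>2 = (1 - cos (2 * (pi * t)))\<^sup>2 + (sin (2 * (pi * t)))\<^sup>2"
    by (simp add: ee_def cmod_power2 mult.assoc)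
  also have "\<dots> = 2 * (1 - cos (2 * (pi * t)))"
    by (rule *) (rule sin_cos_squared_add)
  also have "\<dots> = (2 * \<bar>sin (pi * t)\<bar>)\<^sup>2"
    by (simp only: cos_double_sin power_mult_distrib power2_abs) simp
  finally show ?thesis by (rule power2_eq_imp_eq) auto
qed

text \<open>The left side of the chord formula is 2 |sin(pi (y - k))|; the factor pi > 3 compensates
  the 1/3 lost in \<open>abs_sin_ge\<close>.\<close>

lemma norm_one_minus_ee_ge:
  fixes k :: int
  assumes "\<bar>y - of_int k\<bar> \<le> 1/2"
  shows "2 * \<bar>y - of_int k\<bar> \<le> norm (1 - ee y)"
proof -
  have ey: "ee y = ee (y - of_int k)" using ee_diff[of y "of_int k"] by simp
  have "\<bar>pi * (y - of_int k)\<bar> \<le> 2"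
    using mult_mono[of pi 4 "\<bar>y - of_int k\<bar>" "1/2"] assms pi_less_4 by (simp add: abs_mult)
  from abs_sin_ge[OF this] have "pi * \<bar>y - of_int k\<bar> / 3 \<le> \<bar>sin (pi * (y - of_int k))\<bar>"
    by (simp only: abs_mult) simp
  moreover have "3 * \<bar>y - of_int k\<bar> \<le> pi * \<bar>y - of_int k\<bar>"
    using pi_gt3 by (intro mult_right_mono) auto
  ultimately show ?thesis
    unfolding norm_one_minus_ee[of "y - of_int k", folded ey] by linarith
qed

text \<open>Multiplying by \<open>ee y\<close> shifts the index by one. Since \<open>g\<close>
  vanishes outside the range there are no boundary terms, only the extra index
  \<open>B + 1\<close>.\<close>

lemma sum_by_parts_ee:
  fixes g :: "int \<Rightarrow> complex"
  assumes "\<And>n. n \<notin> {A..B} \<Longrightarrow> g n = 0"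
  shows "(1 - ee y) * (\<Sum>n\<in>{A..B}. g n * ee (of_int n * y)) = (\<Sum>n\<in>{A..B+1}. (g n - g (n - 1)) * ee (of_int n * y))"
proof -
  have "(\<Sum>n\<in>{A..B+1}. g (n - 1) * ee (of_int n * y)) = (\<Sum>n\<in>{A-1..B}. g n * ee (of_int (n+1) * y))"
    by (rule sum.reindex_bij_witness[of _ "\<lambda>n. n + 1" "\<lambda>n. n - 1"]) auto
  also have "\<dots> = (\<Sum>n\<in>{A..B}. g n * ee (of_int (n+1) * y))"
    by (rule sum.mono_neutral_right) (use assms in auto)
  also have "\<dots> = ee y * (\<Sum>n\<in>{A..B}. g n * ee (of_int n * y))"
    by (simp add: sum_distrib_left ring_distribs ee_add mult_ac)
  finally have 1: "(\<Sum>n\<in>{A..B+1}. g (n - 1) * ee (of_int n * y)) = ee y * (\<Sum>n\<in>{A..B}. g n * ee (of_int n * y))" .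
  have 2: "(\<Sum>n\<in>{A..B+1}. g n * ee (of_int n * y)) = (\<Sum>n\<in>{A..B}. g n * ee (of_int n * y))"
    by (rule sum.mono_neutral_right) (use assms in auto)
  show ?thesis by (simp add: left_diff_distrib sum_subtractf 1 2)
qed

text \<open>Two summations by parts. A single one would give decay 1/dist, whose sum over residues
  is harmonic; the decay 1/dist^2 obtained here is summable.\<close>

lemma norm_exp_sum_le_second_difference:
  fixes g :: "int \<Rightarrow> complex"
  assumes "\<And>n. n \<notin> {A..B} \<Longrightarrow> g n = 0"
  shows "(norm (1 - ee y))\<^sup>2 * norm (\<Sum>n\<in>{A..B}. g n * ee (of_int n * y))
         \<le> (\<Sum>n\<in>{A..B+2}. norm (g n - 2 * g (n - 1) + g (n - 2)))"
proof -
  let ?S = "\<Sum>n\<in>{A..B}. g n * ee (of_int n * y)"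
  have "(1 - ee y) * ((1 - ee y) * ?S)
      = (\<Sum>n\<in>{A..(B+1)+1}. ((g n - g (n - 1)) - (g (n - 1) - g (n - 1 - 1))) * ee (of_int n * y))"
  proof -
    have "g n - g (n - 1) = 0" if "n \<notin> {A..B+1}" for n
      using assms[of n] assms[of "n - 1"] that by auto
    then have "(1 - ee y) * (\<Sum>n\<in>{A..B+1}. (g n - g (n - 1)) * ee (of_int n * y)) =
      (\<Sum>n\<in>{A..(B+1)+1}. ((g n - g (n - 1)) - (g (n - 1) - g (n - 1 - 1))) * ee (of_int n * y))"
      by (rule sum_by_parts_ee)
    moreover have "(1 - ee y) * ?S = (\<Sum>n\<in>{A..B+1}. (g n - g (n - 1)) * ee (of_int n * y))"
      by (rule sum_by_parts_ee) (rule assms)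
    ultimately show ?thesis by (simp only:)
  qed
  also have "\<dots> = (\<Sum>n\<in>{A..B+2}. (g n - 2 * g (n - 1) + g (n - 2)) * ee (of_int n * y))"
    by (intro sum.cong) (auto simp: diff_diff_eq)
  finally have "norm ((1 - ee y) * ((1 - ee y) * ?S)) = norm (\<Sum>n\<in>{A..B+2}. (g n - 2 * g (n - 1) + g (n - 2)) * ee (of_int n * y))"
    by simp
  then have "(norm (1 - ee y))\<^sup>2 * norm ?S
     = norm (\<Sum>n\<in>{A..B+2}. (g n - 2 * g (n - 1) + g (n - 2)) * ee (of_int n * y))"
    by (simp add: norm_mult power2_eq_square)
  also have "\<dots> \<le> (\<Sum>n\<in>{A..B+2}. norm (g n - 2 * g (n - 1) + g (n - 2)))"
    by (rule sum_norm_le) (simp add: norm_mult)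
  finally show ?thesis .
qed

section \<open>Tent weights and their correlations\<close>

definition tent :: "nat \<Rightarrow> int \<Rightarrow> real" where
  "tent K n = max 0 (1 - \<bar>of_int n\<bar> / real K)"

lemma tent_nonneg [simp]: "0 \<le> tent K n" and tent_le_1 [simp]: "tent K n \<le> 1"
  by (auto simp: tent_def)

lemma tent_eq_0: "K > 0 \<Longrightarrow> int K \<le> \<bar>n\<bar> \<Longrightarrow> tent K n = 0"
  by (auto simp: tent_def max_def field_simps)

lemma tent_eq: "K > 0 \<Longrightarrow> \<bar>n\<bar> \<le> int K \<Longrightarrow> tent K n = 1 - \<bar>of_int n\<bar> / real K"
  by (auto simp: tent_def max_def field_simps)

lemma tent_diff:
  assumes "K > 0"
  shows "\<bar>tent K n - tent K (n - 1)\<bar> \<le> 1 / real K"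
proof -
  have *: "\<bar>max 0 (1 - a) - max 0 (1 - b)\<bar> \<le> \<bar>a - b\<bar>" for a b :: real by linarith
  have "\<bar>tent K n - tent K (n - 1)\<bar> \<le> \<bar>\<bar>real_of_int n\<bar> / real K - \<bar>real_of_int (n - 1)\<bar> / real K\<bar>"
    unfolding tent_def by (rule *)
  also have "\<dots> = \<bar>\<bar>real_of_int n\<bar> - \<bar>real_of_int (n - 1)\<bar>\<bar> / real K"
    using assms by (simp add: abs_divide flip: diff_divide_distrib)
  also have "\<dots> \<le> 1 / real K" using assms by (intro divide_right_mono) auto
  finally show ?thesis .
qed

lemma tent_second_diff_le:
  assumes "K > 0"
  shows "\<bar>tent K n - 2 * tent K (n - 1) + tent K (n - 2)\<bar> \<le> 2 / real K"
  using tent_diff[OF assms, of n] tent_diff[OF assms, of "n - 1"] by (simp add: abs_le_iff)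

text \<open>The tent is piecewise linear with kinks at -K, 0 and K, and a second difference detects
  a kink only at its middle point n - 1.\<close>

lemma tent_second_diff_eq_0:
  assumes "K > 0" "n - 1 \<notin> {- int K, 0, int K}"
  shows "tent K n - 2 * tent K (n - 1) + tent K (n - 2) = 0"
proof -
  consider "n - 1 < - int K" | "- int K < n - 1" "n - 1 < 0" | "0 < n - 1" "n - 1 < int K" | "n - 1 > int K"
    using assms by fastforce
  then show ?thesis
    by cases (use assms in \<open>auto simp: tent_eq tent_eq_0 field_simps\<close>)
qed

text \<open>Three kinks, each contributing at most 2/K, wherever the shift \<open>h\<close> places
  them.\<close>

lemma sum_tent_second_diff_le:
  assumes "K > 0" "finite S"
  shows "(\<Sum>n\<in>S. \<bar>tent K (n + h) - 2 * tent K (n + h - 1) + tent K (n + h - 2)\<bar>) \<le> 6 / real K"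
proof -
  let ?f = "\<lambda>n. \<bar>tent K (n + h) - 2 * tent K (n + h - 1) + tent K (n + h - 2)\<bar>"
  let ?T = "{1 - int K - h, 1 - h, 1 + int K - h}"
  have "(\<Sum>n\<in>S. ?f n) = (\<Sum>n\<in>S \<inter> ?T. ?f n)"
  proof (rule sum.mono_neutral_right)
    show "\<forall>i\<in>S - S \<inter> ?T. ?f i = 0"
    proof
      fix n assume "n \<in> S - S \<inter> ?T"
      then have "n + h - 1 \<notin> {- int K, 0, int K}" by auto
      then show "?f n = 0" using tent_second_diff_eq_0[OF assms(1)] by simp
    qed
  qed (use assms in auto)
  also have "\<dots> \<le> (\<Sum>n\<in>S \<inter> ?T. 2 / real K)"
    by (intro sum_mono tent_second_diff_le assms)
  also have "\<dots> = real (card (S \<inter> ?T)) * (2 / real K)" by simp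
  also have "\<dots> \<le> 3 * (2 / real K)"
  proof (intro mult_right_mono)
    have "card (S \<inter> ?T) \<le> card ?T" by (intro card_mono) auto
    also have "\<dots> \<le> 3" by (simp add: card_insert_if)
    finally show "real (card (S \<inter> ?T)) \<le> 3" by simp
  qed auto
  finally show ?thesis by simp
qed

text \<open>The autocorrelation of the tent at lag \<open>h\<close>, modulated by frequency
  \<open>y\<close>. Up to a factor of modulus 1 it is the part of the squared tent sum whose two
  indices differ by \<open>h\<close>.\<close>

definition tent_corr :: "nat \<Rightarrow> int \<Rightarrow> real \<Rightarrow> complex" where
  "tent_corr K h y = (\<Sum>m\<in>{- int K..int K}. of_real (tent K m * tent K (m + h)) * ee (of_int m * y))"

lemma norm_tent_corr_le_trivial:
  assumes "K > 0"
  shows "norm (tent_corr K h y) \<le> 3 * real K"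
proof -
  have "norm (tent_corr K h y) \<le> (\<Sum>m\<in>{- int K..int K}. 1)"
    unfolding tent_corr_def
    by (rule sum_norm_le) (auto simp: norm_mult abs_mult intro!: mult_le_one)
  also have "\<dots> = real (2 * K + 1)" by simp
  also have "\<dots> \<le> 3 * real K" using assms by simp
  finally show ?thesis .
qed

text \<open>The weight is a product of two tents. By the discrete Leibniz rule its second
  differences are those of the tents, which sit on a few kinks, plus a product of first differences
  of size 1/K^2 at each of O(K) points: altogether O(1/K).\<close>

lemma norm_tent_corr_le:
  fixes k :: int
  assumes K: "K > 0" and y: "\<bar>y - of_int k\<bar> \<le> 1/2"
  shows "norm (tent_corr K h y) * real K * (y - of_int k)\<^sup>2 \<le> 6"
proof -
  define g where "g = (\<lambda>m. complex_of_real (tent K m * tent K (m + h)))"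
  have supp: "g n = 0" if "n \<notin> {- int K..int K}" for n
    using tent_eq_0[OF K, of n] that by (auto simp: g_def)
  have eq: "tent_corr K h y = (\<Sum>m\<in>{- int K..int K}. g m * ee (of_int m * y))"
    by (simp add: tent_corr_def g_def)
  let ?d = "\<lambda>n. tent K n - 2 * tent K (n - 1) + tent K (n - 2)"
  have pt: "norm (g n - 2 * g (n - 1) + g (n - 2)) \<le> \<bar>?d n\<bar> + 2 / (real K)\<^sup>2 + \<bar>?d (n + h)\<bar>" for n
  proof -
    \<comment> \<open>Leibniz rule for second differences; the second factor is evaluated at
      \<open>n\<close> in the first term and the first factor at \<open>n - 2\<close> in the last,
      which makes the identity exact.\<close>
    have "g n - 2 * g (n - 1) + g (n - 2) = of_real (?d n * tent K (n + h)
       + 2 * ((tent K (n - 1) - tent K (n - 1 - 1)) * (tent K (n + h) - tent K (n + h - 1)))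
       + tent K (n - 2) * ?d (n + h))"
      by (simp add: g_def algebra_simps)
    then have "norm (g n - 2 * g (n - 1) + g (n - 2)) = \<bar>?d n * tent K (n + h)
       + 2 * ((tent K (n - 1) - tent K (n - 1 - 1)) * (tent K (n + h) - tent K (n + h - 1)))
       + tent K (n - 2) * ?d (n + h)\<bar>" by (simp only: norm_of_real)
    also have "\<dots> \<le> \<bar>?d n * tent K (n + h)\<bar>
       + 2 * \<bar>(tent K (n - 1) - tent K (n - 1 - 1)) * (tent K (n + h) - tent K (n + h - 1))\<bar>
       + \<bar>tent K (n - 2) * ?d (n + h)\<bar>" by linarith
    also have "\<dots> \<le> \<bar>?d n\<bar> + 2 * (1 / real K * (1 / real K)) + \<bar>?d (n + h)\<bar>"
    proof (intro add_mono mult_left_mono)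
      show "\<bar>?d n * tent K (n + h)\<bar> \<le> \<bar>?d n\<bar>" by (simp add: abs_mult mult_left_le)
      show "\<bar>tent K (n - 2) * ?d (n + h)\<bar> \<le> \<bar>?d (n + h)\<bar>" by (simp add: abs_mult mult_left_le_one_le)
      show "\<bar>(tent K (n - 1) - tent K (n - 1 - 1)) * (tent K (n + h) - tent K (n + h - 1))\<bar> \<le> 1 / real K * (1 / real K)"
        unfolding abs_mult by (intro mult_mono tent_diff K) auto
    qed auto
    finally show ?thesis by (simp add: power2_eq_square)
  qed
  have "(norm (1 - ee y))\<^sup>2 * norm (tent_corr K h y) \<le> (\<Sum>n\<in>{- int K..int K + 2}. norm (g n - 2 * g (n - 1) + g (n - 2)))"
    unfolding eq by (rule norm_exp_sum_le_second_difference) (rule supp)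
  also have "\<dots> \<le> (\<Sum>n\<in>{- int K..int K + 2}. \<bar>?d n\<bar> + 2 / (real K)\<^sup>2 + \<bar>?d (n + h)\<bar>)"
    by (intro sum_mono pt)
  also have "\<dots> = (\<Sum>n\<in>{- int K..int K + 2}. \<bar>?d n\<bar>) + real (2 * K + 3) * (2 / (real K)\<^sup>2) + (\<Sum>n\<in>{- int K..int K + 2}. \<bar>?d (n + h)\<bar>)"
    by (simp add: sum.distrib)
  also have "\<dots> \<le> 6 / real K + real (5 * K) * (2 / (real K)\<^sup>2) + 6 / real K"
  proof (intro add_mono mult_right_mono)
    show "(\<Sum>n\<in>{- int K..int K + 2}. \<bar>?d n\<bar>) \<le> 6 / real K"
      using sum_tent_second_diff_le[OF K, of "{- int K..int K + 2}" 0] by simp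
    show "(\<Sum>n\<in>{- int K..int K + 2}. \<bar>?d (n + h)\<bar>) \<le> 6 / real K"
      using sum_tent_second_diff_le[OF K, of "{- int K..int K + 2}" h] by simp
  qed (use K in auto)
  also have "\<dots> = 22 / real K" using K by (simp add: power2_eq_square field_simps)
  finally have 1: "(norm (1 - ee y))\<^sup>2 * norm (tent_corr K h y) \<le> 22 / real K" .
  have "(2 * \<bar>y - of_int k\<bar>)\<^sup>2 \<le> (norm (1 - ee y))\<^sup>2"
    by (intro power_mono norm_one_minus_ee_ge y) auto
  then have "(2 * \<bar>y - of_int k\<bar>)\<^sup>2 * norm (tent_corr K h y) \<le> (norm (1 - ee y))\<^sup>2 * norm (tent_corr K h y)"
    by (intro mult_right_mono) auto
  with 1 have "4 * ((y - of_int k)\<^sup>2 * norm (tent_corr K h y)) \<le> 22 / real K"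
    by (simp add: power_mult_distrib)
  then show ?thesis using K by (simp add: field_simps)
qed

definition tent_sum :: "nat \<Rightarrow> int \<Rightarrow> real \<Rightarrow> complex" where
  "tent_sum K c x = (\<Sum>n\<in>{c - int K..c + int K}. of_real (tent K (n - c)) * ee ((of_int n)\<^sup>2 * x))"

text \<open>Weyl differencing: (c + m + h)^2 - (c + m)^2 = (2 c h + h^2) + 2 m h is linear in m. The
  centre \<open>c\<close> enters only through a factor of modulus 1 for each \<open>h\<close>, so
  the bound is uniform in \<open>c\<close>.\<close>

lemma norm_tent_sum_le:
  assumes K: "K > 0"
  shows "(norm (tent_sum K c x))\<^sup>2 \<le> (\<Sum>h\<in>{- 2 * int K..2 * int K}. norm (tent_corr K h (of_int h * (2 * x))))"
proof -
  let ?I = "{- int K..int K}" and ?H = "{- 2 * int K..2 * int K}"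
  let ?w = "\<lambda>m. complex_of_real (tent K m)"
  have F: "tent_sum K c x = (\<Sum>m\<in>?I. ?w m * ee ((of_int (c + m))\<^sup>2 * x))"
    unfolding tent_sum_def
    by (rule sum.reindex_bij_witness[of _ "\<lambda>m. c + m" "\<lambda>n. n - c"]) auto
  have "of_real ((norm (tent_sum K c x))\<^sup>2) = tent_sum K c x * cnj (tent_sum K c x)"
    by (rule complex_norm_square)
  also have "\<dots> = (\<Sum>n\<in>?I. \<Sum>m\<in>?I. (?w n * ee ((of_int (c + n))\<^sup>2 * x)) * cnj (?w m * ee ((of_int (c + m))\<^sup>2 * x)))"
    unfolding F cnj_sum by (simp only: sum_product)
  also have "\<dots> = (\<Sum>m\<in>?I. \<Sum>n\<in>?I. (?w n * ee ((of_int (c + n))\<^sup>2 * x)) * cnj (?w m * ee ((of_int (c + m))\<^sup>2 * x)))"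
    by (rule sum.swap)
  also have "\<dots> = (\<Sum>m\<in>?I. \<Sum>n\<in>?I. ?w m * ?w n * ee (((of_int (c + n))\<^sup>2 - (of_int (c + m))\<^sup>2) * x))"
  proof (intro sum.cong refl)
    fix m n
    show "(?w n * ee ((of_int (c + n))\<^sup>2 * x)) * cnj (?w m * ee ((of_int (c + m))\<^sup>2 * x))
       = ?w m * ?w n * ee (((of_int (c + n))\<^sup>2 - (of_int (c + m))\<^sup>2) * x)"
      unfolding left_diff_distrib ee_diff complex_cnj_mult complex_cnj_complex_of_real by (simp only: mult_ac)
  qed
  also have "\<dots> = (\<Sum>m\<in>?I. \<Sum>h\<in>?H. ?w m * ?w (m + h) * ee (((of_int (c + (m + h)))\<^sup>2 - (of_int (c + m))\<^sup>2) * x))"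
  proof (rule sum.cong[OF refl])
    fix m assume m: "m \<in> ?I"
    have "(\<Sum>n\<in>?I. ?w m * ?w n * ee (((of_int (c + n))\<^sup>2 - (of_int (c + m))\<^sup>2) * x))
       = (\<Sum>h\<in>{- int K - m..int K - m}. ?w m * ?w (m + h) * ee (((of_int (c + (m + h)))\<^sup>2 - (of_int (c + m))\<^sup>2) * x))"
      by (rule sum.reindex_bij_witness[of _ "\<lambda>h. m + h" "\<lambda>n. n - m"]) auto
    \<comment> \<open>Lags outside the admissible window have \<open>tent K (m + h) = 0\<close>;
      enlarging to a range independent of \<open>m\<close> allows the two sums to be
      exchanged.\<close>
    also have "\<dots> = (\<Sum>h\<in>?H. ?w m * ?w (m + h) * ee (((of_int (c + (m + h)))\<^sup>2 - (of_int (c + m))\<^sup>2) * x))"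
    proof (rule sum.mono_neutral_left)
      show "\<forall>h\<in>?H - {- int K - m..int K - m}. ?w m * ?w (m + h) * ee (((of_int (c + (m + h)))\<^sup>2 - (of_int (c + m))\<^sup>2) * x) = 0"
      proof
        fix h assume "h \<in> ?H - {- int K - m..int K - m}"
        then have "tent K (m + h) = 0" by (intro tent_eq_0 K) auto
        then show "?w m * ?w (m + h) * ee (((of_int (c + (m + h)))\<^sup>2 - (of_int (c + m))\<^sup>2) * x) = 0" by simp
      qed
    qed (use m in auto)
    finally show "(\<Sum>n\<in>?I. ?w m * ?w n * ee (((of_int (c + n))\<^sup>2 - (of_int (c + m))\<^sup>2) * x))
      = (\<Sum>h\<in>?H. ?w m * ?w (m + h) * ee (((of_int (c + (m + h)))\<^sup>2 - (of_int (c + m))\<^sup>2) * x))" .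
  qed
  also have "\<dots> = (\<Sum>h\<in>?H. \<Sum>m\<in>?I. ?w m * ?w (m + h) * ee (((of_int (c + (m + h)))\<^sup>2 - (of_int (c + m))\<^sup>2) * x))"
    by (rule sum.swap)
  also have "\<dots> = (\<Sum>h\<in>?H. ee ((2 * of_int c * of_int h + (of_int h)\<^sup>2) * x) * tent_corr K h (of_int h * (2 * x)))"
  proof (rule sum.cong[OF refl])
    fix h
    have E: "ee (((of_int (c + (m + h)))\<^sup>2 - (of_int (c + m))\<^sup>2) * x)
      = ee ((2 * of_int c * of_int h + (of_int h)\<^sup>2) * x) * ee (of_int m * (of_int h * (2 * x)))" for m
      unfolding ee_add[symmetric] by (rule arg_cong[of _ _ ee]) (simp add: algebra_simps power2_eq_square)
    show "(\<Sum>m\<in>?I. ?w m * ?w (m + h) * ee (((of_int (c + (m + h)))\<^sup>2 - (of_int (c + m))\<^sup>2) * x))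
       = ee ((2 * of_int c * of_int h + (of_int h)\<^sup>2) * x) * tent_corr K h (of_int h * (2 * x))"
      unfolding tent_corr_def sum_distrib_left
      by (intro sum.cong refl) (simp only: E of_real_mult mult.assoc mult.left_commute)
  qed
  finally have "norm (complex_of_real ((norm (tent_sum K c x))\<^sup>2)) = norm (\<Sum>h\<in>?H. ee ((2 * of_int c * of_int h + (of_int h)\<^sup>2) * x) * tent_corr K h (of_int h * (2 * x)))"
    by (rule arg_cong)
  then have "(norm (tent_sum K c x))\<^sup>2 = norm (\<Sum>h\<in>?H. ee ((2 * of_int c * of_int h + (of_int h)\<^sup>2) * x) * tent_corr K h (of_int h * (2 * x)))"
    by (simp only: norm_of_real abs_power2)
  also have "\<dots> \<le> (\<Sum>h\<in>?H. norm (tent_corr K h (of_int h * (2 * x))))"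
    by (rule sum_norm_le) (simp add: norm_mult)
  finally show ?thesis .
qed

section \<open>Rational approximation\<close>

lemma sum_inverse_squares_tail:
  assumes "m \<ge> 1"
  shows "(\<Sum>k=m+1..n. 1 / (real k)\<^sup>2) \<le> 1 / real m"
proof (cases "m \<le> n")
  case True
  have "(\<Sum>k=m+1..n. 1 / (real k)\<^sup>2) \<le> 1 / real m - 1 / real n"
    using True
  proof (induction n rule: dec_induct)
    case (step n)
    have "1 / (real (Suc n))\<^sup>2 \<le> 1 / real n - 1 / real (Suc n)"
      using step assms by (simp add: divide_simps power2_eq_square)
    then show ?case using step by simp
  qed auto
  also have "\<dots> \<le> 1 / real m" by simp
  finally show ?thesis .
qed auto

lemma sum_inverse_squares_le_2: "(\<Sum>k=1..n. 1 / (real k)\<^sup>2) \<le> 2"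
proof (cases "n \<ge> 1")
  case True
  then have "(\<Sum>k=1..n. 1 / (real k)\<^sup>2) = 1 + (\<Sum>k=1+1..n. 1 / (real k)\<^sup>2)"
    by (simp add: sum.atLeast_Suc_atMost)
  with sum_inverse_squares_tail[of 1 n] show ?thesis by simp
qed auto

text \<open>The two bounds cross at k = sqrt(B/A): about that many terms of size A, followed by a
  tail B/k of the same size sqrt(A B).\<close>

lemma sum_min_inverse_square_le:
  fixes A B :: real
  assumes "A > 0" "B > 0"
  shows "(\<Sum>k=1..n. min A (B / (real k)\<^sup>2)) \<le> 3 * sqrt (A * B)"
proof (cases "B \<le> A")
  case True
  have "(\<Sum>k=1..n. min A (B / (real k)\<^sup>2)) \<le> (\<Sum>k=1..n. B * (1 / (real k)\<^sup>2))"
    by (intro sum_mono) simp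
  also have "\<dots> \<le> B * 2"
    unfolding sum_distrib_left[symmetric] using assms by (intro mult_left_mono sum_inverse_squares_le_2) auto
  also have "B \<le> sqrt (A * B)" using True assms by (intro real_le_rsqrt) (simp add: power2_eq_square)
  finally show ?thesis using assms by (smt (verit) real_sqrt_ge_zero mult_nonneg_nonneg)
next
  case False
  define m where "m = nat \<lfloor>sqrt (B / A)\<rfloor>"
  have ge1: "sqrt (B / A) \<ge> 1" using False assms by simp
  have m1: "m \<ge> 1" unfolding m_def using ge1 by (simp add: le_nat_iff)
  have m2: "real m \<le> sqrt (B / A)" unfolding m_def using ge1 by (simp add: of_nat_nat)
  have m3: "sqrt (B / A) < 2 * real m"
  proof -
    have "sqrt (B / A) < real m + 1" unfolding m_def using ge1 by linarith
    then show ?thesis using m1 by simp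
  qed
  have "(\<Sum>k=1..n. min A (B / (real k)\<^sup>2)) \<le> (\<Sum>k\<in>{1..m} \<union> {m+1..n}. min A (B / (real k)\<^sup>2))"
    by (intro sum_mono2) (use assms in auto)
  also have "\<dots> = (\<Sum>k=1..m. min A (B / (real k)\<^sup>2)) + (\<Sum>k=m+1..n. min A (B / (real k)\<^sup>2))"
    by (intro sum.union_disjoint) auto
  also have "\<dots> \<le> (\<Sum>k=1..m. A) + (\<Sum>k=m+1..n. B * (1 / (real k)\<^sup>2))"
    by (intro add_mono sum_mono) auto
  also have "\<dots> \<le> real m * A + B * (1 / real m)"
    unfolding sum_distrib_left[symmetric]
    using assms m1 by (intro add_mono mult_left_mono sum_inverse_squares_tail) auto
  also have "real m * A \<le> sqrt (A * B)"
  proof -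
    have "real m * A \<le> sqrt (B / A) * A" using m2 assms by (intro mult_right_mono) auto
    also have "sqrt (B / A) * A = sqrt (A * B)"
      using assms by (simp add: real_sqrt_divide real_sqrt_mult field_simps)
    finally show ?thesis .
  qed
  also have "B * (1 / real m) \<le> 2 * sqrt (A * B)"
  proof -
    have "B / real m \<le> B / (sqrt (B / A) / 2)"
    proof (intro divide_left_mono mult_pos_pos)
      show "0 < real m" using m1 by simp
      show "0 < sqrt (B / A) / 2" using ge1 by simp
    qed (use m3 assms in auto)
    also have "\<dots> = 2 * sqrt (A * B)"
      using assms by (simp add: real_sqrt_divide real_sqrt_mult field_simps)
    finally show ?thesis by simp
  qed
  finally show ?thesis by simp
qed

text \<open>Within one residue class the quotient by q determines the element, so it suffices to
  count the quotients.\<close>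

lemma card_residue_class_le:
  fixes q b M :: int
  assumes "q > 0" "M \<ge> 0"
  shows "real (card {h \<in> {-M..M}. h mod q = b}) \<le> 2 * of_int M / of_int q + 2"
proof -
  let ?S = "{h \<in> {-M..M}. h mod q = b}"
  have inj: "inj_on (\<lambda>h. h div q) ?S"
    by (rule inj_onI) (metis (mono_tags, lifting) mem_Collect_eq mult_div_mod_eq)
  have "(\<lambda>h. h div q) ` ?S \<subseteq> {(-M) div q..M div q}"
    using assms by (auto intro: zdiv_mono1)
  then have "card ?S \<le> card {(-M) div q..M div q}"
    using inj by (metis card_image card_mono finite_atLeastAtMost_int)
  also have "\<dots> = nat (M div q - (-M) div q + 1)" by simp
  finally have "card ?S \<le> nat (M div q - (-M) div q + 1)" .
  moreover have "(-M) div q \<le> M div q" using assms by (intro zdiv_mono1) auto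
  ultimately have 1: "real (card ?S) \<le> of_int (M div q) - of_int ((-M) div q) + 1" by linarith
  have 2: "real_of_int (M div q) \<le> of_int M / of_int q"
    by (rule real_of_int_div4)
  have "of_int (-M) / of_int q - real_of_int ((-M) div q) \<le> 1"
    by (rule real_of_int_div3)
  moreover have "of_int (-M) / of_int q = - (real_of_int M / of_int q)"
    "2 * of_int M / of_int q = real_of_int M / of_int q + of_int M / of_int q" by simp_all
  ultimately show ?thesis using 1 2 by linarith
qed

text \<open>\<open>V h\<close> stands for the size of the correlation at lag h and frequency h th:
  at most 3K, and at most 6/(K dist^2) at distance dist from an integer. If q does not divide h, the
  distance of h a/q to the integers survives up to a factor 2; summing inverse squares over
  residues, each attained O(K/q) times, gives O(q), hence O(K). If h = q k, the distance is |k| q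
  |be|, and the total is O(K + min(K^2/q, 1/(q |be|))). Since q <= 4K and q |be| <= 1/(4K), both
  parts are O(1/(q (1/K^2 + |be|))).\<close>

lemma sum_arc_le:
  fixes V :: "int \<Rightarrow> real" and a q :: int and th :: real and K :: nat
  assumes K: "K > 0" and q: "0 < q" "q \<le> 4 * int K" and cop: "coprime a q"
    and th: "\<bar>of_int q * th - of_int a\<bar> \<le> 1 / (4 * real K)"
    and V0: "\<And>h. 0 \<le> V h" and V1: "\<And>h. V h \<le> 3 * real K"
    and V2: "\<And>h k. \<bar>of_int h * th - of_int k\<bar> \<le> 1/2 \<Longrightarrow> V h * real K * (of_int h * th - of_int k)\<^sup>2 \<le> 6"
  shows "(\<Sum>h\<in>{- 2 * int K..2 * int K}. V h) * (of_int q * (1 / (real K)\<^sup>2 + \<bar>th - of_int a / of_int q\<bar>)) \<le> 40000"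
proof -
  let ?M = "2 * int K"
  define be where "be = th - of_int a / of_int q"
  have qbe: "of_int q * be = of_int q * th - of_int a" using q by (simp add: be_def field_simps)
  have be: "of_int q * \<bar>be\<bar> \<le> 1 / (4 * real K)"
    using th q qbe by (metis abs_mult abs_of_pos of_int_0_less_iff)
  \<comment> \<open>This explains the order 4K of the approximation: for |h| <= 2K the perturbation
    stays within half of the spacing 1/q.\<close>
  have hbe: "\<bar>of_int h * be\<bar> \<le> 1 / (2 * of_int q)" if "h \<in> {-?M..?M}" for h
  proof -
    have "\<bar>be\<bar> \<le> 1 / (4 * real K * of_int q)" using be q K by (simp add: field_simps)
    then have "\<bar>of_int h\<bar> * \<bar>be\<bar> \<le> (2 * real K) * (1 / (4 * real K * of_int q))"
      using that by (intro mult_mono) auto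
    also have "\<dots> = 1 / (2 * of_int q)" using K by simp
    finally show ?thesis by (simp add: abs_mult)
  qed
  have hth: "of_int h * th = of_int (h * a) / of_int q + of_int h * be" for h
    using q by (simp add: be_def algebra_simps)
  let ?A = "{h \<in> {-?M..?M}. \<not> q dvd h}" and ?B = "{h \<in> {-?M..?M}. q dvd h}"
  have finP: "finite {h \<in> {-?M..?M}. P h}" for P by (rule finite_subset[of _ "{-?M..?M}"]) auto
  have fin: "finite ?A" "finite ?B" by (rule finP)+
  have split: "(\<Sum>h\<in>{- 2 * int K..2 * int K}. V h) = (\<Sum>h\<in>?A. V h) + (\<Sum>h\<in>?B. V h)"
  proof -
    have "(\<Sum>h\<in>?A. V h) + (\<Sum>h\<in>?B. V h) = (\<Sum>h\<in>?A \<union> ?B. V h)"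
      by (intro sum.union_disjoint[symmetric] fin) auto
    also have "?A \<union> ?B = {- 2 * int K..2 * int K}" by auto
    finally show ?thesis by simp
  qed
  define f where "f = (\<lambda>r::int. 24 * (of_int q)\<^sup>2 / real K * (1 / (of_int r)\<^sup>2 + 1 / (of_int (q - r))\<^sup>2))"
  have f0: "f r \<ge> 0" for r by (simp add: f_def)
  have VA: "V h \<le> f ((a * h) mod q)" if h: "h \<in> ?A" for h
  proof -
    define r where "r = (a * h) mod q"
    have "\<not> q dvd a * h" using h cop by (simp add: coprime_commute coprime_dvd_mult_right_iff)
    then have r: "0 < r" "r < q"
      using q pos_mod_bound[of q "a * h"] pos_mod_sign[of q "a * h"]
      by (auto simp: r_def dvd_eq_mod_eq_0 order_less_le)
    define k where "k = round (of_int h * th)"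
    have k: "\<bar>of_int h * th - of_int k\<bar> \<le> 1/2"
      unfolding k_def using of_int_round_abs_le[of "of_int h * th"] by (simp add: abs_minus_commute)
    define d where "d = h * a - k * q"
    \<comment> \<open>Distance of \<open>a * h\<close> to the nearest multiple of \<open>q\<close>.
      It is at least 1, so the perturbation bounded in \<open>hbe\<close> removes at most half of
      rho/q.\<close>
    define rho where "rho = min r (q - r)"
    have rho: "rho \<ge> 1" using r by (auto simp: rho_def)
    have "d = r + q * ((a * h) div q - k)"
      unfolding d_def r_def by (simp add: algebra_simps minus_mult_div_eq_mod[symmetric])
    moreover have "rho \<le> \<bar>r + q * j\<bar>" for j
    proof (cases "j \<ge> 0")
      case True
      then have "q * j \<ge> 0" using q by simp
      then show ?thesis using r by (simp add: rho_def)
    next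
      case False
      then have "q * j \<le> q * (-1)" using q by (intro mult_left_mono) auto
      then show ?thesis using r by (simp add: rho_def)
    qed
    ultimately have d: "rho \<le> \<bar>d\<bar>" by simp
    have "of_int h * th - of_int k = of_int d / of_int q + of_int h * be"
      unfolding hth d_def using q by (simp add: field_simps)
    then have "\<bar>of_int h * th - of_int k\<bar> \<ge> \<bar>of_int d / of_int q\<bar> - \<bar>of_int h * be\<bar>" by linarith
    moreover have "\<bar>of_int d / of_int q\<bar> \<ge> real_of_int rho / of_int q"
    proof -
      have "real_of_int rho \<le> \<bar>of_int d\<bar>" using d by linarith
      then show ?thesis using q by (simp add: abs_divide divide_right_mono)
    qed
    moreover have "\<bar>of_int h * be\<bar> \<le> of_int rho / (2 * of_int q)"
    proof -
      have "\<bar>of_int h * be\<bar> \<le> 1 / (2 * of_int q)" using hbe h by blast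
      also have "\<dots> \<le> of_int rho / (2 * of_int q)" using rho q by (intro divide_right_mono) auto
      finally show ?thesis .
    qed
    ultimately have "of_int rho / (2 * of_int q) \<le> \<bar>of_int h * th - of_int k\<bar>" by (simp add: field_simps)
    then have "(of_int rho / (2 * of_int q))\<^sup>2 \<le> \<bar>of_int h * th - of_int k\<bar>\<^sup>2"
      using rho q by (intro power_mono) auto
    then have "V h * real K * (of_int rho / (2 * of_int q))\<^sup>2 \<le> V h * real K * (of_int h * th - of_int k)\<^sup>2"
      using V0 by (intro mult_left_mono) auto
    also have "\<dots> \<le> 6" by (rule V2[OF k])
    finally have "V h \<le> 24 * (of_int q)\<^sup>2 / real K * (1 / (of_int rho)\<^sup>2)"
      using K q rho by (simp add: field_simps power2_eq_square)
    also have "\<dots> \<le> f r" unfolding f_def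
    proof (intro mult_left_mono)
      show "1 / (real_of_int rho)\<^sup>2 \<le> 1 / (of_int r)\<^sup>2 + 1 / (of_int (q - r))\<^sup>2"
        by (auto simp: rho_def min_def)
    qed auto
    finally show ?thesis by (simp add: r_def)
  qed
  have sumf: "(\<Sum>r\<in>{1..<q}. f r) \<le> 96 * (of_int q)\<^sup>2 / real K"
  proof -
    have 1: "(\<Sum>r\<in>{1..<q}. 1 / (real_of_int r)\<^sup>2) \<le> 2"
    proof -
      have "(\<Sum>r\<in>{1..<q}. 1 / (real_of_int r)\<^sup>2) = (\<Sum>k=1..nat (q - 1). 1 / (real k)\<^sup>2)"
        by (rule sum.reindex_bij_witness[of _ int nat]) auto
      then show ?thesis using sum_inverse_squares_le_2 by simp
    qed
    have 2: "(\<Sum>r\<in>{1..<q}. 1 / (real_of_int (q - r))\<^sup>2) = (\<Sum>r\<in>{1..<q}. 1 / (real_of_int r)\<^sup>2)"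
      by (rule sum.reindex_bij_witness[of _ "\<lambda>r. q - r" "\<lambda>r. q - r"]) auto
    have "(\<Sum>r\<in>{1..<q}. f r) = 24 * (of_int q)\<^sup>2 / real K * ((\<Sum>r\<in>{1..<q}. 1 / (real_of_int r)\<^sup>2) + (\<Sum>r\<in>{1..<q}. 1 / (real_of_int (q - r))\<^sup>2))"
      unfolding f_def by (simp only: sum_distrib_left[symmetric] sum.distrib)
    also have "\<dots> \<le> 24 * (of_int q)\<^sup>2 / real K * (2 + 2)"
      using 1 2 by (intro mult_left_mono) auto
    finally show ?thesis by simp
  qed
  have partA: "(\<Sum>h\<in>?A. V h) \<le> 4608 * real K"
  proof -
    have "(\<Sum>h\<in>?A. V h) \<le> (\<Sum>h\<in>?A. f ((a * h) mod q))" by (intro sum_mono VA)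
    also have "\<dots> = (\<Sum>r\<in>{1..<q}. \<Sum>h\<in>{h\<in>?A. (a * h) mod q = r}. f ((a * h) mod q))"
    proof (rule sum.group[symmetric])
      show "(\<lambda>h. a * h mod q) ` ?A \<subseteq> {1..<q}"
      proof
        fix r assume "r \<in> (\<lambda>h. a * h mod q) ` ?A"
        then obtain h where h: "h \<in> ?A" "r = a * h mod q" by blast
        have "\<not> q dvd a * h" using h cop by (simp add: coprime_commute coprime_dvd_mult_right_iff)
        then have "0 < a * h mod q" "a * h mod q < q" using q pos_mod_bound[of q "a*h"] pos_mod_sign[of q "a*h"]
          by (auto simp: dvd_eq_mod_eq_0 order_less_le)
        then show "r \<in> {1..<q}" using h(2) by simp
      qed
    qed (use fin in auto)
    also have "\<dots> = (\<Sum>r\<in>{1..<q}. real (card {h\<in>?A. (a * h) mod q = r}) * f r)"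
      by (intro sum.cong refl) simp
    also have "\<dots> \<le> (\<Sum>r\<in>{1..<q}. (2 * of_int ?M / of_int q + 2) * f r)"
    proof (intro sum_mono mult_right_mono f0)
      fix r
      show "real (card {h\<in>?A. (a * h) mod q = r}) \<le> 2 * of_int ?M / of_int q + 2"
      proof (cases "{h\<in>?A. (a * h) mod q = r} = {}")
        case True
        have "real (card {h\<in>?A. (a * h) mod q = r}) = 0" unfolding True by simp
        moreover have "0 \<le> 2 * real_of_int ?M / of_int q + 2" using q by simp
        ultimately show ?thesis by linarith
      next
        case False
        then obtain h0 where h0: "(a * h0) mod q = r" by blast
        \<comment> \<open>As \<open>a\<close> is invertible modulo \<open>q\<close>, prescribing the
          residue of \<open>a * h\<close> prescribes that of \<open>h\<close>.\<close>
        have "{h\<in>?A. (a * h) mod q = r} \<subseteq> {h \<in> {-?M..?M}. h mod q = h0 mod q}"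
        proof (rule subsetI)
          fix h assume "h \<in> {h\<in>?A. (a * h) mod q = r}"
          then have h: "h \<in> {-?M..?M}" "r = a * h mod q" by simp_all
          then have "[a * h = a * h0] (mod q)" using h0 by (simp add: cong_def)
          then have "[h = h0] (mod q)" using cop by (simp add: cong_mult_lcancel)
          then show "h \<in> {h \<in> {-?M..?M}. h mod q = h0 mod q}" using h(1) by (simp add: cong_def)
        qed
        then have "card {h\<in>?A. (a * h) mod q = r} \<le> card {h \<in> {-?M..?M}. h mod q = h0 mod q}"
          by (intro card_mono finP)
        then show ?thesis using card_residue_class_le[of q ?M "h0 mod q"] q by linarith
      qed
    qed
    also have "\<dots> = (2 * of_int ?M / of_int q + 2) * (\<Sum>r\<in>{1..<q}. f r)"
      by (simp only: sum_distrib_left)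
    also have "\<dots> \<le> (2 * of_int ?M / of_int q + 2) * (96 * (of_int q)\<^sup>2 / real K)"
      using q by (intro mult_left_mono sumf) auto
    also have "\<dots> = 96 * (4 * of_int q + 2 * of_int q * (of_int q / real K))"
      using q K by (simp add: field_simps power2_eq_square)
    also have "\<dots> \<le> 96 * (4 * (4 * real K) + 2 * (4 * real K) * 4)"
    proof -
      have "real_of_int q \<le> 4 * real K" using q by linarith
      moreover from this have "of_int q / real K \<le> 4" using K by (simp add: field_simps)
      ultimately show ?thesis using q by (intro mult_left_mono add_mono mult_mono) auto
    qed
    finally show ?thesis by simp
  qed
  have K1: "real K * of_int q \<le> 4 * (real K)\<^sup>2"
  proof -
    have "real_of_int q \<le> 4 * real K" using q by linarith
    then have "real K * of_int q \<le> real K * (4 * real K)" by (intro mult_left_mono) auto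
    then show ?thesis by (simp add: power2_eq_square)
  qed
  have K2: "real K * (of_int q * \<bar>be\<bar>) \<le> 1/4"
    using mult_left_mono[OF be, of "real K"] K by simp
  have B0: "0 \<le> (\<Sum>h\<in>?B. V h)" by (intro sum_nonneg V0)
  have partB1: "(\<Sum>h\<in>?B. V h) * of_int q \<le> 36 * (real K)\<^sup>2"
  proof -
    have "(\<Sum>h\<in>?B. V h) \<le> (\<Sum>h\<in>?B. 3 * real K)" by (intro sum_mono V1)
    also have "\<dots> = real (card ?B) * (3 * real K)" by simp
    also have "\<dots> \<le> (2 * of_int ?M / of_int q + 2) * (3 * real K)"
      using card_residue_class_le[of q ?M 0] q by (intro mult_right_mono) (auto simp: dvd_eq_mod_eq_0)
    finally have "(\<Sum>h\<in>?B. V h) * of_int q \<le> (2 * of_int ?M / of_int q + 2) * (3 * real K) * of_int q"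
      using q by (intro mult_right_mono) auto
    also have "\<dots> = 12 * (real K)\<^sup>2 + 6 * (real K * of_int q)"
      using q by (simp add: field_simps power2_eq_square)
    finally show ?thesis using K1 by linarith
  qed
  \<comment> \<open>For be = 0 the claim is trivial. Otherwise the multiples h = q k obey min(3K,
    B/k^2), which \<open>sum_min_inverse_square_le\<close> sums to O(1/c) on each side of 0.\<close>
  have partB2: "(\<Sum>h\<in>?B. V h) * (of_int q * \<bar>be\<bar>) \<le> 41"
  proof (cases "be = 0")
    case False
    define c where "c = of_int q * \<bar>be\<bar>"
    have c: "c > 0" using False q by (simp add: c_def)
    define B where "B = 6 / (real K * c\<^sup>2)"
    have B: "B > 0" using K c by (simp add: B_def)
    have Vk: "V (q * k) \<le> B / (of_int k)\<^sup>2" if "q * k \<in> {-?M..?M}" "k \<noteq> 0" for k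
    proof -
      have eq: "of_int (q * k) * th - of_int (a * k) = of_int (q * k) * be"
        unfolding hth using q by simp
      have "\<bar>of_int (q * k) * be\<bar> \<le> 1 / (2 * of_int q)" by (rule hbe[OF that(1)])
      also have "\<dots> \<le> 1/2" using q by (simp add: field_simps)
      finally have "V (q * k) * real K * (of_int (q * k) * be)\<^sup>2 \<le> 6"
        using V2[of "q * k" "a * k"] unfolding eq by blast
      moreover have "(of_int (q * k) * be)\<^sup>2 = (of_int k)\<^sup>2 * c\<^sup>2"
        unfolding c_def by (simp add: power_mult_distrib)
      ultimately have "V (q * k) * (real K * c\<^sup>2 * (of_int k)\<^sup>2) \<le> 6" by (simp add: mult_ac)
      then have "V (q * k) \<le> 6 / (real K * c\<^sup>2 * (of_int k)\<^sup>2)"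
        using K c that by (subst pos_le_divide_eq) auto
      then show ?thesis by (simp add: B_def)
    qed
    have ksI: "k * sg > 0" if "q * k * sg > 0" for k sg :: int
      using that q by (metis mult.assoc zero_less_mult_pos)
    let ?m = "\<lambda>k::nat. min (3 * real K) (B / (real k)\<^sup>2)"
    \<comment> \<open>The sign \<open>sg\<close> treats positive and negative multiples of
      \<open>q\<close> together, both indexed by the positive integer
      \<open>h * sg div q\<close>.\<close>
    have pos: "(\<Sum>h\<in>{h\<in>{-?M..?M}. q dvd h \<and> h * sg > 0}. V h) \<le> 3 * sqrt (3 * real K * B)"
      if sg: "sg = 1 \<or> sg = -1" for sg :: int
    proof -
      have "(\<Sum>h\<in>{h\<in>{-?M..?M}. q dvd h \<and> h * sg > 0}. V h) \<le> (\<Sum>h\<in>{h\<in>{-?M..?M}. q dvd h \<and> h * sg > 0}. ?m (nat (h * sg div q)))"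
      proof (rule sum_mono)
        fix h assume h: "h \<in> {h\<in>{-?M..?M}. q dvd h \<and> h * sg > 0}"
        then obtain k where k: "h = q * k" by (auto elim: dvdE)
        have ks: "k * sg > 0" using h k ksI[of k sg] by simp
        have "real (nat (h * sg div q)) = of_int (k * sg)"
          using k q ks by (simp add: mult.assoc)
        then have "(real (nat (h * sg div q)))\<^sup>2 = (of_int k)\<^sup>2"
          using sg by (auto simp: power2_eq_square)
        moreover have "V h \<le> B / (of_int k)\<^sup>2"
        proof -
          have "k \<noteq> 0" using ks by auto
          moreover have "q * k \<in> {-?M..?M}" using h k by simp
          ultimately show ?thesis using Vk[of k] k by blast
        qed
        ultimately show "V h \<le> ?m (nat (h * sg div q))" using V1[of h] by simp
      qed
      also have "\<dots> = (\<Sum>k\<in>(\<lambda>h. nat (h * sg div q)) ` {h\<in>{-?M..?M}. q dvd h \<and> h * sg > 0}. ?m k)"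
      proof (subst sum.reindex)
        show "inj_on (\<lambda>h. nat (h * sg div q)) {h\<in>{-?M..?M}. q dvd h \<and> h * sg > 0}"
        proof (rule inj_onI)
          fix h h' assume h: "h \<in> {h\<in>{-?M..?M}. q dvd h \<and> h * sg > 0}" "h' \<in> {h\<in>{-?M..?M}. q dvd h \<and> h * sg > 0}"
            "nat (h * sg div q) = nat (h' * sg div q)"
          then obtain k k' where k: "h = q * k" "h' = q * k'" by (auto elim!: dvdE)
          have kk: "k * sg > 0" "k' * sg > 0" using h k ksI[of k sg] ksI[of k' sg] by simp_all
          have "nat (k * sg) = nat (k' * sg)" using h(3) k q by (simp add: mult.assoc)
          with kk have "k * sg = k' * sg" by linarith
          then show "h = h'" using k sg by auto
        qed
      qed simp
      also have "\<dots> \<le> (\<Sum>k=1..2*K. ?m k)"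
      proof (rule sum_mono2)
        show "(\<lambda>h. nat (h * sg div q)) ` {h\<in>{-?M..?M}. q dvd h \<and> h * sg > 0} \<subseteq> {1..2*K}"
        proof (rule image_subsetI)
          fix h assume "h \<in> {h\<in>{-?M..?M}. q dvd h \<and> h * sg > 0}"
          then have h: "h \<in> {-?M..?M}" "q dvd h" "0 < h * sg" by simp_all
          then obtain k where k: "h = q * k" by (auto elim: dvdE)
          have ks: "k * sg > 0" using h k ksI[of k sg] by simp
          have "1 * (k * sg) \<le> q * (k * sg)" using q ks by (intro mult_right_mono) auto
          also have "q * (k * sg) \<le> ?M" using h sg k by (auto simp: mult.assoc)
          finally show "nat (h * sg div q) \<in> {1..2*K}" using ks k q by (auto simp: mult.assoc)
        qed
      qed (use B in auto)
      also have "\<dots> \<le> 3 * sqrt (3 * real K * B)"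
        by (intro sum_min_inverse_square_le) (use K B in auto)
      finally show ?thesis .
    qed
    have "?B = {0} \<union> {h\<in>{-?M..?M}. q dvd h \<and> h * 1 > 0} \<union> {h\<in>{-?M..?M}. q dvd h \<and> h * (-1) > 0}" by auto
    then have "(\<Sum>h\<in>?B. V h) = (\<Sum>h\<in>{0} \<union> {h\<in>{-?M..?M}. q dvd h \<and> h * 1 > 0} \<union> {h\<in>{-?M..?M}. q dvd h \<and> h * (-1) > 0}. V h)"
      by (rule arg_cong)
    also have "\<dots> = V 0 + (\<Sum>h\<in>{h\<in>{-?M..?M}. q dvd h \<and> h * 1 > 0}. V h) + (\<Sum>h\<in>{h\<in>{-?M..?M}. q dvd h \<and> h * (-1) > 0}. V h)"
    proof -
      have "(\<Sum>h\<in>({0} \<union> {h\<in>{-?M..?M}. q dvd h \<and> h * 1 > 0}) \<union> {h\<in>{-?M..?M}. q dvd h \<and> h * (-1) > 0}. V h)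
        = (\<Sum>h\<in>{0} \<union> {h\<in>{-?M..?M}. q dvd h \<and> h * 1 > 0}. V h) + (\<Sum>h\<in>{h\<in>{-?M..?M}. q dvd h \<and> h * (-1) > 0}. V h)"
        by (intro sum.union_disjoint finite_UnI finP) auto
      also have "(\<Sum>h\<in>{0} \<union> {h\<in>{-?M..?M}. q dvd h \<and> h * 1 > 0}. V h) = (\<Sum>h\<in>{0}. V h) + (\<Sum>h\<in>{h\<in>{-?M..?M}. q dvd h \<and> h * 1 > 0}. V h)"
        by (intro sum.union_disjoint finP) auto
      finally show ?thesis by (simp only: sum.insert sum.empty finite.emptyI empty_iff not_False_eq_True add_0_right)
    qed
    also have "\<dots> \<le> 3 * real K + 3 * sqrt (3 * real K * B) + 3 * sqrt (3 * real K * B)"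
      by (intro add_mono V1 pos) auto
    also have "sqrt (3 * real K * B) \<le> 5 / c"
    proof -
      have "3 * real K * B = 18 / c\<^sup>2" using K by (simp add: B_def)
      also have "\<dots> \<le> (5 / c)\<^sup>2" using c by (simp add: power_divide divide_right_mono)
      finally show ?thesis using c by (intro real_le_lsqrt) (auto simp: B_def)
    qed
    finally have "(\<Sum>h\<in>?B. V h) \<le> 3 * real K + 30 / c" by simp
    then have "(\<Sum>h\<in>?B. V h) * c \<le> (3 * real K + 30 / c) * c" using c by (intro mult_right_mono) auto
    also have "\<dots> = 3 * (real K * c) + 30" using c by (simp add: algebra_simps)
    finally show ?thesis using K2 by (simp add: c_def)
  qed simp
  let ?S = "(\<Sum>h\<in>?A. V h) + (\<Sum>h\<in>?B. V h)"
  \<comment> \<open>18468 = 4 * 4608 + 36 and, below, 1193 = 4608/4 + 41, from the two parts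
    together with \<open>K1\<close> and \<open>K2\<close>; 40000 leaves room above their
    sum.\<close>
  have S1: "?S * of_int q \<le> 18468 * (real K)\<^sup>2"
  proof -
    have "(\<Sum>h\<in>?A. V h) * of_int q \<le> 4608 * real K * of_int q"
      using partA q by (intro mult_right_mono) auto
    then show ?thesis using partB1 K1 by (simp add: distrib_right)
  qed
  have S2: "?S * (of_int q * \<bar>be\<bar>) \<le> 1193"
  proof -
    have "(\<Sum>h\<in>?A. V h) * (of_int q * \<bar>be\<bar>) \<le> 4608 * real K * (of_int q * \<bar>be\<bar>)"
      using partA q by (intro mult_right_mono) auto
    then show ?thesis using partB2 K2 by (simp add: distrib_right)
  qed
  have "?S * (of_int q * (1 / (real K)\<^sup>2 + \<bar>be\<bar>)) = ?S * of_int q / (real K)\<^sup>2 + ?S * (of_int q * \<bar>be\<bar>)"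
  proof -
    have "S * (Q * (1 / k + b)) = S * Q / k + S * (Q * b)" for S Q k b :: real
      by (simp add: distrib_left)
    then show ?thesis .
  qed
  also have "?S * of_int q / (real K)\<^sup>2 \<le> 18468"
    using S1 K by (subst pos_divide_le_eq) auto
  finally show ?thesis using S2 unfolding split be_def[symmetric] by linarith
qed

section \<open>Tent sums on Dirichlet arcs and their moments\<close>

lemma norm_tent_sum_arc:
  assumes K: "K > 0" and x: "x \<in> {0..1}"
  shows "\<exists>q\<in>{1..4*K}. \<exists>a\<in>{0..2*q}. (norm (tent_sum K c x))\<^sup>2
           \<le> 40000 / (real q * (1 / (real K)\<^sup>2 + \<bar>2 * x - real a / real q\<bar>))"
proof -
  have "4 * K > 0" using K by simp
  \<comment> \<open>The approximation error of \<open>of_int q * (2 * x)\<close> is below 1/4, so 0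
    <= 2x <= 2 forces the integer numerator into [0, 2q].\<close>
  then obtain a q :: int where aq: "coprime a q" "0 < q" "q \<le> int (4 * K)"
    "\<bar>of_int q * (2 * x) - of_int a\<bar> < 1 / real (4 * K)"
    by (rule Dirichlet_approx_coprime)
  have le: "1 / real (4 * K) \<le> 1/4" using K by (simp add: field_simps)
  have "0 \<le> of_int q * (2 * x)" using aq x by simp
  with aq(4) le have "- 1 < real_of_int a" by linarith
  then have a0: "0 \<le> a" by linarith
  have "of_int q * (2 * x) \<le> of_int q * 2" using aq x by (intro mult_left_mono) auto
  with aq(4) le have "real_of_int a < 2 * of_int q + 1" by linarith
  then have a1: "a \<le> 2 * q" by linarith
  let ?S = "\<Sum>h\<in>{- 2 * int K..2 * int K}. norm (tent_corr K h (of_int h * (2 * x)))"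
  have "?S * (of_int q * (1 / (real K)\<^sup>2 + \<bar>2 * x - of_int a / of_int q\<bar>)) \<le> 40000"
  proof (rule sum_arc_le)
    show "\<bar>of_int q * (2 * x) - of_int a\<bar> \<le> 1 / (4 * real K)" using aq(4) by simp
  qed (use K aq norm_tent_corr_le_trivial norm_tent_corr_le in auto)
  moreover have "of_int q * (1 / (real K)\<^sup>2 + \<bar>2 * x - of_int a / of_int q\<bar>) > 0"
    using aq K by (intro mult_pos_pos add_pos_nonneg) auto
  ultimately have "?S \<le> 40000 / (of_int q * (1 / (real K)\<^sup>2 + \<bar>2 * x - of_int a / of_int q\<bar>))"
    by (simp add: pos_le_divide_eq)
  with norm_tent_sum_le[OF K, of c x]
  have "(norm (tent_sum K c x))\<^sup>2 \<le> 40000 / (real (nat q) * (1 / (real K)\<^sup>2 + \<bar>2 * x - real (nat a) / real (nat q)\<bar>))"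
    using aq a0 by simp
  moreover have "nat q \<in> {1..4*K}" "nat a \<in> {0..2 * nat q}" using aq a0 a1 by auto
  ultimately show ?thesis by blast
qed

lemma integral_inverse_powr_le:
  fixes c u r :: real
  assumes c: "c > 0" and u: "0 \<le> u" "u \<le> 2" and r: "r > 1"
  shows "integral {0..1} (\<lambda>x. (c + \<bar>2 * x - u\<bar>) powr (- r)) \<le> c powr (1 - r) / (r - 1)"
proof -
  let ?f = "\<lambda>x. (c + \<bar>2 * x - u\<bar>) powr (- r)"
  let ?G = "\<lambda>x. (c + u - 2 * x) powr (1 - r) / (2 * (r - 1))"
  let ?F = "\<lambda>x. (- ((c + 2 * x - u) powr (1 - r))) / (2 * (r - 1))"
  have L: "(?f has_integral (?G (u/2) - ?G 0)) {0..u/2}"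
  proof (rule fundamental_theorem_of_calculus)
    fix x assume x: "x \<in> {0..u/2}"
    have "((\<lambda>x. (c + u - 2 * x) powr (1 - r)) has_real_derivative 2 * (r - 1) * (c + u - 2 * x) powr (- r)) (at x within {0..u/2})"
      using c x by (auto intro!: derivative_eq_intros simp: algebra_simps)
    from DERIV_cdivide[OF this, of "2 * (r - 1)"]
    have "(?G has_real_derivative (c + u - 2 * x) powr (- r)) (at x within {0..u/2})" using r by simp
    moreover have "c + \<bar>2 * x - u\<bar> = c + u - 2 * x" using x by auto
    ultimately show "(?G has_vector_derivative ?f x) (at x within {0..u/2})"
      by (simp only: has_real_derivative_iff_has_vector_derivative)
  qed (use u in auto)
  have R: "(?f has_integral (?F 1 - ?F (u/2))) {u/2..1}"
  proof (rule fundamental_theorem_of_calculus)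
    fix x assume x: "x \<in> {u/2..1}"
    have "((\<lambda>x. - ((c + 2 * x - u) powr (1 - r))) has_real_derivative 2 * (r - 1) * (c + 2 * x - u) powr (- r)) (at x within {u/2..1})"
      using c x by (auto intro!: derivative_eq_intros simp: algebra_simps)
    from DERIV_cdivide[OF this, of "2 * (r - 1)"]
    have "(?F has_real_derivative (c + 2 * x - u) powr (- r)) (at x within {u/2..1})" using r by simp
    moreover have "c + \<bar>2 * x - u\<bar> = c + 2 * x - u" using x by auto
    ultimately show "(?F has_vector_derivative ?f x) (at x within {u/2..1})"
      by (simp only: has_real_derivative_iff_has_vector_derivative)
  qed (use u in auto)
  have "(?f has_integral ((?G (u/2) - ?G 0) + (?F 1 - ?F (u/2)))) {0..1}"
    by (rule has_integral_combine[OF _ _ L R]) (use u in auto)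
  then have "integral {0..1} ?f = (?G (u/2) - ?G 0) + (?F 1 - ?F (u/2))" by (rule integral_unique)
  also have "\<dots> \<le> ?G (u/2) - ?F (u/2)"
  proof -
    have "?G 0 \<ge> 0" using r by (intro divide_nonneg_pos) auto
    moreover have "?F 1 \<le> 0" using r by (intro divide_nonpos_pos) auto
    ultimately show ?thesis by linarith
  qed
  also have "\<dots> = c powr (1 - r) / (r - 1) / 2 + c powr (1 - r) / (r - 1) / 2"
    by (simp add: divide_divide_eq_left mult.commute)
  also have "\<dots> = c powr (1 - r) / (r - 1)" by (rule field_sum_of_halves)
  finally show ?thesis .
qed

lemma continuous_on_tent_sum [continuous_intros]: "continuous_on A (tent_sum K c)"
  unfolding tent_sum_def by (intro continuous_intros)

text \<open>No partition into arcs is needed: the bound valid on some arc is majorised by the sum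
  over all fractions a/q, reduced or not. The at most 3q numerators turn q^(-p/2) into
  q^(1-p/2).\<close>

lemma integral_tent_sum_le:
  assumes K: "K > 0" and p: "p > 2"
  shows "integral {0..1} (\<lambda>x. norm (tent_sum K c x) powr p)
    \<le> 3 * 40000 powr (p/2) / (p/2 - 1) * real K powr (p - 2) * (\<Sum>q=1..4*K. real q powr (1 - p/2))"
proof -
  let ?r = "p / 2"
  let ?b = "\<lambda>q a x. (40000 / real q) powr ?r * (1 / (real K)\<^sup>2 + \<bar>2 * x - real a / real q\<bar>) powr (- ?r)"
  have K2: "1 / (real K)\<^sup>2 > 0" using K by simp
  have cont: "continuous_on {0..1} (?b q a)" for q a
  proof (intro continuous_intros ballI)
    fix x show "1 / (real K)\<^sup>2 + \<bar>2 * x - real a / real q\<bar> \<noteq> 0"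
      using K2 abs_ge_zero[of "2 * x - real a / real q"] by linarith
  qed
  have bnn: "?b q a x \<ge> 0" for q a x by simp
  have pt: "norm (tent_sum K c x) powr p \<le> (\<Sum>q=1..4*K. \<Sum>a=0..2*q. ?b q a x)" if x: "x \<in> {0..1}" for x
  proof -
    obtain q a where qa: "q \<in> {1..4*K}" "a \<in> {0..2*q}"
      and le: "(norm (tent_sum K c x))\<^sup>2 \<le> 40000 / (real q * (1 / (real K)\<^sup>2 + \<bar>2 * x - real a / real q\<bar>))"
      using norm_tent_sum_arc[OF K x] by blast
    have "norm (tent_sum K c x) powr p = ((norm (tent_sum K c x))\<^sup>2) powr ?r"
    proof (cases "norm (tent_sum K c x) = 0")
      case False
      then show ?thesis by (simp add: powr_powr flip: powr_numeral)
    qed (use p in auto)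
    also have "\<dots> \<le> (40000 / (real q * (1 / (real K)\<^sup>2 + \<bar>2 * x - real a / real q\<bar>))) powr ?r"
      using p by (intro powr_mono2 le) auto
    also have "\<dots> = ?b q a x"
    proof -
      have pos: "1 / (real K)\<^sup>2 + \<bar>2 * x - real a / real q\<bar> > 0" using K2 by (intro add_pos_nonneg) auto
      have "40000 / (real q * (1 / (real K)\<^sup>2 + \<bar>2 * x - real a / real q\<bar>)) = (40000 / real q) * inverse (1 / (real K)\<^sup>2 + \<bar>2 * x - real a / real q\<bar>)"
        by (simp add: divide_inverse)
      also have "\<dots> powr ?r = (40000 / real q) powr ?r * (inverse (1 / (real K)\<^sup>2 + \<bar>2 * x - real a / real q\<bar>)) powr ?r"
        by (rule powr_mult)
      also have "(inverse (1 / (real K)\<^sup>2 + \<bar>2 * x - real a / real q\<bar>)) powr ?r = (1 / (real K)\<^sup>2 + \<bar>2 * x - real a / real q\<bar>) powr (- ?r)"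
        using pos by (simp add: powr_minus inverse_powr)
      finally show ?thesis .
    qed
    also have "\<dots> \<le> (\<Sum>a=0..2*q. ?b q a x)"
      by (rule member_le_sum[OF qa(2)]) (use bnn in auto)
    also have "\<dots> \<le> (\<Sum>q=1..4*K. \<Sum>a=0..2*q. ?b q a x)"
      by (rule member_le_sum[OF qa(1), where f="\<lambda>q. \<Sum>a=0..2*q. ?b q a x"]) (use bnn in \<open>auto intro!: sum_nonneg\<close>)
    finally show ?thesis .
  qed
  have bi: "?b q a integrable_on {0..1}" for q a
    by (intro integrable_continuous_real cont)
  have "integral {0..1} (\<lambda>x. norm (tent_sum K c x) powr p) \<le> integral {0..1} (\<lambda>x. \<Sum>q=1..4*K. \<Sum>a=0..2*q. ?b q a x)"
    by (intro integral_le pt integrable_norm_powr continuous_intros integrable_sum bi) (use p in auto)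
  also have "\<dots> = (\<Sum>q=1..4*K. \<Sum>a=0..2*q. integral {0..1} (?b q a))"
  proof -
    have "integral {0..1} (\<lambda>x. \<Sum>q=1..4*K. \<Sum>a=0..2*q. ?b q a x) = (\<Sum>q=1..4*K. integral {0..1} (\<lambda>x. \<Sum>a=0..2*q. ?b q a x))"
      by (intro integral_sum integrable_sum bi finite_atLeastAtMost)
    also have "\<dots> = (\<Sum>q=1..4*K. \<Sum>a=0..2*q. integral {0..1} (?b q a))"
      by (intro sum.cong refl integral_sum bi finite_atLeastAtMost)
    finally show ?thesis .
  qed
  also have "\<dots> \<le> (\<Sum>q=1..4*K. \<Sum>a=0..2*q. (40000 / real q) powr ?r * (real K powr (p - 2) / (?r - 1)))"
  proof (intro sum_mono)
    fix q a assume q: "q \<in> {1..4*K}" "a \<in> {0..2*q}"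
    have "integral {0..1} (?b q a) = (40000 / real q) powr ?r * integral {0..1} (\<lambda>x. (1 / (real K)\<^sup>2 + \<bar>2 * x - real a / real q\<bar>) powr (- ?r))"
      by simp
    also have "\<dots> \<le> (40000 / real q) powr ?r * ((1 / (real K)\<^sup>2) powr (1 - ?r) / (?r - 1))"
      using q p K by (intro mult_left_mono integral_inverse_powr_le) (auto simp: field_simps simp flip: of_nat_mult)
    also have "(1 / (real K)\<^sup>2) powr (1 - ?r) = real K powr (p - 2)"
    proof -
      have "1 / (real K)\<^sup>2 = real K powr (-2)" using K by (simp add: powr_minus divide_inverse)
      then show ?thesis by (simp add: powr_powr algebra_simps)
    qed
    finally show "integral {0..1} (?b q a) \<le> (40000 / real q) powr ?r * (real K powr (p - 2) / (?r - 1))" .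
  qed
  also have "\<dots> \<le> (\<Sum>q=1..4*K. 3 * 40000 powr ?r / (?r - 1) * real K powr (p - 2) * real q powr (1 - ?r))"
  proof (intro sum_mono)
    fix q assume q: "q \<in> {1..4*K}"
    have "(\<Sum>a=0..2*q. (40000 / real q) powr ?r * (real K powr (p - 2) / (?r - 1)))
       = real (2 * q + 1) * ((40000 / real q) powr ?r * (real K powr (p - 2) / (?r - 1)))" by simp
    also have "\<dots> \<le> (3 * real q) * ((40000 / real q) powr ?r * (real K powr (p - 2) / (?r - 1)))"
      using q p by (intro mult_right_mono) auto
    also have "\<dots> = 3 * 40000 powr ?r / (?r - 1) * real K powr (p - 2) * (real q / real q powr ?r)"
      by (simp add: powr_divide mult_ac)
    also have "real q / real q powr ?r = real q powr (1 - ?r)" using q by (simp add: powr_diff)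
    finally show "(\<Sum>a=0..2*q. (40000 / real q) powr ?r * (real K powr (p - 2) / (?r - 1)))
       \<le> 3 * 40000 powr ?r / (?r - 1) * real K powr (p - 2) * real q powr (1 - ?r)" .
  qed
  also have "\<dots> = 3 * 40000 powr ?r / (?r - 1) * real K powr (p - 2) * (\<Sum>q=1..4*K. real q powr (1 - ?r))"
    by (simp only: sum_distrib_left)
  finally show ?thesis .
qed

section \<open>Sums over intervals\<close>

definition isum :: "int \<Rightarrow> nat \<Rightarrow> real \<Rightarrow> complex" where
  "isum a L x = (\<Sum>n\<in>{a..<a + int L}. ee ((of_int n)\<^sup>2 * x))"

lemma continuous_on_isum [continuous_intros]: "continuous_on A (isum a L)"
  unfolding isum_def by (intro continuous_intros)

lemma isum_add: "isum a (L + M) x = isum a L x + isum (a + int L) M x"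
proof -
  have "{a..<a + int (L + M)} = {a..<a + int L} \<union> {a + int L..<a + int L + int M}" by auto
  then show ?thesis unfolding isum_def by (simp add: sum.union_disjoint)
qed

lemma isum_mult: "isum a (m * K) x = (\<Sum>i<m. isum (a + int (i * K)) K x)"
proof (induction m)
  case (Suc m)
  have "isum a (Suc m * K) x = isum a (m * K + K) x" by (simp add: add.commute)
  then show ?case by (simp only: isum_add Suc sum.lessThan_Suc)
qed (simp add: isum_def)

lemma norm_isum_le: "norm (isum a L x) \<le> real L"
proof -
  have "norm (isum a L x) \<le> (\<Sum>n\<in>{a..<a + int L}. 1)"
    unfolding isum_def by (rule sum_norm_le) simp
  then show ?thesis by simp
qed

text \<open>Averaging the indicator of an interval over K consecutive shifts convolves two boxes of
  length K, which is a tent. Its apex is b + K - 1, the only point contained in all K shifted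
  intervals.\<close>

lemma sum_isum_eq_tent_sum:
  assumes K: "K > 0"
  shows "(\<Sum>j<K. isum (b + int j) K x) = of_nat K * tent_sum K (b + int K - 1) x"
proof -
  let ?c = "b + int K - 1"
  let ?J = "{?c - int K..?c + int K}"
  let ?e = "\<lambda>n. ee ((of_int n)\<^sup>2 * x)"
  have "(\<Sum>j<K. isum (b + int j) K x) = (\<Sum>j<K. \<Sum>n\<in>?J. if b + int j \<le> n \<and> n < b + int j + int K then ?e n else 0)"
  proof (rule sum.cong[OF refl])
    fix j assume j: "j \<in> {..<K}"
    have "{b + int j..<b + int j + int K} = {n \<in> ?J. b + int j \<le> n \<and> n < b + int j + int K}"
      using j by auto
    then show "isum (b + int j) K x = (\<Sum>n\<in>?J. if b + int j \<le> n \<and> n < b + int j + int K then ?e n else 0)"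
      unfolding isum_def by (simp add: sum.If_cases Int_def conj_commute)
  qed
  also have "\<dots> = (\<Sum>n\<in>?J. \<Sum>j<K. if b + int j \<le> n \<and> n < b + int j + int K then ?e n else 0)"
    by (rule sum.swap)
  also have "\<dots> = (\<Sum>n\<in>?J. of_real (real K * tent K (n - ?c)) * ?e n)"
  proof (rule sum.cong[OF refl])
    fix n assume n: "n \<in> ?J"
    have "(\<Sum>j<K. if b + int j \<le> n \<and> n < b + int j + int K then ?e n else 0)
        = of_nat (card {j\<in>{..<K}. b + int j \<le> n \<and> n < b + int j + int K}) * ?e n"
      by (simp add: sum.If_cases Int_def)
    moreover have "real (card {j\<in>{..<K}. b + int j \<le> n \<and> n < b + int j + int K}) = real K * tent K (n - ?c)"
    proof -
      \<comment> \<open>The shifts that cover \<open>n\<close> form an integer interval, of length K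
        minus the distance of \<open>n\<close> from the apex.\<close>
      have "{j\<in>{..<K}. b + int j \<le> n \<and> n < b + int j + int K} = nat ` {max 0 (n - ?c)..min (int K - 1) (n - b)}"
      proof (intro equalityI subsetI)
        fix j assume "j \<in> {j\<in>{..<K}. b + int j \<le> n \<and> n < b + int j + int K}"
        then show "j \<in> nat ` {max 0 (n - ?c)..min (int K - 1) (n - b)}"
          by (intro image_eqI[of _ _ "int j"]) auto
      qed auto
      then have "card {j\<in>{..<K}. b + int j \<le> n \<and> n < b + int j + int K} = card {max 0 (n - ?c)..min (int K - 1) (n - b)}"
        by (simp only:) (rule card_image, auto simp: inj_on_def)
      also have "\<dots> = nat (min (int K - 1) (n - b) - max 0 (n - ?c) + 1)" by simp
      also have "min (int K - 1) (n - b) - max 0 (n - ?c) + 1 = int K - \<bar>n - ?c\<bar>" by auto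
      finally have "real (card {j\<in>{..<K}. b + int j \<le> n \<and> n < b + int j + int K}) = real (nat (int K - \<bar>n - ?c\<bar>))"
        by simp
      also have "\<dots> = real K - of_int \<bar>n - ?c\<bar>" using n by auto
      also have "\<dots> = real K * tent K (n - ?c)" using n K by (subst tent_eq) (auto simp: field_simps)
      finally show ?thesis .
    qed
    moreover have "complex_of_real (real (card {j\<in>{..<K}. b + int j \<le> n \<and> n < b + int j + int K}))
        = of_nat (card {j\<in>{..<K}. b + int j \<le> n \<and> n < b + int j + int K})"
      by (rule of_real_of_nat_eq)
    ultimately show "(\<Sum>j<K. if b + int j \<le> n \<and> n < b + int j + int K then ?e n else 0)
        = of_real (real K * tent K (n - ?c)) * ?e n" by (simp only:)
  qed
  also have "\<dots> = of_nat K * tent_sum K ?c x"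
    by (simp add: tent_sum_def sum_distrib_left mult.assoc)
  finally show ?thesis .
qed

text \<open>For each offset j < K cut the interval into an initial piece of length j, m pieces of
  length K and a remainder. Averaging over j turns the m middle pieces into tents; the two end
  pieces stay sharp but are shorter than 2K.\<close>

lemma Lp_norm_isum_le_average:
  assumes K: "K > 0" and L: "(m + 1) * K \<le> L" and p: "p \<ge> 1"
    and short: "\<And>a j. j + m * K \<le> L \<Longrightarrow> j < 2 * K \<Longrightarrow> Lp_norm p (isum a j) \<le> A"
    and lenL: "L < (m + 2) * K"
    and tents: "\<And>c. Lp_norm p (tent_sum K c) \<le> B"
  shows "Lp_norm p (isum a L) \<le> 2 * A + real m * B"
proof -
  have p0: "p > 0" using p by simp
  let ?s = "\<lambda>j x. isum a j x + isum (a + int j + int (m * K)) (L - m * K - j) x"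
  let ?t = "\<lambda>i x. of_nat K * tent_sum K (a + int (i * K) + int K - 1) x"
  have eq: "of_nat K * isum a L x = (\<Sum>j<K. ?s j x) + (\<Sum>i<m. ?t i x)" for x
  proof -
    have "isum a L x = ?s j x + (\<Sum>i<m. isum (a + int (i * K) + int j) K x)" if "j < K" for j
    proof -
      have "L = j + (m * K + (L - m * K - j))" using that L by simp
      then have "isum a L x = isum a (j + (m * K + (L - m * K - j))) x" by simp
      also have "\<dots> = isum a j x + (isum (a + int j) (m * K) x + isum (a + int j + int (m * K)) (L - m * K - j) x)"
        by (simp only: isum_add)
      finally show ?thesis by (simp add: isum_mult add_ac)
    qed
    then have "(\<Sum>j<K. isum a L x) = (\<Sum>j<K. ?s j x + (\<Sum>i<m. isum (a + int (i * K) + int j) K x))"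
      by (intro sum.cong) auto
    also have "\<dots> = (\<Sum>j<K. ?s j x) + (\<Sum>i<m. \<Sum>j<K. isum (a + int (i * K) + int j) K x)"
      by (simp only: sum.distrib) (subst sum.swap, rule refl)
    also have "(\<Sum>i<m. \<Sum>j<K. isum (a + int (i * K) + int j) K x) = (\<Sum>i<m. ?t i x)"
      by (intro sum.cong refl sum_isum_eq_tent_sum K)
    finally show ?thesis by simp
  qed
  have "real K * Lp_norm p (isum a L) = Lp_norm p (\<lambda>x. of_nat K * isum a L x)"
    by (subst Lp_norm_scale) (use p0 in \<open>auto intro!: continuous_intros\<close>)
  also have "\<dots> = Lp_norm p (\<lambda>x. (\<Sum>j<K. ?s j x) + (\<Sum>i<m. ?t i x))"
    by (rule Lp_norm_cong) (rule eq)
  also have "\<dots> \<le> Lp_norm p (\<lambda>x. \<Sum>j<K. ?s j x) + Lp_norm p (\<lambda>x. \<Sum>i<m. ?t i x)"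
    by (intro Lp_norm_triangle continuous_intros p)
  also have "\<dots> \<le> (\<Sum>j<K. Lp_norm p (?s j)) + (\<Sum>i<m. Lp_norm p (?t i))"
    by (intro add_mono Lp_norm_sum_le continuous_intros p) auto
  also have "(\<Sum>j<K. Lp_norm p (?s j)) \<le> (\<Sum>j<K. 2 * A)"
  proof (rule sum_mono)
    fix j assume j: "j \<in> {..<K}"
    have "Lp_norm p (?s j) \<le> Lp_norm p (isum a j) + Lp_norm p (isum (a + int j + int (m * K)) (L - m * K - j))"
      by (intro Lp_norm_triangle continuous_intros p)
    also have "\<dots> \<le> A + A"
      using j L lenL by (intro add_mono short) auto
    finally show "Lp_norm p (?s j) \<le> 2 * A" by simp
  qed
  also have "(\<Sum>i<m. Lp_norm p (?t i)) \<le> (\<Sum>i<m. real K * B)"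
  proof (rule sum_mono)
    fix i
    have "Lp_norm p (?t i) = real K * Lp_norm p (tent_sum K (a + int (i * K) + int K - 1))"
      by (subst Lp_norm_scale) (use p0 in \<open>auto intro!: continuous_intros\<close>)
    also have "\<dots> \<le> real K * B" by (intro mult_left_mono tents) auto
    finally show "Lp_norm p (?t i) \<le> real K * B" .
  qed
  also have "(\<Sum>j<K. 2 * A) + (\<Sum>i<m. real K * B) = real K * (2 * A + real m * B)"
    by (simp add: algebra_simps)
  finally show ?thesis using K by simp
qed

text \<open>With K = L div 16 both end pieces have length at most L/8, and each costs 3/8 of the
  bound for L. Two of them give 3/4 < 1, so the induction closes once the constant C satisfies 3/4 C
  + 30 C0 <= C; the summand 16 takes care of lengths below 16.\<close>

lemma Lp_norm_isum_le_of_tents: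
  fixes D :: "nat \<Rightarrow> real"
  assumes p: "p \<ge> 1"
    and D1: "\<And>L. L \<ge> 1 \<Longrightarrow> D L \<ge> 1"
    and Dmono: "\<And>L M. 1 \<le> L \<Longrightarrow> L \<le> M \<Longrightarrow> D L \<le> D M"
    and D8: "\<And>n L. 1 \<le> n \<Longrightarrow> 8 * n \<le> L \<Longrightarrow> D n \<le> 3 / 8 * D L"
    and tents: "\<And>K c. K > 0 \<Longrightarrow> Lp_norm p (tent_sum K c) \<le> C0 * D K" and C0: "C0 \<ge> 0"
    and L: "L \<ge> 1"
  shows "Lp_norm p (isum a L) \<le> (16 + 120 * C0) * D L"
  using L
proof (induction L arbitrary: a rule: less_induct)
  case (less L)
  have p0: "p > 0" using p by simp
  define C where "C = 16 + 120 * C0"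
  have C: "C \<ge> 16" using C0 by (simp add: C_def)
  show ?case
  proof (cases "L < 16")
    case True
    have "Lp_norm p (isum a L) \<le> real L"
      by (intro Lp_norm_le_sup continuous_intros p0 norm_isum_le) auto
    also have "\<dots> \<le> C * 1" using True C by simp
    also have "\<dots> \<le> C * D L" using C D1 less.prems by (intro mult_left_mono) auto
    finally show ?thesis by (simp add: C_def)
  next
    case False
    define K where "K = L div 16"
    define m where "m = L div K - 1"
    have K: "K > 0" using False by (simp add: K_def)
    have K16: "16 * K \<le> L" "L < 16 * K + 16" unfolding K_def by auto
    have q: "16 \<le> L div K" using K K16 by (simp add: less_eq_div_iff_mult_less_eq)
    have "L < 32 * K" using K K16 by simp
    then have q2: "L div K < 32" using K by (simp add: div_less_iff_less_mult)
    have m1: "(m + 1) * K = L - L mod K"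
      using q by (simp add: m_def minus_mod_eq_div_mult)
    have m2: "(m + 1) * K \<le> L" using m1 by simp
    have m3: "L < (m + 2) * K"
    proof -
      have "L mod K < K" using K by simp
      then have "L < (m + 1) * K + K" using m1 by (metis add_less_cancel_left le_add_diff_inverse2 m1 mod_less_eq_dividend)
      then show ?thesis by simp
    qed
    have "Lp_norm p (isum a L) \<le> 2 * (C * (3 / 8 * D L)) + real m * (C0 * D L)"
    proof (rule Lp_norm_isum_le_average[OF K m2 p _ m3])
      fix a j assume j: "j + m * K \<le> L" "j < 2 * K"
      have DL: "D L \<ge> 0" using D1[of L] less.prems by linarith
      show "Lp_norm p (isum a j) \<le> C * (3 / 8 * D L)"
      proof (cases "j = 0")
        case True
        have "Lp_norm p (isum a j) \<le> real 0"
          unfolding True by (intro Lp_norm_le_sup continuous_intros p0 norm_isum_le) auto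
        then show ?thesis using DL C by (smt (verit) divide_nonneg_nonneg mult_nonneg_nonneg of_nat_0)
      next
        case False
        have "j < L" using j K16 K by linarith
        then have "Lp_norm p (isum a j) \<le> C * D j"
          using less.IH[of j a] False by (simp add: C_def)
        also have "\<dots> \<le> C * (3 / 8 * D L)"
          using C False j K16 by (intro mult_left_mono D8) auto
        finally show ?thesis .
      qed
    next
      fix c
      have "K \<le> L" using K16 by linarith
      then show "Lp_norm p (tent_sum K c) \<le> C0 * D L"
        using tents[OF K, of c] mult_left_mono[OF Dmono[of K L] C0] K by simp
    qed
    also have "\<dots> \<le> 2 * (C * (3 / 8 * D L)) + 30 * (C0 * D L)"
    proof -
      have "real m \<le> 30" using q2 by (simp add: m_def)
      moreover have "D L \<ge> 0" using D1[of L] less.prems by linarith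
      ultimately show ?thesis using C0 by (intro add_left_mono mult_right_mono) auto
    qed
    also have "\<dots> = (12 + 120 * C0) * D L" by (simp add: C_def algebra_simps)
    also have "\<dots> \<le> (16 + 120 * C0) * D L"
      using D1[of L] less.prems by (intro mult_right_mono) auto
    finally show ?thesis .
  qed
qed

section \<open>Growth functions and sums over denominators\<close>

lemma powr_minus_le_diff:
  fixes t g :: real
  assumes "t > 0" "g > 0" "g \<noteq> 1"
  shows "(t + 1) powr (- g) \<le> ((t + 1) powr (1 - g) - t powr (1 - g)) / (1 - g)"
proof -
  have "\<exists>z. t < z \<and> z < t + 1 \<and> (t + 1) powr (1 - g) / (1 - g) - t powr (1 - g) / (1 - g) = (t + 1 - t) * z powr (- g)"
  proof (rule MVT2)
    fix x assume "t \<le> x" "x \<le> t + 1"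
    then show "((\<lambda>x. x powr (1 - g) / (1 - g)) has_real_derivative x powr (- g)) (at x)"
      using assms by (auto intro!: derivative_eq_intros)
  qed simp
  then obtain z where z: "t < z" "z < t + 1"
    "((t + 1) powr (1 - g) - t powr (1 - g)) / (1 - g) = z powr (- g)"
    by (auto simp: diff_divide_distrib)
  have "(t + 1) powr (- g) \<le> z powr (- g)"
    using z assms by (intro powr_mono2') auto
  then show ?thesis using z by simp
qed

lemma sum_powr_minus_le:
  fixes g :: real
  assumes "0 < g" "g \<noteq> 1" "M \<ge> 1"
  shows "(\<Sum>q=1..M. real q powr (- g)) \<le> 1 + (real M powr (1 - g) - 1) / (1 - g)"
  using assms(3)
proof (induction M rule: dec_induct)
  case (step n)
  have "real (Suc n) powr (- g) \<le> (real (Suc n) powr (1 - g) - real n powr (1 - g)) / (1 - g)"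
    using powr_minus_le_diff[of "real n" g] step assms by (simp add: add.commute)
  then show ?case using step by (simp add: diff_divide_distrib)
qed simp

lemma sum_inverse_le_ln:
  assumes "M \<ge> 1"
  shows "(\<Sum>q=1..M. 1 / real q) \<le> 1 + ln (real M)"
  using assms
proof (induction M rule: dec_induct)
  case (step n)
  have "ln (real n / real (Suc n)) \<le> real n / real (Suc n) - 1"
    using step by (intro ln_le_minus_one) auto
  also have "\<dots> = - 1 / real (Suc n)" by (simp add: field_simps)
  finally have "1 / real (Suc n) \<le> ln (real (Suc n)) - ln (real n)"
    using step by (simp add: ln_div)
  then show ?case using step by simp
qed simp

text \<open>The \<open>1 +\<close> makes the logarithmic factor at least 1 already at L = 1, where
  the induction on lengths has to hold.\<close>

definition growth :: "real \<Rightarrow> real \<Rightarrow> nat \<Rightarrow> real" where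
  "growth sg ta L = real L powr sg * (1 + ln (real L)) powr ta"

text \<open>The exponents for which \<open>growth sg ta L\<close> is the order of the \<open>L\<^sup>p\<close> norm of an unweighted sum of length \<open>L\<close>.\<close>

definition admissible :: "real \<Rightarrow> real \<Rightarrow> real \<Rightarrow> bool" where
  "admissible p sg ta \<longleftrightarrow> (2 < p \<and> p < 4 \<and> sg = 1/2 \<and> ta = 0) \<or> (p = 4 \<and> sg = 1/2 \<and> ta = 1/4)
     \<or> (p > 4 \<and> sg = 1 - 2/p \<and> ta = 0)"

lemma admissibleD:
  assumes "admissible p sg ta"
  shows "p > 2" "sg \<ge> 1/2" "ta \<ge> 0"
proof -
  have "1 - 2 / p \<ge> 1/2" if "p > 4" using that by (simp add: field_simps)
  then show "sg \<ge> 1/2" using assms by (auto simp: admissible_def)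
qed (use assms in \<open>auto simp: admissible_def\<close>)

lemma growth_ge_1: "sg \<ge> 0 \<Longrightarrow> ta \<ge> 0 \<Longrightarrow> L \<ge> 1 \<Longrightarrow> growth sg ta L \<ge> 1"
proof -
  assume a: "sg \<ge> 0" "ta \<ge> 0" "L \<ge> 1"
  have "1 \<le> real L powr sg" "1 \<le> (1 + ln (real L)) powr ta"
    using a by (auto intro!: ge_one_powr_ge_zero)
  from mult_mono[OF this] show ?thesis by (simp add: growth_def)
qed

lemma growth_0: "L \<ge> 1 \<Longrightarrow> growth sg 0 L = real L powr sg"
proof -
  assume "L \<ge> 1"
  then have "1 + ln (real L) > 0" by (intro add_pos_nonneg) auto
  then show ?thesis by (simp add: growth_def)
qed

lemma growth_mono:
  assumes "sg \<ge> 0" "ta \<ge> 0" "1 \<le> L" "L \<le> M"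
  shows "growth sg ta L \<le> growth sg ta M"
  unfolding growth_def using assms by (intro mult_mono powr_mono2 add_left_mono) auto

text \<open>Uses sg >= 1/2 through sqrt(1/8) <= 3/8; the logarithmic factor only helps.\<close>

lemma growth_eighth:
  assumes "sg \<ge> 1/2" "ta \<ge> 0" "1 \<le> n" "8 * n \<le> L"
  shows "growth sg ta n \<le> 3 / 8 * growth sg ta L"
proof -
  have "real n powr sg \<le> (real L / 8) powr sg"
    using assms by (intro powr_mono2) auto
  also have "\<dots> = (1 / 8) powr sg * real L powr sg" by (simp add: powr_divide)
  also have "\<dots> \<le> 3 / 8 * real L powr sg"
  proof (intro mult_right_mono)
    have "(1 / 8 :: real) powr sg \<le> (1/8) powr (1/2)" using assms by (intro powr_mono') auto
    also have "\<dots> = sqrt (1/8)" by (simp add: powr_half_sqrt)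
    also have "\<dots> \<le> 3 / 8" by (rule real_le_lsqrt) (auto simp: power2_eq_square)
    finally show "(1 / 8 :: real) powr sg \<le> 3 / 8" .
  qed auto
  finally have "real n powr sg * (1 + ln (real n)) powr ta \<le> (3 / 8 * real L powr sg) * (1 + ln (real L)) powr ta"
    using assms by (intro mult_mono powr_mono2 add_left_mono) auto
  then show ?thesis by (simp add: growth_def)
qed

text \<open>The sum over q is of order K^(2-p/2) for p < 4, of order 1 + log K for p = 4, and
  bounded for p > 4. Multiplied by K^(p-2) these are the p-th powers of K^(1/2), K^(1/2) (1 + log
  K)^(1/4) and K^(1-2/p).\<close>

lemma sum_powr_growth:
  assumes "admissible p sg ta"
  shows "\<exists>C>0. \<forall>K\<ge>1. real K powr (p - 2) * (\<Sum>q=1..4*K. real q powr (1 - p/2)) \<le> C * growth sg ta K powr p"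
proof -
  consider (lt) "2 < p" "p < 4" "sg = 1/2" "ta = 0" | (eq) "p = 4" "sg = 1/2" "ta = 1/4" | (gt) "p > 4" "sg = 1 - 2/p" "ta = 0"
    using assms by (auto simp: admissible_def)
  then show ?thesis
  proof cases
    case lt
    have "real K powr (p - 2) * (\<Sum>q=1..4*K. real q powr (1 - p/2)) \<le> (4 powr (2 - p/2) / (2 - p/2)) * growth sg ta K powr p"
      if K: "K \<ge> 1" for K
    proof -
      have "(\<Sum>q=1..4*K. real q powr (- (p/2 - 1))) \<le> 1 + (real (4 * K) powr (1 - (p/2 - 1)) - 1) / (1 - (p/2 - 1))"
        by (rule sum_powr_minus_le) (use lt K in auto)
      also have "\<dots> \<le> real (4 * K) powr (2 - p/2) / (2 - p/2)"
      proof -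
        have "1 \<le> 1 / (2 - p/2)" using lt by (simp add: le_divide_eq)
        moreover have "1 - (p/2 - 1) = 2 - p/2" by simp
        ultimately show ?thesis by (simp add: diff_divide_distrib)
      qed
      also have "\<dots> = 4 powr (2 - p/2) / (2 - p/2) * real K powr (2 - p/2)"
        by (simp add: powr_mult)
      finally have "real K powr (p - 2) * (\<Sum>q=1..4*K. real q powr (1 - p/2))
         \<le> real K powr (p - 2) * (4 powr (2 - p/2) / (2 - p/2) * real K powr (2 - p/2))"
        by (intro mult_left_mono) auto
      also have "\<dots> = 4 powr (2 - p/2) / (2 - p/2) * (real K powr (p - 2) * real K powr (2 - p/2))" by simp
      also have "real K powr (p - 2) * real K powr (2 - p/2) = real K powr (p/2)"
        by (simp flip: powr_add)
      also have "real K powr (p/2) = growth sg ta K powr p"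
        unfolding lt(3,4) using K by (simp add: growth_0 powr_powr)
      finally show ?thesis .
    qed
    moreover have "0 < 4 powr (2 - p/2) / (2 - p/2)" using lt by simp
    ultimately show ?thesis by blast
  next
    case eq
    have "real K powr (p - 2) * (\<Sum>q=1..4*K. real q powr (1 - p/2)) \<le> 3 * growth sg ta K powr p"
      if K: "K \<ge> 1" for K
    proof -
      have "(\<Sum>q=1..4*K. real q powr (1 - p/2)) = (\<Sum>q=1..4*K. 1 / real q)"
      proof (rule sum.cong[OF refl])
        fix q :: nat
        have "1 - p/2 = - 1" using eq by simp
        then show "real q powr (1 - p/2) = 1 / real q" by (simp only: powr_minus_divide powr_one of_nat_0_le_iff)
      qed
      also have "\<dots> \<le> 1 + ln (real (4 * K))" using K by (intro sum_inverse_le_ln) auto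
      also have "\<dots> = 1 + ln 4 + ln (real K)" using K by (simp add: ln_mult)
      also have "\<dots> \<le> 3 * (1 + ln (real K))"
      proof -
        have "ln (4::real) = 2 * ln 2" using ln_realpow[of 2 2] by simp
        also have "\<dots> \<le> 2" using ln2_le_25_over_36 by simp
        finally have "ln (4::real) \<le> 2" .
        moreover have "0 \<le> ln (real K)" using K by simp
        moreover have "1 + a + b \<le> 3 * (1 + b)" if "a \<le> 2" "0 \<le> b" for a b :: real
          using that by (simp add: distrib_left)
        ultimately show ?thesis by blast
      qed
      finally have "real K powr (p - 2) * (\<Sum>q=1..4*K. real q powr (1 - p/2)) \<le> real K powr (p - 2) * (3 * (1 + ln (real K)))"
        by (intro mult_left_mono) auto
      also have "\<dots> = 3 * growth sg ta K powr p"
      proof -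
        have "0 \<le> 1 + ln (real K)" using K by (simp add: add_nonneg_nonneg)
        then have "growth sg ta K powr p = real K powr 2 * (1 + ln (real K))"
          unfolding growth_def eq by (simp only: powr_powr powr_mult) simp
        then show ?thesis using eq(1) by simp
      qed
      finally show ?thesis .
    qed
    then show ?thesis by (intro exI[of _ 3]) auto
  next
    case gt
    have "real K powr (p - 2) * (\<Sum>q=1..4*K. real q powr (1 - p/2)) \<le> (1 + 1 / (p/2 - 2)) * growth sg ta K powr p"
      if K: "K \<ge> 1" for K
    proof -
      have "(\<Sum>q=1..4*K. real q powr (- (p/2 - 1))) \<le> 1 + (real (4 * K) powr (1 - (p/2 - 1)) - 1) / (1 - (p/2 - 1))"
        by (rule sum_powr_minus_le) (use gt K in auto)
      also have "\<dots> = 1 + (1 - real (4 * K) powr (2 - p/2)) / (p/2 - 2)"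
        using gt by (simp add: divide_simps) (simp add: algebra_simps)
      also have "\<dots> \<le> 1 + 1 / (p/2 - 2)"
        using gt by (intro add_left_mono divide_right_mono) auto
      finally have le: "real K powr (p - 2) * (\<Sum>q=1..4*K. real q powr (1 - p/2))
         \<le> real K powr (p - 2) * (1 + 1 / (p/2 - 2))"
        by (intro mult_left_mono) auto
      have "real K powr (p - 2) = growth sg ta K powr p"
        using K gt by (simp add: growth_0 powr_powr left_diff_distrib)
      with le show ?thesis by (simp add: mult.commute)
    qed
    moreover have "0 < 1 + 1 / (p/2 - 2)" using gt by (simp add: add_pos_pos)
    ultimately show ?thesis by blast
  qed
qed

lemma Lp_norm_isum_le:
  assumes adm: "admissible p sg ta"
  shows "\<exists>C>0. \<forall>L\<ge>1. \<forall>a. Lp_norm p (isum a L) \<le> C * growth sg ta L"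
proof -
  note a = admissibleD[OF adm]
  obtain C1 where C1: "C1 > 0" "\<And>K. K \<ge> 1 \<Longrightarrow> real K powr (p - 2) * (\<Sum>q=1..4*K. real q powr (1 - p/2)) \<le> C1 * growth sg ta K powr p"
    using sum_powr_growth[OF adm] by blast
  define C2 where "C2 = 3 * 40000 powr (p/2) / (p/2 - 1) * C1"
  have C2: "C2 > 0" using C1 a by (simp add: C2_def)
  define C0 where "C0 = C2 powr (1/p)"
  have C0: "C0 > 0" using C2 by (simp add: C0_def)
  have tents: "Lp_norm p (tent_sum K c) \<le> C0 * growth sg ta K" if K: "K > 0" for K c
  proof (rule Lp_norm_leI)
    have "integral {0..1} (\<lambda>x. norm (tent_sum K c x) powr p)
      \<le> 3 * 40000 powr (p/2) / (p/2 - 1) * real K powr (p - 2) * (\<Sum>q=1..4*K. real q powr (1 - p/2))"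
      by (rule integral_tent_sum_le[OF K a(1)])
    also have "\<dots> = 3 * 40000 powr (p/2) / (p/2 - 1) * (real K powr (p - 2) * (\<Sum>q=1..4*K. real q powr (1 - p/2)))"
      by (simp only: mult.assoc)
    also have "\<dots> \<le> 3 * 40000 powr (p/2) / (p/2 - 1) * (C1 * growth sg ta K powr p)"
      using K a by (intro mult_left_mono C1) auto
    also have "\<dots> = C2 * growth sg ta K powr p" by (simp add: C2_def)
    also have "\<dots> = (C0 * growth sg ta K) powr p"
      using a C2 by (simp add: C0_def powr_mult powr_powr growth_def)
    finally show "integral {0..1} (\<lambda>x. norm (tent_sum K c x) powr p) \<le> (C0 * growth sg ta K) powr p" .
  qed (use a C0 in \<open>auto intro!: continuous_intros simp: growth_def\<close>)
  have "Lp_norm p (isum a L) \<le> (16 + 120 * C0) * growth sg ta L" if "L \<ge> 1" for L a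
  proof (rule Lp_norm_isum_le_of_tents[where D = "growth sg ta"])
    show "growth sg ta n \<le> 3 / 8 * growth sg ta L" if "1 \<le> n" "8 * n \<le> L" for n L
      by (rule growth_eighth) (use a that in auto)
  qed (use a C0 that tents in \<open>auto intro: growth_ge_1 growth_mono\<close>)
  then show ?thesis using C0 by (intro exI[of _ "16 + 120 * C0"]) auto
qed

section \<open>Dyadic blocks with power weights\<close>

lemma summation_by_parts_nat:
  fixes w :: "nat \<Rightarrow> complex" and f :: "nat \<Rightarrow> complex"
  shows "(\<Sum>i\<le>k. w i * f i) = w k * (\<Sum>i\<le>k. f i) + (\<Sum>i<k. (w i - w (Suc i)) * (\<Sum>l\<le>i. f l))"
  by (induction k) (simp_all add: algebra_simps)

text \<open>Abel summation: by monotonicity the total variation of the weights telescopes to one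
  difference, and for weights in [0, W] this difference plus the last weight is at most 2W.\<close>

lemma Lp_norm_monotone_weight_le:
  fixes w :: "nat \<Rightarrow> real" and f :: "nat \<Rightarrow> real \<Rightarrow> complex"
  assumes p: "p \<ge> 1" and cont: "\<And>i. continuous_on {0..1} (f i)"
    and M: "\<And>i. i \<le> k \<Longrightarrow> Lp_norm p (\<lambda>x. \<Sum>l\<le>i. f l x) \<le> M"
    and w: "\<And>i. i \<le> k \<Longrightarrow> 0 \<le> w i" "\<And>i. i \<le> k \<Longrightarrow> w i \<le> W" and mono: "mono w \<or> antimono w"
  shows "Lp_norm p (\<lambda>x. \<Sum>i\<le>k. of_real (w i) * f i x) \<le> 2 * W * M"
proof -
  have p0: "p > 0" using p by simp
  let ?S = "\<lambda>i x. \<Sum>l\<le>i. f l x"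
  have cS: "continuous_on {0..1} (?S i)" for i by (intro continuous_intros cont)
  have M0: "M \<ge> 0" using M[of k] Lp_norm_nonneg[of p "?S k"] by linarith
  have sc: "Lp_norm p (\<lambda>x. of_real c * ?S i x) \<le> \<bar>c\<bar> * M" if "i \<le> k" for c i
    using M[OF that] Lp_norm_scale[OF cS p0, of "of_real c" i] by (simp add: mult_left_mono)
  have "Lp_norm p (\<lambda>x. \<Sum>i\<le>k. of_real (w i) * f i x)
     = Lp_norm p (\<lambda>x. of_real (w k) * ?S k x + (\<Sum>i<k. of_real (w i - w (Suc i)) * ?S i x))"
    by (rule Lp_norm_cong) (simp add: summation_by_parts_nat[of "\<lambda>i. of_real (w i)"])
  also have "\<dots> \<le> Lp_norm p (\<lambda>x. of_real (w k) * ?S k x) + Lp_norm p (\<lambda>x. \<Sum>i<k. of_real (w i - w (Suc i)) * ?S i x)"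
    by (intro Lp_norm_triangle continuous_intros cont p)
  also have "\<dots> \<le> Lp_norm p (\<lambda>x. of_real (w k) * ?S k x) + (\<Sum>i<k. Lp_norm p (\<lambda>x. of_real (w i - w (Suc i)) * ?S i x))"
    by (intro add_left_mono Lp_norm_sum_le continuous_intros cont p) auto
  also have "\<dots> \<le> \<bar>w k\<bar> * M + (\<Sum>i<k. \<bar>w i - w (Suc i)\<bar> * M)"
    by (intro add_mono sum_mono sc) auto
  also have "\<dots> = (\<bar>w k\<bar> + (\<Sum>i<k. \<bar>w i - w (Suc i)\<bar>)) * M"
    by (simp add: sum_distrib_right distrib_right)
  also have "(\<Sum>i<k. \<bar>w i - w (Suc i)\<bar>) = \<bar>w 0 - w k\<bar>"
    using mono
  proof
    assume m: "mono w"
    have "(\<Sum>i<k. \<bar>w i - w (Suc i)\<bar>) = (\<Sum>i<k. w (Suc i) - w i)"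
      using m by (intro sum.cong) (auto simp: mono_iff_le_Suc)
    also have "\<dots> = w k - w 0" by (rule sum_lessThan_telescope)
    also have "\<dots> = \<bar>w 0 - w k\<bar>" using m by (simp add: mono_def)
    finally show ?thesis .
  next
    assume m: "antimono w"
    have "(\<Sum>i<k. \<bar>w i - w (Suc i)\<bar>) = (\<Sum>i<k. w i - w (Suc i))"
      using m by (intro sum.cong) (auto simp: antimono_iff_le_Suc)
    also have "\<dots> = w 0 - w k" by (rule sum_lessThan_telescope')
    also have "\<dots> = \<bar>w 0 - w k\<bar>" using m by (simp add: antimono_def)
    finally show ?thesis .
  qed
  also have "(\<bar>w k\<bar> + \<bar>w 0 - w k\<bar>) * M \<le> (2 * W) * M"
    using w[of 0] w[of k] M0 by (intro mult_right_mono) auto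
  finally show ?thesis by simp
qed

text \<open>The cutoff at N is built in, so that \<open>TN\<close> is exactly a finite sum of
  blocks, the last of which may be incomplete.\<close>

definition block :: "real \<Rightarrow> nat \<Rightarrow> nat \<Rightarrow> real \<Rightarrow> complex" where
  "block r N j x = (\<Sum>n\<in>{2^j..<2^Suc j} \<inter> {..N}. of_real (real n powr r) * ee ((real n)\<^sup>2 * x))"

lemma continuous_on_block [continuous_intros]: "continuous_on A (block r N j)"
  unfolding block_def by (intro continuous_intros)

text \<open>Initial segments of a block are intervals of length at most 2^j, so partial summation
  treats complete and incomplete blocks alike and the constant does not depend on N. On a block n^r
  varies by at most a factor 2^|r|.\<close>

lemma Lp_norm_block_le:
  assumes adm: "admissible p sg ta"
  shows "\<exists>C>0. \<forall>N j. Lp_norm p (block r N j) \<le> C * (2 powr (r * real j) * growth sg ta (2^j))"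
proof -
  note a = admissibleD[OF adm]
  have p: "p \<ge> 1" "p > 0" using a by auto
  obtain C where C: "C > 0" "\<And>L a. L \<ge> 1 \<Longrightarrow> Lp_norm p (isum a L) \<le> C * growth sg ta L"
    using Lp_norm_isum_le[OF adm] by blast
  have g0: "growth sg ta n \<ge> 0" for n by (simp add: growth_def)
  have "Lp_norm p (block r N j) \<le> (2 * 2 powr \<bar>r\<bar> * C) * (2 powr (r * real j) * growth sg ta (2^j))" for N j
  proof (cases "N < 2^j")
    case True
    then have "{2^j..<2^Suc j} \<inter> {..N} = {}" by auto
    then have "Lp_norm p (block r N j) = 0"
      unfolding block_def using p by (simp add: Lp_norm_zero)
    then show ?thesis using C g0 by simp
  next
    case False
    define k where "k = min N (2^Suc j - 1) - 2^j"
    define b where "b = (2::nat)^j"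
    have b: "b \<ge> 1" by (simp add: b_def)
    have k: "k < 2^j" "2^j + k \<le> N"
      using False b unfolding k_def power_Suc b_def[symmetric] by linarith+
    have set: "{2^j..<2^Suc j} \<inter> {..N} = {2^j..2^j + k}"
      using False b unfolding k_def power_Suc b_def[symmetric] by auto
    let ?f = "\<lambda>i x. ee ((real (2^j + i))\<^sup>2 * x)"
    let ?w = "\<lambda>i. real (2^j + i) powr r"
    have eq: "block r N j x = (\<Sum>i\<le>k. of_real (?w i) * ?f i x)" for x
      unfolding block_def set
      by (rule sum.reindex_bij_witness[of _ "\<lambda>i. 2^j + i" "\<lambda>n. n - 2^j"]) auto
    have "Lp_norm p (\<lambda>x. \<Sum>i\<le>k. of_real (?w i) * ?f i x) \<le> 2 * (2 powr \<bar>r\<bar> * 2 powr (r * real j)) * (C * growth sg ta (2^j))"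
    proof (rule Lp_norm_monotone_weight_le[OF p(1)])
      fix i assume i: "i \<le> k"
      have "(\<lambda>x. \<Sum>l\<le>i. ?f l x) = isum (2^j) (Suc i)"
      proof
        fix x
        show "(\<Sum>l\<le>i. ?f l x) = isum (2^j) (Suc i) x"
          unfolding isum_def
          by (rule sum.reindex_bij_witness[of _ "\<lambda>n. nat (n - 2^j)" "\<lambda>l. 2^j + int l"]) auto
      qed
      then have "Lp_norm p (\<lambda>x. \<Sum>l\<le>i. ?f l x) \<le> C * growth sg ta (Suc i)"
        using C(2)[of "Suc i" "2^j"] by simp
      also have "\<dots> \<le> C * growth sg ta (2^j)"
        using C i k a by (intro mult_left_mono growth_mono) auto
      finally show "Lp_norm p (\<lambda>x. \<Sum>l\<le>i. ?f l x) \<le> C * growth sg ta (2^j)" .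
      have lo: "(2::real)^j \<le> real (2^j + i)" by simp
      have hi: "real (2^j + i) \<le> 2 * 2^j"
      proof -
        have "2^j + i \<le> 2 * 2^j" using i k by simp
        then have "real (2^j + i) \<le> real (2 * 2^j)" by (rule of_nat_mono)
        then show ?thesis by simp
      qed
      have pj: "((2::real)^j) powr r = 2 powr (r * real j)"
        by (simp add: powr_powr mult.commute flip: powr_realpow)
      show "?w i \<le> 2 powr \<bar>r\<bar> * 2 powr (r * real j)"
      proof (cases "r \<ge> 0")
        case True
        have "?w i \<le> (2 * 2^j) powr r" using True hi by (intro powr_mono2) auto
        also have "\<dots> = 2 powr r * 2 powr (r * real j)" by (simp add: powr_mult pj)
        finally show ?thesis using True by simp
      next
        case False
        have "?w i \<le> (2^j) powr r" using False lo by (intro powr_mono2') auto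
        also have "\<dots> = 1 * 2 powr (r * real j)" by (simp add: pj)
        also have "\<dots> \<le> 2 powr \<bar>r\<bar> * 2 powr (r * real j)"
          by (intro mult_right_mono ge_one_powr_ge_zero) auto
        finally show ?thesis .
      qed
    next
      show "mono ?w \<or> antimono ?w"
      proof (cases "r \<ge> 0")
        case True
        then have "mono ?w" by (auto intro!: monoI powr_mono2)
        then show ?thesis ..
      next
        case False
        then have "antimono ?w" by (auto intro!: antimonoI powr_mono2' simp: add_pos_nonneg)
        then show ?thesis ..
      qed
    qed (auto intro!: continuous_intros)
    moreover have "Lp_norm p (block r N j) = Lp_norm p (\<lambda>x. \<Sum>i\<le>k. of_real (?w i) * ?f i x)"
      by (rule Lp_norm_cong) (rule eq)
    ultimately show ?thesis by (simp only:) (simp add: mult_ac)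
  qed
  then show ?thesis using C by (intro exI[of _ "2 * 2 powr \<bar>r\<bar> * C"]) auto
qed

section \<open>Square-root cancellation between lacunary blocks\<close>

text \<open>Taylor with Lagrange remainder; |u| <= 9/16 keeps the intermediate point 1 + t in
  [1/3, 3], which bounds (1 + t)^(r-2) for either sign of r - 2.\<close>

lemma powr_second_order_bound:
  fixes r u :: real
  assumes r: "r \<ge> 1" and u: "\<bar>u\<bar> \<le> 9/16"
  shows "(1 + u) powr r \<le> 1 + r * u + (r * (r - 1) * 3 powr \<bar>r - 2\<bar>) * u\<^sup>2"
proof (cases "u = 0")
  case False
  define df where "df = (\<lambda>m t. if m = 0 then (1 + t) powr r else if m = Suc 0 then r * (1 + t) powr (r - 1)
      else r * (r - 1) * (1 + t) powr (r - 2) :: real)"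
  have "\<exists>t. (if u < 0 then u < t \<and> t < 0 else 0 < t \<and> t < u) \<and>
      (1 + u) powr r = (\<Sum>m<2. (df m 0 / fact m) * (u - 0)^m) + (df 2 t / fact 2) * (u - 0)^2"
  proof (rule Taylor[where a = "-9/16" and b = "9/16"])
    show "\<forall>m t. m < 2 \<and> -9/16 \<le> t \<and> t \<le> 9/16 \<longrightarrow> ((df m) has_real_derivative df (Suc m) t) (at t)"
    proof (intro allI impI)
      fix m t assume a: "m < (2::nat) \<and> -9/16 \<le> t \<and> t \<le> (9/16::real)"
      then have pos: "1 + t > 0" by simp
      have 0: "((\<lambda>t. (1 + t) powr r) has_real_derivative r * (1 + t) powr (r - 1)) (at t)"
        using pos by (auto intro!: derivative_eq_intros)
      have 1: "((\<lambda>t. r * (1 + t) powr (r - 1)) has_real_derivative r * (r - 1) * (1 + t) powr (r - 2)) (at t)"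
        using pos by (auto intro!: derivative_eq_intros simp: diff_diff_eq)
      consider "m = 0" | "m = 1" using a by linarith
      then show "((df m) has_real_derivative df (Suc m) t) (at t)"
        by cases (use 0 1 in \<open>auto simp: df_def\<close>)
    qed
  qed (use u False in \<open>auto simp: df_def\<close>)
  then obtain t where t: "if u < 0 then u < t \<and> t < 0 else 0 < t \<and> t < u"
    and eq: "(1 + u) powr r = (\<Sum>m<2. (df m 0 / fact m) * (u - 0)^m) + (df 2 t / fact 2) * (u - 0)^2" by blast
  have tt: "1/3 \<le> 1 + t" "1 + t \<le> 3" using t u by (auto split: if_splits)
  have "(\<Sum>m<2. (df m 0 / fact m) * (u - 0)^m) = 1 + r * u"
    by (simp add: numeral_2_eq_2 df_def)
  moreover have "df 2 t / fact 2 * (u - 0)^2 \<le> (r * (r - 1) * 3 powr \<bar>r - 2\<bar>) * u\<^sup>2"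
  proof -
    have "(1 + t) powr (r - 2) \<le> 3 powr \<bar>r - 2\<bar>"
    proof (cases "r \<ge> 2")
      case True
      then show ?thesis using tt by (simp add: powr_mono2)
    next
      case False
      have "(1 + t) powr (r - 2) \<le> (1/3) powr (r - 2)" using False tt by (intro powr_mono2') auto
      also have "\<dots> = 3 powr (2 - r)" by (simp add: powr_divide powr_minus_divide[symmetric])
      finally show ?thesis using False by simp
    qed
    then have "r * (r - 1) * (1 + t) powr (r - 2) \<le> r * (r - 1) * 3 powr \<bar>r - 2\<bar>"
      using r by (intro mult_left_mono) auto
    moreover have "0 \<le> r * (r - 1) * (1 + t) powr (r - 2)" using r by simp
    ultimately have "df 2 t / fact 2 \<le> r * (r - 1) * 3 powr \<bar>r - 2\<bar>"
      by (simp add: df_def)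
    from mult_right_mono[OF this zero_le_power2[of u]] show ?thesis by (simp only: diff_zero)
  qed
  ultimately show ?thesis using eq by simp
qed simp

lemma norm_add_sq:
  fixes z w :: complex
  shows "(norm (z + w))\<^sup>2 = (norm z)\<^sup>2 + (2 * Re (cnj z * w) + (norm w)\<^sup>2)"
  by (simp only: cmod_power2) (simp add: power2_eq_square algebra_simps)

text \<open>Second-order expansion of (1 + |z|^2)^(p/2) in the increment w. It holds globally
  because, once |w| is comparable to sqrt(1 + |z|^2) or larger, every term is O(|w|^p).\<close>

lemma smooth_power_expansion:
  fixes p :: real
  assumes p: "p > 2"
  shows "\<exists>C>0. \<forall>z w :: complex. (1 + (norm (z + w))\<^sup>2) powr (p/2) \<le> (1 + (norm z)\<^sup>2) powr (p/2)
     + p * ((1 + (norm z)\<^sup>2) powr (p/2 - 1) * Re (cnj z * w))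
     + C * ((1 + (norm z)\<^sup>2) powr (p/2 - 1) * (norm w)\<^sup>2 + norm w powr p)"
proof -
  define r where "r = p / 2"
  have r: "r > 1" using p by (simp add: r_def)
  define c1 where "c1 = r * (r - 1) * 3 powr \<bar>r - 2\<bar>"
  have c1: "c1 > 0" using r by (simp add: c1_def)
  define C where "C = r + 6 * c1 + 25 powr r + p * 16 powr r"
  have C: "C > 0" using r c1 p by (simp add: C_def add_pos_nonneg)
  have "(1 + (norm (z + w))\<^sup>2) powr r \<le> (1 + (norm z)\<^sup>2) powr r
     + p * ((1 + (norm z)\<^sup>2) powr (r - 1) * Re (cnj z * w))
     + C * ((1 + (norm z)\<^sup>2) powr (r - 1) * (norm w)\<^sup>2 + norm w powr p)" for z w :: complex
  proof -
    define R where "R = 1 + (norm z)\<^sup>2"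
    define q where "q = Re (cnj z * w)"
    define n where "n = norm w"
    have R1: "R \<ge> 1" by (simp add: R_def)
    have n0: "n \<ge> 0" by (simp add: n_def)
    have zR: "norm z \<le> sqrt R" by (rule real_le_rsqrt) (simp add: R_def)
    have "\<bar>q\<bar> \<le> norm (cnj z * w)" unfolding q_def by (rule abs_Re_le_cmod)
    also have "\<dots> = norm z * n" by (simp add: norm_mult n_def)
    also have "\<dots> \<le> sqrt R * n" using zR n0 by (intro mult_right_mono)
    finally have q: "\<bar>q\<bar> \<le> sqrt R * n" .
    have eq: "1 + (norm (z + w))\<^sup>2 = R + (2 * q + n\<^sup>2)"
      by (simp add: norm_add_sq R_def q_def n_def)
    have np: "(n\<^sup>2) powr r = n powr p"
      using n0 by (cases "n = 0") (auto simp: r_def powr_powr simp flip: powr_numeral)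
    have "(R + (2 * q + n\<^sup>2)) powr r \<le> R powr r + p * (R powr (r - 1) * q) + C * (R powr (r - 1) * n\<^sup>2 + n powr p)"
    \<comment> \<open>Below this threshold the relative change u is at most 9/4 * 1/4 = 9/16. Above
      it R <= 16 n^2 and |q| <= 4 n^2, whence 25 = 16 + 8 + 1, and a possibly negative first-order
      term is repaid by p * 16^r n^p.\<close>
    proof (cases "n \<le> sqrt R / 4")
      case True
      define u where "u = (2 * q + n\<^sup>2) / R"
      have nn: "n\<^sup>2 \<le> sqrt R * n / 4"
        using mult_right_mono[OF True n0] by (simp only: power2_eq_square times_divide_eq_left)
      have a1: "\<bar>2 * q + n\<^sup>2\<bar> \<le> 9/4 * (sqrt R * n)" using q nn zero_le_power2[of n] by linarith
      also have "\<dots> \<le> 9/4 * (sqrt R * (sqrt R / 4))" using True R1 by (intro mult_left_mono) auto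
      also have "\<dots> = 9/16 * R" using R1 by simp
      finally have u: "\<bar>u\<bar> \<le> 9/16" using R1 by (simp add: u_def abs_divide divide_le_eq)
      have "(2 * q + n\<^sup>2)\<^sup>2 = \<bar>2 * q + n\<^sup>2\<bar>\<^sup>2" by simp
      also have "\<dots> \<le> (9/4 * (sqrt R * n))\<^sup>2" by (intro power_mono a1) auto
      also have "\<dots> = 81/16 * (R * n\<^sup>2)" using R1 by (simp add: power_mult_distrib power_divide)
      also have "\<dots> \<le> 6 * (R * n\<^sup>2)" using R1 by (intro mult_right_mono) auto
      finally have "u\<^sup>2 \<le> 6 * (R * n\<^sup>2) / R\<^sup>2"
        unfolding u_def power_divide by (intro divide_right_mono) auto
      then have u2: "u\<^sup>2 \<le> 6 * n\<^sup>2 / R" using R1 by (simp add: power2_eq_square)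
      have "R + (2 * q + n\<^sup>2) = R * (1 + u)" using R1 by (simp add: u_def field_simps)
      then have "(R + (2 * q + n\<^sup>2)) powr r = R powr r * (1 + u) powr r"
        by (simp only: powr_mult)
      also have "\<dots> \<le> R powr r * (1 + r * u + c1 * u\<^sup>2)"
        unfolding c1_def using r u by (intro mult_left_mono powr_second_order_bound) auto
      also have "\<dots> \<le> R powr r * (1 + r * u + c1 * (6 * n\<^sup>2 / R))"
        using c1 u2 by (intro mult_left_mono add_left_mono) auto
      also have "\<dots> = R powr r + R powr r / R * (r * (2 * q) + r * n\<^sup>2 + 6 * c1 * n\<^sup>2)"
        using R1 by (simp add: u_def field_simps)
      also have "R powr r / R = R powr (r - 1)" using R1 by (simp add: powr_diff)
      also have "R powr r + R powr (r - 1) * (r * (2 * q) + r * n\<^sup>2 + 6 * c1 * n\<^sup>2)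
          = R powr r + p * (R powr (r - 1) * q) + (r + 6 * c1) * (R powr (r - 1) * n\<^sup>2)"
        by (simp add: r_def algebra_simps)
      also have "\<dots> \<le> R powr r + p * (R powr (r - 1) * q) + C * (R powr (r - 1) * n\<^sup>2 + n powr p)"
      proof -
        have "(r + 6 * c1) * (R powr (r - 1) * n\<^sup>2) \<le> C * (R powr (r - 1) * n\<^sup>2)"
          unfolding C_def using p by (intro mult_right_mono) auto
        moreover have "0 \<le> C * n powr p" using C by simp
        ultimately show ?thesis by (simp add: distrib_left)
      qed
      finally show ?thesis .
    next
      case False
      then have lt: "sqrt R < 4 * n" by simp
      have R16: "R \<le> 16 * n\<^sup>2"
      proof -
        have "(sqrt R)\<^sup>2 \<le> (4 * n)\<^sup>2" using lt R1 by (intro power_mono) auto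
        then show ?thesis using R1 by (simp add: power_mult_distrib)
      qed
      have qn: "\<bar>q\<bar> \<le> 4 * n\<^sup>2"
      proof -
        have "sqrt R * n \<le> 4 * n * n" using lt n0 by (intro mult_right_mono) auto
        then show ?thesis using q by (simp add: power2_eq_square)
      qed
      have pos: "0 \<le> R + (2 * q + n\<^sup>2)" unfolding eq[symmetric] by simp
      have "(R + (2 * q + n\<^sup>2)) powr r \<le> (25 * n\<^sup>2) powr r"
        using pos r R16 qn by (intro powr_mono2) (auto simp: abs_le_iff)
      also have "\<dots> = 25 powr r * n powr p" by (simp add: powr_mult np)
      finally have 1: "(R + (2 * q + n\<^sup>2)) powr r \<le> 25 powr r * n powr p" .
      have "\<bar>R powr (r - 1) * q\<bar> \<le> (16 * n\<^sup>2) powr (r - 1) * (16 * n\<^sup>2)"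
        unfolding abs_mult using R1 R16 r qn by (intro mult_mono) (auto intro!: powr_mono2)
      also have "\<dots> = (16 * n\<^sup>2) powr r"
      proof -
        have "16 * n\<^sup>2 > 0" using R16 R1 by linarith
        then show ?thesis by (simp add: powr_diff)
      qed
      also have "\<dots> = 16 powr r * n powr p" by (simp add: powr_mult np)
      finally have "- (16 powr r * n powr p) \<le> R powr (r - 1) * q" by linarith
      then have 2: "p * (- (16 powr r * n powr p)) \<le> p * (R powr (r - 1) * q)"
        using p by (intro mult_left_mono) auto
      have "(25 powr r + p * 16 powr r) * n powr p \<le> C * (R powr (r - 1) * n\<^sup>2 + n powr p)"
        unfolding C_def using r c1 p by (intro mult_mono) auto
      then have "25 powr r * n powr p \<le> p * (- (16 powr r * n powr p)) + C * (R powr (r - 1) * n\<^sup>2 + n powr p)"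
        by (simp add: algebra_simps)
      moreover have "0 \<le> R powr r" by simp
      ultimately show ?thesis using 1 2 by linarith
    qed
    then show ?thesis unfolding eq by (simp only: R_def q_def n_def)
  qed
  then show ?thesis using C unfolding r_def by blast
qed

text \<open>Compare y^2 with l R: one of the two terms on the right dominates by itself.\<close>

lemma powr_young:
  fixes R y l r :: real
  assumes "R > 0" "y \<ge> 0" "l > 0" "r > 1"
  shows "R powr (r - 1) * y\<^sup>2 \<le> l * R powr r + l powr (1 - r) * y powr (2 * r)"
proof (cases "y\<^sup>2 \<le> l * R")
  case True
  have "R powr (r - 1) * y\<^sup>2 \<le> R powr (r - 1) * (l * R)" using True by (intro mult_left_mono) auto
  also have "\<dots> = l * R powr r" using assms by (simp add: powr_diff)
  finally show ?thesis by (smt (verit) mult_nonneg_nonneg powr_ge_zero)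
next
  case False
  then have y: "y > 0" using assms by (cases "y = 0") (auto simp: mult_pos_pos)
  have "R \<le> y\<^sup>2 / l" using False assms by (simp add: field_simps)
  then have "R powr (r - 1) * y\<^sup>2 \<le> (y\<^sup>2 / l) powr (r - 1) * y\<^sup>2"
    using assms by (intro mult_right_mono powr_mono2) auto
  also have "\<dots> = l powr (1 - r) * ((y\<^sup>2) powr (r - 1) * y\<^sup>2)"
    using assms by (simp add: powr_divide powr_diff field_simps)
  also have "(y\<^sup>2) powr (r - 1) * y\<^sup>2 = (y\<^sup>2) powr r" using y by (simp add: powr_diff)
  also have "(y\<^sup>2) powr r = y powr (2 * r)" using y by (simp add: powr_powr flip: powr_numeral)
  finally show ?thesis using assms by (smt (verit) mult_nonneg_nonneg powr_ge_zero)
qed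

section \<open>Integration by parts against a smoothed power\<close>

lemma has_vector_derivative_smooth_power:
  fixes P P' :: "real \<Rightarrow> complex" and e :: real
  assumes "(P has_vector_derivative P' x) (at x within A)"
  shows "((\<lambda>x. ((1 + (norm (P x))\<^sup>2) powr e) *\<^sub>R cnj (P x)) has_vector_derivative
      (((1 + (norm (P x))\<^sup>2) powr e) *\<^sub>R cnj (P' x)
       + (e * (1 + (norm (P x))\<^sup>2) powr (e - 1) * (2 * Re (cnj (P x) * P' x))) *\<^sub>R cnj (P x))) (at x within A)"
proof (rule has_vector_derivative_scaleR)
  show "((\<lambda>x. cnj (P x)) has_vector_derivative cnj (P' x)) (at x within A)"
    using bounded_linear.has_vector_derivative[OF bounded_linear_cnj assms] .
  have re: "((\<lambda>x. Re (P x)) has_real_derivative Re (P' x)) (at x within A)"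
    using bounded_linear.has_vector_derivative[OF bounded_linear_Re assms]
    by (simp add: has_real_derivative_iff_has_vector_derivative)
  have im: "((\<lambda>x. Im (P x)) has_real_derivative Im (P' x)) (at x within A)"
    using bounded_linear.has_vector_derivative[OF bounded_linear_Im assms]
    by (simp add: has_real_derivative_iff_has_vector_derivative)
  have pos: "1 + ((Re (P x))\<^sup>2 + (Im (P x))\<^sup>2) > 0" by (intro add_pos_nonneg) auto
  have d1: "((\<lambda>x. 1 + ((Re (P x))\<^sup>2 + (Im (P x))\<^sup>2)) has_real_derivative 2 * Re (cnj (P x) * P' x)) (at x within A)"
    using DERIV_add[OF DERIV_const[of 1] DERIV_add[OF DERIV_power[OF re, of 2] DERIV_power[OF im, of 2]]]
    by (simp add: algebra_simps)
  have "((\<lambda>x. (1 + ((Re (P x))\<^sup>2 + (Im (P x))\<^sup>2)) powr e) has_real_derivative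
      e * (1 + ((Re (P x))\<^sup>2 + (Im (P x))\<^sup>2)) powr (e - 1) * (2 * Re (cnj (P x) * P' x))) (at x within A)"
    by (rule DERIV_chain2[OF has_real_derivative_powr[OF pos] d1])
  then show "((\<lambda>x. (1 + (norm (P x))\<^sup>2) powr e) has_real_derivative
      e * (1 + (norm (P x))\<^sup>2) powr (e - 1) * (2 * Re (cnj (P x) * P' x))) (at x within A)"
    by (simp only: cmod_power2)
qed

text \<open>In the second summand |Re(cnj z d)| |z| <= |z|^2 |d| <= R |d|, with R = 1 + |z|^2,
  restores the power of R lost by differentiating.\<close>

lemma norm_deriv_smooth_power_le:
  fixes z d :: complex and e :: real
  assumes "e \<ge> 0"
  shows "norm (((1 + (norm z)\<^sup>2) powr e) *\<^sub>R cnj d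
       + (e * (1 + (norm z)\<^sup>2) powr (e - 1) * (2 * Re (cnj z * d))) *\<^sub>R cnj z)
      \<le> (2 * e + 1) * ((1 + (norm z)\<^sup>2) powr e * norm d)"
proof -
  define R where "R = 1 + (norm z)\<^sup>2"
  have R: "R \<ge> 1" by (simp add: R_def)
  define q where "q = Re (cnj z * d)"
  have "\<bar>q\<bar> * norm z \<le> norm (cnj z * d) * norm z"
    unfolding q_def by (intro mult_right_mono abs_Re_le_cmod) auto
  also have "\<dots> = (norm z)\<^sup>2 * norm d" by (simp add: norm_mult power2_eq_square)
  also have "\<dots> \<le> R * norm d" by (intro mult_right_mono) (auto simp: R_def)
  finally have 1: "\<bar>q\<bar> * norm z \<le> R * norm d" .
  have "norm ((e * R powr (e - 1) * (2 * q)) *\<^sub>R cnj z) = 2 * e * R powr (e - 1) * (\<bar>q\<bar> * norm z)"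
    using assms by (simp add: abs_mult)
  also have "\<dots> \<le> 2 * e * R powr (e - 1) * (R * norm d)"
    using assms by (intro mult_left_mono 1) auto
  also have "\<dots> = 2 * e * (R powr e * norm d)" using R by (simp add: powr_diff)
  finally have 2: "norm ((e * R powr (e - 1) * (2 * q)) *\<^sub>R cnj z) \<le> 2 * e * (R powr e * norm d)" .
  have "norm ((R powr e) *\<^sub>R cnj d + (e * R powr (e - 1) * (2 * q)) *\<^sub>R cnj z)
     \<le> norm ((R powr e) *\<^sub>R cnj d) + norm ((e * R powr (e - 1) * (2 * q)) *\<^sub>R cnj z)"
    by (rule norm_triangle_ineq)
  also have "\<dots> \<le> R powr e * norm d + 2 * e * (R powr e * norm d)"
    using 2 by simp
  also have "\<dots> = (2 * e + 1) * (R powr e * norm d)" by (simp add: algebra_simps)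
  finally show ?thesis unfolding R_def q_def .
qed

text \<open>A regularised p-th moment: the base is at least 1, so every real power of it is smooth
  where the function vanishes, and the zero function has energy 1.\<close>

definition smooth_energy :: "real \<Rightarrow> (real \<Rightarrow> complex) \<Rightarrow> real" where
  "smooth_energy p f = integral {0..1} (\<lambda>x. (1 + (norm (f x))\<^sup>2) powr (p/2))"

lemma continuous_on_smooth_power:
  fixes f :: "real \<Rightarrow> complex"
  assumes "continuous_on A f"
  shows "continuous_on A (\<lambda>x. (1 + (norm (f x))\<^sup>2) powr e)"
proof (intro continuous_intros assms ballI)
  fix x
  have "1 + (norm (f x))\<^sup>2 > 0" by (intro add_pos_nonneg) auto
  then show "1 + (norm (f x))\<^sup>2 \<noteq> 0" by simp
qed

text \<open>Integrating by parts moves the derivative from the high-frequency block \<open>t = U'\<close> onto the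
  low-frequency partial sum; this replaces the vanishing of the cross term for martingale differences.\<close>

lemma smooth_energy_cross_term:
  fixes P P' t U :: "real \<Rightarrow> complex"
  assumes p: "p > 2" and k: "k > 0"
    and P: "\<And>x. (P has_vector_derivative P' x) (at x within {0..1})"
    and U: "\<And>x. (U has_vector_derivative t x) (at x within {0..1})"
    and per: "P 0 = P 1" "U 0 = U 1"
    and cont: "continuous_on {0..1} P'" "continuous_on {0..1} t"
  shows "integral {0..1} (\<lambda>x. (1 + (norm (P x))\<^sup>2) powr (p/2 - 1) * Re (cnj (P x) * t x))
    \<le> (p - 1) * integral {0..1} (\<lambda>x. (1 + (norm (P x))\<^sup>2) powr (p/2 - 1) * (norm (P' x / of_real k) * norm (of_real k * U x)))"
proof -
  let ?e = "p/2 - 1"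
  let ?G = "\<lambda>x. ((1 + (norm (P x))\<^sup>2) powr ?e) *\<^sub>R cnj (P x)"
  let ?G' = "\<lambda>x. ((1 + (norm (P x))\<^sup>2) powr ?e) *\<^sub>R cnj (P' x)
       + (?e * (1 + (norm (P x))\<^sup>2) powr (?e - 1) * (2 * Re (cnj (P x) * P' x))) *\<^sub>R cnj (P x)"
  have cP: "continuous_on {0..1} P" using P by (meson continuous_on_eq_continuous_within has_vector_derivative_continuous)
  have cU: "continuous_on {0..1} U" using U by (meson continuous_on_eq_continuous_within has_vector_derivative_continuous)
  have "((\<lambda>x. ?G x * t x + ?G' x * U x) has_integral (?G 1 * U 1 - ?G 0 * U 0)) {0..1}"
  proof (rule fundamental_theorem_of_calculus)
    fix x :: real
    show "((\<lambda>x. ?G x * U x) has_vector_derivative ?G x * t x + ?G' x * U x) (at x within {0..1})"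
      by (intro has_vector_derivative_mult has_vector_derivative_smooth_power P U)
  qed simp
  then have sum0: "((\<lambda>x. ?G x * t x + ?G' x * U x) has_integral 0) {0..1}" using per by simp
  have cG: "continuous_on {0..1} ?G" by (intro continuous_intros continuous_on_smooth_power cP)
  have iGt: "(\<lambda>x. ?G x * t x) integrable_on {0..1}"
    by (intro integrable_continuous_real continuous_intros cG cont)
  have "((\<lambda>x. (?G x * t x + ?G' x * U x) - ?G x * t x) has_integral (0 - integral {0..1} (\<lambda>x. ?G x * t x))) {0..1}"
    by (intro has_integral_diff sum0 integrable_integral iGt)
  then have parts: "((\<lambda>x. ?G' x * U x) has_integral (- integral {0..1} (\<lambda>x. ?G x * t x))) {0..1}" by simp
  let ?b = "\<lambda>x. (p - 1) * ((1 + (norm (P x))\<^sup>2) powr ?e * (norm (P' x / of_real k) * norm (of_real k * U x)))"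
  have ib: "?b integrable_on {0..1}"
    by (intro integrable_continuous_real continuous_intros continuous_on_smooth_power cP cU cont) (use k in auto)
  have "norm (integral {0..1} (\<lambda>x. ?G' x * U x)) \<le> integral {0..1} ?b"
  proof (rule integral_norm_bound_integral)
    show "(\<lambda>x. ?G' x * U x) integrable_on {0..1}" using parts by blast
    fix x :: real
    have "norm (?G' x * U x) = norm (?G' x) * norm (U x)" by (rule norm_mult)
    also have "\<dots> \<le> ((2 * ?e + 1) * ((1 + (norm (P x))\<^sup>2) powr ?e * norm (P' x))) * norm (U x)"
      using p by (intro mult_right_mono norm_deriv_smooth_power_le) auto
    also have "\<dots> = ?b x" using k by (simp add: norm_mult norm_divide)
    finally show "norm (?G' x * U x) \<le> ?b x" .
  qed (rule ib)
  then have "norm (integral {0..1} (\<lambda>x. ?G x * t x)) \<le> integral {0..1} ?b"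
    using integral_unique[OF parts] by simp
  moreover have "integral {0..1} (\<lambda>x. Re (?G x * t x)) = Re (integral {0..1} (\<lambda>x. ?G x * t x))"
    using integral_linear[OF iGt bounded_linear_Re] by (simp add: o_def)
  moreover have "(\<lambda>x. Re (?G x * t x)) = (\<lambda>x. (1 + (norm (P x))\<^sup>2) powr ?e * Re (cnj (P x) * t x))"
    by (simp add: algebra_simps)
  ultimately have "integral {0..1} (\<lambda>x. (1 + (norm (P x))\<^sup>2) powr ?e * Re (cnj (P x) * t x)) \<le> integral {0..1} ?b"
    using complex_Re_le_cmod[of "integral {0..1} (\<lambda>x. ?G x * t x)"] by simp
  then show ?thesis by (simp only: integral_mult_right)
qed

text \<open>Here \<open>k\<close> is the frequency scale of the new block \<open>t\<close>: P' is at
  most of order k and the antiderivative U of order 1/k, so P'/k and kU are comparable in size to t.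
  Young's inequality with parameter 1/J gives the old energy a factor 1 + C/J, harmless over J
  steps, at the price J^(p/2-1) on the moments of the block data.\<close>

lemma smooth_energy_step:
  fixes p :: real
  assumes p: "p > 2"
  obtains C where "C > 0" and "\<And>P P' t U k J.
     \<lbrakk>k > 0; J \<ge> 1; \<And>x. (P has_vector_derivative P' x) (at x within {0..1});
      \<And>x. (U has_vector_derivative t x) (at x within {0..1}); P 0 = P 1; U 0 = U 1;
      continuous_on {0..1} P'; continuous_on {0..1} t\<rbrakk> \<Longrightarrow>
     smooth_energy p (\<lambda>x. P x + t x) \<le> (1 + C / J) * smooth_energy p P + C * J powr (p/2 - 1) *
       (integral {0..1} (\<lambda>x. norm (P' x / of_real k) powr p) + integral {0..1} (\<lambda>x. norm (of_real k * U x) powr p)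
        + integral {0..1} (\<lambda>x. norm (t x) powr p))"
proof -
  obtain C0 where C0: "C0 > 0" and exp: "\<And>z w :: complex. (1 + (norm (z + w))\<^sup>2) powr (p/2) \<le> (1 + (norm z)\<^sup>2) powr (p/2)
     + p * ((1 + (norm z)\<^sup>2) powr (p/2 - 1) * Re (cnj z * w))
     + C0 * ((1 + (norm z)\<^sup>2) powr (p/2 - 1) * (norm w)\<^sup>2 + norm w powr p)"
    using smooth_power_expansion[OF p] by blast
  define C where "C = 2 * p\<^sup>2 + 2 * C0"
  have C: "C > 0" using C0 by (simp add: C_def add_nonneg_pos)
  have "smooth_energy p (\<lambda>x. P x + t x) \<le> (1 + C / J) * smooth_energy p P + C * J powr (p/2 - 1) *
       (integral {0..1} (\<lambda>x. norm (P' x / of_real k) powr p) + integral {0..1} (\<lambda>x. norm (of_real k * U x) powr p)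
        + integral {0..1} (\<lambda>x. norm (t x) powr p))"
    if k: "k > 0" and J: "J \<ge> 1" and P: "\<And>x. (P has_vector_derivative P' x) (at x within {0..1})"
      and U: "\<And>x. (U has_vector_derivative t x) (at x within {0..1})"
      and per: "P 0 = P 1" "U 0 = U 1"
      and cont: "continuous_on {0..1} P'" "continuous_on {0..1} t" for P P' t U :: "real \<Rightarrow> complex" and k J :: real
  proof -
    let ?e = "p/2 - 1"
    let ?R = "\<lambda>x. 1 + (norm (P x))\<^sup>2"
    let ?Q = "\<lambda>x. P' x / of_real k" and ?V = "\<lambda>x. of_real k * U x"
    have p0: "p > 0" using p by simp
    have cP: "continuous_on {0..1} P" using P by (meson continuous_on_eq_continuous_within has_vector_derivative_continuous)
    have cU: "continuous_on {0..1} U" using U by (meson continuous_on_eq_continuous_within has_vector_derivative_continuous)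
    have cQ: "continuous_on {0..1} ?Q" using k by (intro continuous_intros cont) auto
    have cV: "continuous_on {0..1} ?V" by (intro continuous_intros cU)
    note ci = continuous_on_smooth_power continuous_on_norm_powr cP cU cQ cV cont p0 continuous_on_add
      continuous_on_mult continuous_on_norm continuous_on_power continuous_on_const continuous_on_Re continuous_on_cnj
    define Y where "Y = smooth_energy p P"
    define a where "a = integral {0..1} (\<lambda>x. norm (?Q x) powr p)"
    define b where "b = integral {0..1} (\<lambda>x. norm (?V x) powr p)"
    define c where "c = integral {0..1} (\<lambda>x. norm (t x) powr p)"
    have nn: "a \<ge> 0" "b \<ge> 0" "c \<ge> 0" by (simp_all add: a_def b_def c_def)
    have Y0: "Y \<ge> 0" unfolding Y_def smooth_energy_def
      by (intro integral_nonneg integrable_continuous_real ci) auto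
    let ?JJ = "J powr ?e"
    have JJ: "?JJ \<ge> 1" using J p by (intro ge_one_powr_ge_zero) auto
    have young: "?R x powr ?e * y\<^sup>2 \<le> ?R x powr (p/2) / J + ?JJ * y powr p" if "y \<ge> 0" for x y
    proof -
      have "?R x > 0" by (intro add_pos_nonneg) auto
      from powr_young[OF this that, of "1 / J" "p/2"] J p
      have "?R x powr (p/2 - 1) * y\<^sup>2 \<le> 1 / J * ?R x powr (p/2) + (1 / J) powr (1 - p/2) * y powr (2 * (p/2))"
        by simp
      also have "(1 / J) powr (1 - p/2) = ?JJ"
        using J by (simp add: powr_divide powr_minus_divide[symmetric])
      finally show ?thesis by simp
    qed
    have I1: "integral {0..1} (\<lambda>x. ?R x powr ?e * (norm (?Q x) * norm (?V x))) \<le> 2 * Y / J + ?JJ * (a + b)"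
    proof -
      have "integral {0..1} (\<lambda>x. ?R x powr ?e * (norm (?Q x) * norm (?V x)))
        \<le> integral {0..1} (\<lambda>x. 2 / J * ?R x powr (p/2) + ?JJ * (norm (?Q x) powr p + norm (?V x) powr p))"
      proof (intro integral_le integrable_continuous_real ci)
        fix x
        have "norm (?Q x) * norm (?V x) \<le> (norm (?Q x))\<^sup>2 + (norm (?V x))\<^sup>2"
        proof -
          have "u * v \<le> u\<^sup>2 + v\<^sup>2" if "u \<ge> 0" "v \<ge> 0" for u v :: real
            using sum_squares_bound[of u v] mult_nonneg_nonneg[OF that] by linarith
          then show ?thesis by (meson norm_ge_zero)
        qed
        then have "?R x powr ?e * (norm (?Q x) * norm (?V x)) \<le> ?R x powr ?e * ((norm (?Q x))\<^sup>2 + (norm (?V x))\<^sup>2)"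
          by (intro mult_left_mono) auto
        also have "\<dots> \<le> (?R x powr (p/2) / J + ?JJ * norm (?Q x) powr p) + (?R x powr (p/2) / J + ?JJ * norm (?V x) powr p)"
          using add_mono[OF young[OF norm_ge_zero[of "?Q x"], of x] young[OF norm_ge_zero[of "?V x"], of x]]
          by (simp only: distrib_left)
        also have "\<dots> = 2 / J * ?R x powr (p/2) + ?JJ * (norm (?Q x) powr p + norm (?V x) powr p)"
          by (simp add: distrib_left)
        finally show "?R x powr ?e * (norm (?Q x) * norm (?V x)) \<le> 2 / J * ?R x powr (p/2) + ?JJ * (norm (?Q x) powr p + norm (?V x) powr p)" .
      qed
      also have "\<dots> = 2 / J * Y + ?JJ * (a + b)"
      proof -
        have i: "(\<lambda>x. ?R x powr (p/2)) integrable_on {0..1}" "(\<lambda>x. norm (?Q x) powr p) integrable_on {0..1}"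
          "(\<lambda>x. norm (?V x) powr p) integrable_on {0..1}"
          by (intro integrable_continuous_real ci)+
        show ?thesis unfolding Y_def smooth_energy_def a_def b_def
          by (simp only: integral_add integral_mult_right i integrable_on_mult_right integrable_add)
      qed
      finally show ?thesis by simp
    qed
    have I2: "integral {0..1} (\<lambda>x. ?R x powr ?e * (norm (t x))\<^sup>2 + norm (t x) powr p) \<le> Y / J + 2 * (?JJ * c)"
    proof -
      have "integral {0..1} (\<lambda>x. ?R x powr ?e * (norm (t x))\<^sup>2 + norm (t x) powr p)
        \<le> integral {0..1} (\<lambda>x. 1 / J * ?R x powr (p/2) + 2 * ?JJ * norm (t x) powr p)"
      proof (intro integral_le integrable_continuous_real ci)
        fix x
        have "1 * norm (t x) powr p \<le> ?JJ * norm (t x) powr p" by (intro mult_right_mono JJ) auto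
        then show "?R x powr ?e * (norm (t x))\<^sup>2 + norm (t x) powr p \<le> 1 / J * ?R x powr (p/2) + 2 * ?JJ * norm (t x) powr p"
          using young[of "norm (t x)" x] by simp
      qed
      also have "\<dots> = 1 / J * Y + 2 * ?JJ * c"
      proof -
        have i: "(\<lambda>x. ?R x powr (p/2)) integrable_on {0..1}" "(\<lambda>x. norm (t x) powr p) integrable_on {0..1}"
          by (intro integrable_continuous_real ci)+
        show ?thesis unfolding Y_def smooth_energy_def c_def
          by (simp only: integral_add integral_mult_right i integrable_on_mult_right)
      qed
      finally show ?thesis by simp
    qed
    have "smooth_energy p (\<lambda>x. P x + t x) \<le> integral {0..1} (\<lambda>x. (?R x powr (p/2)
        + p * (?R x powr ?e * Re (cnj (P x) * t x))) + C0 * (?R x powr ?e * (norm (t x))\<^sup>2 + norm (t x) powr p))"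
      unfolding smooth_energy_def
      by (intro integral_le integrable_continuous_real ci exp)
    also have "\<dots> = Y + p * integral {0..1} (\<lambda>x. ?R x powr ?e * Re (cnj (P x) * t x))
        + C0 * integral {0..1} (\<lambda>x. ?R x powr ?e * (norm (t x))\<^sup>2 + norm (t x) powr p)"
    proof -
      have i: "(\<lambda>x. ?R x powr (p/2)) integrable_on {0..1}" "(\<lambda>x. ?R x powr ?e * Re (cnj (P x) * t x)) integrable_on {0..1}"
        "(\<lambda>x. ?R x powr ?e * (norm (t x))\<^sup>2 + norm (t x) powr p) integrable_on {0..1}"
        by (intro integrable_continuous_real ci)+
      show ?thesis unfolding Y_def smooth_energy_def
        by (subst integral_add, intro integrable_add integrable_on_mult_right i, intro integrable_on_mult_right i,
            subst integral_add, intro i, intro integrable_on_mult_right i) (simp only: integral_mult_right)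
    qed
    also have "\<dots> \<le> Y + p * ((p - 1) * (2 * Y / J + ?JJ * (a + b))) + C0 * (Y / J + 2 * (?JJ * c))"
    proof -
      have "integral {0..1} (\<lambda>x. ?R x powr ?e * Re (cnj (P x) * t x)) \<le> (p - 1) * integral {0..1} (\<lambda>x. ?R x powr ?e * (norm (?Q x) * norm (?V x)))"
        by (rule smooth_energy_cross_term[OF p k P U per cont])
      also have "\<dots> \<le> (p - 1) * (2 * Y / J + ?JJ * (a + b))" using p by (intro mult_left_mono I1) auto
      finally show ?thesis using p C0 by (intro add_mono mult_left_mono I2) auto
    qed
    also have "\<dots> \<le> Y + p\<^sup>2 * (2 * Y / J + ?JJ * (a + b)) + C0 * (Y / J + 2 * (?JJ * c))"
    proof -
      have "0 \<le> 2 * Y / J + ?JJ * (a + b)" using Y0 J nn by (intro add_nonneg_nonneg) auto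
      moreover have "p * (p - 1) \<le> p\<^sup>2" using p by (simp add: power2_eq_square algebra_simps)
      ultimately have "p * (p - 1) * (2 * Y / J + ?JJ * (a + b)) \<le> p\<^sup>2 * (2 * Y / J + ?JJ * (a + b))"
        by (intro mult_right_mono)
      then show ?thesis by (simp only: mult.assoc)
    qed
    also have "\<dots> \<le> Y + C * (Y / J) + C * (?JJ * (a + b + c))"
    proof -
      have "2 * p\<^sup>2 * (Y / J) + C0 * (Y / J) \<le> C * (Y / J)"
        unfolding distrib_right[symmetric] using C0 Y0 J by (intro mult_right_mono) (auto simp: C_def)
      moreover have "p\<^sup>2 * (?JJ * (a + b)) \<le> C * (?JJ * (a + b))"
        using C0 nn by (intro mult_right_mono) (auto simp: C_def)
      moreover have "2 * C0 * (?JJ * c) \<le> C * (?JJ * c)"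
        using C0 nn by (intro mult_right_mono) (auto simp: C_def)
      ultimately show ?thesis by (simp only: distrib_left mult.assoc) (simp add: algebra_simps)
    qed
    finally show ?thesis by (simp add: Y_def a_def b_def c_def algebra_simps)
  qed
  from that[OF C this] show thesis .
qed

text \<open>Over J steps the factors 1 + C/J multiply to at most exp C, and the source terms add up
  to J * J^(p/2-1) * B^p = (B sqrt J)^p up to a constant. The powers of 4 reflect frequencies n^2
  with n of size 2^j; B >= 1 absorbs the initial energy 1.\<close>

lemma Lp_norm_lacunary_sum_le:
  fixes p :: real
  assumes p: "p > 2"
  obtains C where "C > 0" and "\<And>t U d B J.
     \<lbrakk>B \<ge> 1; J \<ge> 1; \<And>j x. (U j has_vector_derivative t j x) (at x within {0..1});
      \<And>j x. (t j has_vector_derivative d j x) (at x within {0..1});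
      \<And>j. continuous_on {0..1} (d j); \<And>j. t j 0 = t j 1; \<And>j. U j 0 = U j 1;
      \<And>j. j < J \<Longrightarrow> Lp_norm p (t j) \<le> B \<and> Lp_norm p (U j) \<le> B / 4^j \<and> Lp_norm p (d j) \<le> B * 4^j\<rbrakk> \<Longrightarrow>
     Lp_norm p (\<lambda>x. \<Sum>j<J. t j x) \<le> C * (B * sqrt (real J))"
proof (rule smooth_energy_step[OF p], goal_cases)
  case (1 C)
  note C = 1(2) and step = 1(3)
  define D where "D = exp C * (1 + 3 * C)"
  have D: "D > 0" using C by (simp add: D_def add_pos_pos)
  have p0: "p > 0" "p \<ge> 1" using p by auto
  have main: "Lp_norm p (\<lambda>x. \<Sum>j<J. t j x) \<le> D powr (1/p) * (B * sqrt (real J))"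
    if B: "B \<ge> 1" and J: "J \<ge> 1"
      and U: "\<And>j x. (U j has_vector_derivative t j x) (at x within {0..1})"
      and t: "\<And>j x. (t j has_vector_derivative d j x) (at x within {0..1})"
      and cd: "\<And>j. continuous_on {0..1} (d j)" and per: "\<And>j. t j 0 = t j 1" "\<And>j. U j 0 = U j 1"
      and bd: "\<And>j. j < J \<Longrightarrow> Lp_norm p (t j) \<le> B \<and> Lp_norm p (U j) \<le> B / 4^j \<and> Lp_norm p (d j) \<le> B * 4^j"
    for t U d :: "nat \<Rightarrow> real \<Rightarrow> complex" and B :: real and J :: nat
  proof -
    have ct: "continuous_on {0..1} (t j)" for j
      using t by (meson continuous_on_eq_continuous_within has_vector_derivative_continuous)
    have cU: "continuous_on {0..1} (U j)" for j
      using U by (meson continuous_on_eq_continuous_within has_vector_derivative_continuous)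
    let ?P = "\<lambda>j x. \<Sum>i<j. t i x"
    let ?P' = "\<lambda>j x. \<Sum>i<j. d i x"
    let ?a = "real J powr (p/2 - 1)"
    define Y where "Y = (\<lambda>j. smooth_energy p (?P j))"
    have a1: "?a \<ge> 1" using J p by (intro ge_one_powr_ge_zero) auto
    have Bp: "B powr p \<ge> 1" using B p0 by (intro ge_one_powr_ge_zero) auto
    have ind: "Y (Suc j) \<le> (1 + C / real J) * Y j + 3 * C * ?a * B powr p" if j: "j < J" for j
    proof -
      have "Y (Suc j) = smooth_energy p (\<lambda>x. ?P j x + t j x)" by (simp add: Y_def)
      also have "\<dots> \<le> (1 + C / real J) * smooth_energy p (?P j) + C * ?a *
       (integral {0..1} (\<lambda>x. norm (?P' j x / of_real (4^j)) powr p) + integral {0..1} (\<lambda>x. norm (of_real (4^j) * U j x) powr p)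
        + integral {0..1} (\<lambda>x. norm (t j x) powr p))"
      proof (rule step)
        show "(?P j has_vector_derivative ?P' j x) (at x within {0..1})" for x
          by (intro has_vector_derivative_sum t)
      qed (use J U per in \<open>auto intro!: continuous_intros cd ct sum.cong\<close>)
      also have "\<dots> \<le> (1 + C / real J) * smooth_energy p (?P j) + C * ?a * (B powr p + B powr p + B powr p)"
      proof -
        \<comment> \<open>Derivatives of the earlier blocks grow geometrically, so their sum is
          comparable to the last one and dividing by 4^j brings it back to B.\<close>
        have "integral {0..1} (\<lambda>x. norm (?P' j x / of_real (4^j)) powr p) \<le> B powr p"
        proof (rule integral_norm_powr_le)
          have "Lp_norm p (\<lambda>x. ?P' j x / of_real (4^j)) = Lp_norm p (\<lambda>x. of_real (1 / 4^j) * ?P' j x)"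
            by (rule Lp_norm_cong) simp
          also have "\<dots> = 1 / 4^j * Lp_norm p (?P' j)"
            by (subst Lp_norm_scale) (use p0 in \<open>auto intro!: continuous_intros cd simp: norm_divide norm_power\<close>)
          also have "\<dots> \<le> 1 / 4^j * (\<Sum>i<j. Lp_norm p (d i))"
            by (intro mult_left_mono Lp_norm_sum_le cd p0) auto
          also have "\<dots> \<le> 1 / 4^j * (\<Sum>i<j. B * 4^i)"
            using bd j by (intro mult_left_mono sum_mono) auto
          also have "\<dots> = 1 / 4^j * (B * ((4^j - 1) / 3))"
            by (simp add: sum_distrib_left[symmetric] sum_gp_strict) (simp add: field_simps)
          also have "\<dots> \<le> 1 / 4^j * (B * 4^j)"
          proof -
            have "(4^j - 1) / 3 \<le> (4::real)^j" using frac_le[of "(4::real)^j" "4^j - 1" 1 3] by simp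
            then show ?thesis using B by (intro mult_left_mono) auto
          qed
          also have "\<dots> = B" by simp
          finally show "Lp_norm p (\<lambda>x. ?P' j x / of_real (4^j)) \<le> B" .
        qed (use p0 in \<open>auto intro!: continuous_intros cd\<close>)
        moreover have "integral {0..1} (\<lambda>x. norm (of_real (4^j) * U j x) powr p) \<le> B powr p"
        proof (rule integral_norm_powr_le)
          have "Lp_norm p (\<lambda>x. of_real (4^j) * U j x) = 4^j * Lp_norm p (U j)"
            by (subst Lp_norm_scale) (use p0 cU in \<open>auto simp: norm_power\<close>)
          also have "\<dots> \<le> 4^j * (B / 4^j)" using bd j by (intro mult_left_mono) auto
          finally show "Lp_norm p (\<lambda>x. of_real (4^j) * U j x) \<le> B" by simp
        qed (use p0 in \<open>auto intro!: continuous_intros cU\<close>)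
        moreover have "integral {0..1} (\<lambda>x. norm (t j x) powr p) \<le> B powr p"
          using bd j by (intro integral_norm_powr_le ct p0) auto
        ultimately show ?thesis using C by (intro add_left_mono mult_left_mono add_mono) auto
      qed
      finally show ?thesis by (simp add: Y_def)
    qed
    \<comment> \<open>Discrete Gronwall: the recursion \<open>ind\<close> is solved with the growth
      factor pulled out of all source terms.\<close>
    have "Y j \<le> (1 + C / real J)^j * (1 + real j * (3 * C * ?a * B powr p))" if "j \<le> J" for j
      using that
    proof (induction j)
      case 0
      then show ?case by (simp add: Y_def smooth_energy_def)
    next
      case (Suc j)
      let ?g = "1 + C / real J" and ?m = "3 * C * ?a * B powr p"
      have g1: "?g \<ge> 1" using C by simp
      have m0: "?m \<ge> 0" using C by simp
      have "Y (Suc j) \<le> ?g * Y j + ?m" using ind Suc by simp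
      also have "\<dots> \<le> ?g * (?g^j * (1 + real j * ?m)) + ?g^Suc j * ?m"
      proof (intro add_mono mult_left_mono)
        show "?m \<le> ?g^Suc j * ?m" using one_le_power[OF g1, of "Suc j"] m0 mult_right_mono[of 1 "?g^Suc j" ?m] by simp
      qed (use Suc g1 in auto)
      also have "\<dots> = ?g^Suc j * (1 + real (Suc j) * ?m)" by (simp add: algebra_simps)
      finally show ?case .
    qed
    from this[of J] have YJ: "Y J \<le> (1 + C / real J)^J * (1 + real J * (3 * C * ?a * B powr p))" by simp
    have "(1 + C / real J)^J \<le> exp C"
    proof -
      have "(1 + C / real J)^J \<le> exp (C / real J)^J"
        using C by (intro power_mono) (auto simp: exp_ge_add_one_self add_nonneg_nonneg)
      also have "\<dots> = exp C" using J by (simp flip: exp_of_nat_mult)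
      finally show ?thesis .
    qed
    moreover have "1 + real J * (3 * C * ?a * B powr p) \<le> (1 + 3 * C) * (real J * ?a * B powr p)"
    proof -
      have "1 \<le> real J * ?a" using mult_mono[of 1 "real J" 1 ?a] J a1 by simp
      then have "1 \<le> real J * ?a * B powr p" using mult_mono[of 1 "real J * ?a" 1 "B powr p"] Bp by simp
      then show ?thesis by (simp add: algebra_simps)
    qed
    ultimately have "(1 + C / real J)^J * (1 + real J * (3 * C * ?a * B powr p)) \<le> exp C * ((1 + 3 * C) * (real J * ?a * B powr p))"
      using C by (intro mult_mono) (auto intro!: add_nonneg_nonneg)
    with YJ have "Y J \<le> exp C * ((1 + 3 * C) * (real J * ?a * B powr p))" by linarith
    also have "\<dots> = D * (real J powr (p/2) * B powr p)"
      using J by (simp add: D_def powr_diff)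
    also have "\<dots> = (D powr (1/p) * (B * sqrt (real J))) powr p"
      using D B p0 by (simp add: powr_mult powr_powr powr_half_sqrt[symmetric] mult_ac)
    finally have YJ2: "Y J \<le> (D powr (1/p) * (B * sqrt (real J))) powr p" .
    show ?thesis
    proof (rule Lp_norm_leI)
      have cPJ: "continuous_on {0..1} (?P J)" by (intro continuous_intros ct)
      have "integral {0..1} (\<lambda>x. norm (?P J x) powr p) \<le> Y J"
        unfolding Y_def smooth_energy_def
      proof (intro integral_le integrable_norm_powr p0 cPJ integrable_continuous_real continuous_on_smooth_power)
        fix x
        have "norm (?P J x) powr p = ((norm (?P J x))\<^sup>2) powr (p/2)"
          using p0 by (cases "norm (?P J x) = 0") (auto simp: powr_powr simp flip: powr_numeral)
        also have "\<dots> \<le> (1 + (norm (?P J x))\<^sup>2) powr (p/2)" using p0 by (intro powr_mono2) auto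
        finally show "norm (?P J x) powr p \<le> (1 + (norm (?P J x))\<^sup>2) powr (p/2)" .
      qed
      with YJ2 show "integral {0..1} (\<lambda>x. norm (?P J x) powr p) \<le> (D powr (1/p) * (B * sqrt (real J))) powr p"
        by linarith
    qed (use p0 B in \<open>auto intro!: continuous_intros ct\<close>)
  qed
  have "D powr (1/p) > 0" using D by simp
  from that[OF this main] show thesis .
qed

section \<open>Upper bounds\<close>

lemma TN_eq_ee: "TN s N x = (\<Sum>n=1..N. of_real (real n powr (- 2 * s)) * ee ((real n)\<^sup>2 * x))"
  unfolding TN_def
proof (rule sum.cong[OF refl])
  fix n
  have "exp (2 * pi * \<i> * complex_of_real ((real n)\<^sup>2 * x)) = ee ((real n)\<^sup>2 * x)"
    by (simp add: ee_def cis_conv_exp mult_ac)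
  then show "complex_of_real (real n powr (- 2 * s)) * exp (2 * pi * \<i> * complex_of_real ((real n)\<^sup>2 * x))
     = of_real (real n powr (- 2 * s)) * ee ((real n)\<^sup>2 * x)" by simp
qed

lemma continuous_on_TN [continuous_intros]: "continuous_on A (TN s N)"
  unfolding TN_eq_ee by (intro continuous_intros)

lemma TN_eq_sum_blocks:
  assumes "N < 2^J"
  shows "TN s N x = (\<Sum>j<J. block (- 2 * s) N j x)"
proof -
  let ?f = "\<lambda>n. complex_of_real (real n powr (- 2 * s)) * ee ((real n)\<^sup>2 * x)"
  have "(\<Sum>j<J. block (- 2 * s) N j x) = (\<Sum>n\<in>{1..<2^J} \<inter> {..N}. ?f n)" for J
  proof (induction J)
    case (Suc J)
    have "{1..<2^Suc J} \<inter> {..N} = ({1..<2^J} \<inter> {..N}) \<union> ({2^J..<2^Suc J} \<inter> {..N})"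
      by (auto intro: less_le_trans)
    then have "(\<Sum>n\<in>{1..<2^Suc J} \<inter> {..N}. ?f n) = (\<Sum>n\<in>{1..<2^J} \<inter> {..N}. ?f n) + (\<Sum>n\<in>{2^J..<2^Suc J} \<inter> {..N}. ?f n)"
      by (simp only:) (intro sum.union_disjoint, auto)
    then show ?case by (simp only: sum.lessThan_Suc Suc) (simp only: block_def)
  qed simp
  moreover have "{1..<2^J} \<inter> {..N} = {1..N}" using assms by auto
  ultimately show ?thesis by (simp only: TN_eq_ee)
qed

text \<open>Differentiation multiplies by 2 pi i n^2 and so raises the exponent by 2. Read
  backwards, a block with exponent r - 2 divided by 2 pi i is a periodic antiderivative.\<close>

lemma block_has_vector_derivative:
  "(block r N j has_vector_derivative (2 * pi * \<i>) * block (r + 2) N j x) (at x within A)"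
proof -
  let ?S = "{2^j..<2^Suc j} \<inter> {..N}"
  have "((\<lambda>x. \<Sum>n\<in>?S. of_real (real n powr r) * ee ((real n)\<^sup>2 * x)) has_vector_derivative
      (\<Sum>n\<in>?S. of_real (real n powr r) * ((2 * pi * (real n)\<^sup>2) *\<^sub>R (\<i> * ee ((real n)\<^sup>2 * x))))) (at x within A)"
    by (intro has_vector_derivative_sum has_vector_derivative_mult_right ee_has_vector_derivative)
  moreover have "(\<Sum>n\<in>?S. of_real (real n powr r) * ((2 * pi * (real n)\<^sup>2) *\<^sub>R (\<i> * ee ((real n)\<^sup>2 * x))))
      = (2 * pi * \<i>) * block (r + 2) N j x"
    unfolding block_def sum_distrib_left
  proof (rule sum.cong[OF refl])
    fix n assume "n \<in> ?S"
    then have "real n > 0" using less_le_trans[of 0 "2^j" n] by simp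
    then have "real n powr (r + 2) = real n powr r * (real n)\<^sup>2" by (simp add: powr_add)
    then show "of_real (real n powr r) * ((2 * pi * (real n)\<^sup>2) *\<^sub>R (\<i> * ee ((real n)\<^sup>2 * x)))
      = (2 * pi * \<i>) * (of_real (real n powr (r + 2)) * ee ((real n)\<^sup>2 * x))"
      by (simp add: scaleR_conv_of_real mult_ac)
  qed
  ultimately show ?thesis by (simp only: block_def[abs_def])
qed

lemma block_periodic: "block r N j 0 = block r N j 1"
proof -
  have "ee ((real n)\<^sup>2) = 1" for n using ee_of_nat[of "n\<^sup>2"] by simp
  then show ?thesis by (simp add: block_def)
qed

section \<open>Summation over dyadic blocks\<close>

lemma dyadic_scale:
  assumes "N \<ge> 2"
  obtains k where "k \<ge> 1" "2^k \<le> N" "N < 2^Suc k" "real k \<le> 2 * ln (real N)" "ln (real N) \<le> 2 * real k"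
proof -
  obtain k where k: "2^k \<le> N" "N < 2^(k+1)" using ex_power_ivl1[of 2 N] assms by auto
  have k1: "k \<ge> 1" using k(2) assms by (cases k) auto
  have ln2: "1/2 \<le> ln (2::real)" "ln (2::real) \<le> 1" using ln2_ge_two_thirds ln2_le_25_over_36 by linarith+
  have "real (2^k) \<le> real N" using k(1) by (rule of_nat_mono)
  then have "ln ((2::real)^k) \<le> ln (real N)" using assms by (subst ln_le_cancel_iff) auto
  then have "real k * ln 2 \<le> ln (real N)" by (simp add: ln_realpow)
  moreover have "real k * (1/2) \<le> real k * ln 2" using ln2 by (intro mult_left_mono) auto
  ultimately have 1: "real k \<le> 2 * ln (real N)" by linarith
  have "real N \<le> real (2^(k+1))" using k(2) by (intro of_nat_mono) auto
  then have "ln (real N) \<le> ln ((2::real)^(k+1))" using assms by (subst ln_le_cancel_iff) auto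
  also have "\<dots> = real (k + 1) * ln 2" by (rule ln_realpow)
  also have "\<dots> \<le> real (k + 1) * 1" using ln2 by (intro mult_left_mono) auto
  finally have 2: "ln (real N) \<le> 2 * real k" using k1 by simp
  show thesis using that[OF k1 k(1) _ 1 2] k(2) by simp
qed

lemma one_plus_ln_powr_le:
  assumes "N \<ge> 2" "ta \<ge> 0"
  shows "(1 + ln (real N)) powr ta \<le> 3 powr ta * ln (real N) powr ta"
proof -
  have "ln 2 \<le> ln (real N)" using assms by simp
  then have l: "1/2 \<le> ln (real N)" using ln2_ge_two_thirds by linarith
  have "(1 + ln (real N)) powr ta \<le> (3 * ln (real N)) powr ta"
    using l assms by (intro powr_mono2) auto
  also have "\<dots> = 3 powr ta * ln (real N) powr ta" by (rule powr_mult)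
  finally show ?thesis .
qed

lemma powr_growth_two_power:
  assumes "N \<ge> 2" "2^j \<le> N" "ta \<ge> 0"
  shows "2 powr (r * real j) * growth sg ta (2^j) \<le> (2 powr (r + sg))^j * (3 powr ta * ln (real N) powr ta)"
proof -
  have "real (2^j) \<le> real N" using assms by (intro of_nat_mono) auto
  then have "ln ((2::real)^j) \<le> ln (real N)" using assms by (subst ln_le_cancel_iff) auto
  then have "(1 + ln (real (2^j))) powr ta \<le> (1 + ln (real N)) powr ta"
    using assms by (intro powr_mono2) (auto intro!: add_nonneg_nonneg)
  also have "\<dots> \<le> 3 powr ta * ln (real N) powr ta" by (rule one_plus_ln_powr_le) (use assms in auto)
  finally have l: "(1 + ln (real (2^j))) powr ta \<le> 3 powr ta * ln (real N) powr ta" .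
  have e: "real (2^j) powr sg = 2 powr (sg * real j)"
    by (simp add: powr_powr mult.commute flip: powr_realpow)
  have "2 powr (r * real j) * growth sg ta (2^j) = (2 powr (r * real j) * 2 powr (sg * real j)) * (1 + ln (real (2^j))) powr ta"
    unfolding growth_def e by simp
  also have "2 powr (r * real j) * 2 powr (sg * real j) = (2 powr (r + sg))^j"
    by (simp add: powr_power algebra_simps flip: powr_add)
  also have "(2 powr (r + sg))^j * (1 + ln (real (2^j))) powr ta \<le> (2 powr (r + sg))^j * (3 powr ta * ln (real N) powr ta)"
    by (intro mult_left_mono l) auto
  finally show ?thesis .
qed

text \<open>Triangle inequality over the blocks: they scale like powers of 2^(sg - 2 s), so away
  from the critical line the geometric series is dominated by one end.\<close>

lemma Lp_norm_TN_le_sum: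
  assumes adm: "admissible p sg ta"
  shows "\<exists>C>0. \<forall>N\<ge>2. \<forall>k. 2^k \<le> N \<longrightarrow> N < 2^Suc k \<longrightarrow>
    Lp_norm p (TN s N) \<le> C * ln (real N) powr ta * (\<Sum>j\<le>k. (2 powr (sg - 2 * s))^j)"
proof -
  note a = admissibleD[OF adm]
  obtain C where C: "C > 0" "\<And>N j. Lp_norm p (block (- 2 * s) N j) \<le> C * (2 powr ((- 2 * s) * real j) * growth sg ta (2^j))"
    using Lp_norm_block_le[OF adm] by blast
  have "Lp_norm p (TN s N) \<le> (C * 3 powr ta) * ln (real N) powr ta * (\<Sum>j\<le>k. (2 powr (sg - 2 * s))^j)"
    if N: "N \<ge> 2" and k: "2^k \<le> N" "N < 2^Suc k" for N k
  proof -
    have "Lp_norm p (TN s N) = Lp_norm p (\<lambda>x. \<Sum>j<Suc k. block (- 2 * s) N j x)"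
      by (rule Lp_norm_cong) (rule TN_eq_sum_blocks[OF k(2)])
    also have "\<dots> \<le> (\<Sum>j<Suc k. Lp_norm p (block (- 2 * s) N j))"
      using a by (intro Lp_norm_sum_le continuous_intros) auto
    also have "\<dots> \<le> (\<Sum>j<Suc k. C * ((2 powr (- 2 * s + sg))^j * (3 powr ta * ln (real N) powr ta)))"
    proof (rule sum_mono)
      fix j assume "j \<in> {..<Suc k}"
      then have "(2::nat)^j \<le> 2^k" by (intro power_increasing) auto
      then have "2^j \<le> N" using k by linarith
      from powr_growth_two_power[OF N this a(3), of "- 2 * s" sg]
      have "C * (2 powr ((- 2 * s) * real j) * growth sg ta (2^j)) \<le> C * ((2 powr (- 2 * s + sg))^j * (3 powr ta * ln (real N) powr ta))"
        using C by (intro mult_left_mono) auto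
      with C(2)[of N j] show "Lp_norm p (block (- 2 * s) N j) \<le> C * ((2 powr (- 2 * s + sg))^j * (3 powr ta * ln (real N) powr ta))"
        by linarith
    qed
    also have "\<dots> = (C * 3 powr ta) * ln (real N) powr ta * (\<Sum>j\<le>k. (2 powr (sg - 2 * s))^j)"
      by (simp add: sum_distrib_left lessThan_Suc_atMost mult_ac)
    finally show ?thesis .
  qed
  then show ?thesis using C by (intro exI[of _ "C * 3 powr ta"]) auto
qed

text \<open>The series grows geometrically, and its last term, at scale N, carries the
  bound.\<close>

lemma Lp_norm_TN_le_supercritical:
  assumes adm: "admissible p sg ta" and s: "sg > 2 * s"
  shows "\<exists>C>0. \<forall>N\<ge>2. Lp_norm p (TN s N) \<le> C * (real N powr (sg - 2 * s) * ln (real N) powr ta)"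
proof -
  define x where "x = (2::real) powr (sg - 2 * s)"
  have x: "x > 1" using s by (simp add: x_def)
  obtain C where C: "C > 0" and bd: "\<And>N k. N \<ge> 2 \<Longrightarrow> 2^k \<le> N \<Longrightarrow> N < 2^Suc k \<Longrightarrow>
    Lp_norm p (TN s N) \<le> C * ln (real N) powr ta * (\<Sum>j\<le>k. x^j)"
    using Lp_norm_TN_le_sum[OF adm, of s] unfolding x_def by blast
  have "Lp_norm p (TN s N) \<le> C * (x / (x - 1)) * (real N powr (sg - 2 * s) * ln (real N) powr ta)" if N: "N \<ge> 2" for N
  proof -
    obtain k where k: "2^k \<le> N" "N < 2^Suc k" using dyadic_scale[OF N] by blast
    have "(\<Sum>j\<le>k. x^j) = (x^Suc k - 1) / (x - 1)"
      using x geometric_sum[of x "Suc k"] by (simp add: lessThan_Suc_atMost)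
    also have "\<dots> \<le> x^Suc k / (x - 1)" using x by (intro divide_right_mono) auto
    also have "\<dots> = x / (x - 1) * x^k" by simp
    also have "\<dots> \<le> x / (x - 1) * real N powr (sg - 2 * s)"
    proof (rule mult_left_mono)
      have "x^k = (2^k) powr (sg - 2 * s)"
        unfolding x_def by (simp add: powr_power powr_powr mult.commute flip: powr_realpow)
      also have "\<dots> \<le> real N powr (sg - 2 * s)"
        using s of_nat_mono[OF k(1), where 'a = real] by (intro powr_mono2) auto
      finally show "x^k \<le> real N powr (sg - 2 * s)" .
    qed (use x in auto)
    finally have "(\<Sum>j\<le>k. x^j) \<le> x / (x - 1) * real N powr (sg - 2 * s)" .
    then have "C * ln (real N) powr ta * (\<Sum>j\<le>k. x^j) \<le> C * ln (real N) powr ta * (x / (x - 1) * real N powr (sg - 2 * s))"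
      using C by (intro mult_left_mono) auto
    then show ?thesis using bd[OF N k] by (simp add: mult_ac)
  qed
  moreover have "C * (x / (x - 1)) > 0" using C x by simp
  ultimately show ?thesis by blast
qed

lemma Lp_norm_TN_le_subcritical:
  assumes adm: "admissible p sg 0" and s: "sg < 2 * s"
  shows "\<exists>C>0. \<forall>N\<ge>2. Lp_norm p (TN s N) \<le> C * 1"
proof -
  define x where "x = (2::real) powr (sg - 2 * s)"
  have x: "0 < x" "x < 1" using s by (auto simp: x_def powr_less_one)
  obtain C where C: "C > 0" and bd: "\<And>N k. N \<ge> 2 \<Longrightarrow> 2^k \<le> N \<Longrightarrow> N < 2^Suc k \<Longrightarrow>
    Lp_norm p (TN s N) \<le> C * ln (real N) powr 0 * (\<Sum>j\<le>k. x^j)"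
    using Lp_norm_TN_le_sum[OF adm, of s] unfolding x_def by blast
  have "Lp_norm p (TN s N) \<le> (C * (1 / (1 - x))) * 1" if N: "N \<ge> 2" for N
  proof -
    obtain k where k: "2^k \<le> N" "N < 2^Suc k" using dyadic_scale[OF N] by blast
    have "(\<Sum>j\<le>k. x^j) = (1 - x^Suc k) / (1 - x)"
      using x sum_gp0[of x k] by simp
    also have "\<dots> \<le> 1 / (1 - x)" using x by (intro divide_right_mono) auto
    finally have "C * (\<Sum>j\<le>k. x^j) \<le> C * (1 / (1 - x))" using C by (intro mult_left_mono) auto
    moreover have "ln (real N) > 0" using N by simp
    ultimately show ?thesis using bd[OF N k] by simp
  qed
  moreover have "C * (1 / (1 - x)) > 0" using C x by simp
  ultimately show ?thesis by blast
qed

text \<open>All blocks now satisfy the same bound l = (log N)^ta up to a constant. The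
  antiderivative and derivative of a block are blocks with exponent shifted by -2 and +2, hence
  smaller and larger by exactly 4^j, as the lacunary estimate requires.\<close>

lemma Lp_norm_TN_le_critical:
  assumes adm: "admissible p sg ta" and s: "sg = 2 * s"
  shows "\<exists>C>0. \<forall>N\<ge>2. Lp_norm p (TN s N) \<le> C * ln (real N) powr (1/2 + ta)"
proof (rule Lp_norm_lacunary_sum_le[OF admissibleD(1)[OF adm]], goal_cases)
  case (1 C)
  note C = 1(1) and lac = 1(2)
  note a = admissibleD[OF adm]
  have p0: "p > 0" using a by simp
  obtain C1 where C1: "C1 > 0" "\<And>N j. Lp_norm p (block (- 2 * s) N j) \<le> C1 * (2 powr ((- 2 * s) * real j) * growth sg ta (2^j))"
    using Lp_norm_block_le[OF adm] by blast
  obtain C2 where C2: "C2 > 0" "\<And>N j. Lp_norm p (block (- 2 * s - 2) N j) \<le> C2 * (2 powr ((- 2 * s - 2) * real j) * growth sg ta (2^j))"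
    using Lp_norm_block_le[OF adm] by blast
  obtain C3 where C3: "C3 > 0" "\<And>N j. Lp_norm p (block (- 2 * s + 2) N j) \<le> C3 * (2 powr ((- 2 * s + 2) * real j) * growth sg ta (2^j))"
    using Lp_norm_block_le[OF adm] by blast
  \<comment> \<open>One summand for each of the three block bounds; the summand
    \<open>2 powr ta\<close> secures E * l >= 1, because ln N >= 1/2.\<close>
  define E where "E = 2 powr ta + C1 * 3 powr ta + C2 * 3 powr ta + 2 * pi * C3 * 3 powr ta"
  have E: "E > 0" using C1 C2 C3 by (simp add: E_def add_pos_pos)
  have "Lp_norm p (TN s N) \<le> (C * E * 2) * ln (real N) powr (1/2 + ta)" if N: "N \<ge> 2" for N
  proof -
    obtain k where k: "k \<ge> 1" "2^k \<le> N" "N < 2^Suc k" "real k \<le> 2 * ln (real N)" "ln (real N) \<le> 2 * real k"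
      using dyadic_scale[OF N] by blast
    define l where "l = ln (real N) powr ta"
    have lnN: "ln (real N) \<ge> 1/2"
    proof -
      have "ln 2 \<le> ln (real N)" using N by simp
      then show ?thesis using ln2_ge_two_thirds by linarith
    qed
    have l0: "l \<ge> 0" by (simp add: l_def)
    have l1: "2 powr ta * l \<ge> 1"
    proof -
      have "2 powr ta * l = (2 * ln (real N)) powr ta" by (simp only: l_def powr_mult)
      also have "\<dots> \<ge> 1" using lnN a by (intro ge_one_powr_ge_zero) auto
      finally show ?thesis .
    qed
    have pow2: "(2::nat)^j \<le> N" if "j < Suc k" for j
    proof -
      have "(2::nat)^j \<le> 2^k" using that by (intro power_increasing) auto
      then show ?thesis using k by linarith
    qed
    have four: "(2 powr (2::real))^j = 4^j" "(2 powr (-2::real))^j = 1 / 4^j" for j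
    proof -
      have "2 powr (2::real) = 4" "2 powr (-2::real) = 1 / 4" by (simp_all add: powr_minus_divide)
      then show "(2 powr (2::real))^j = 4^j" "(2 powr (-2::real))^j = 1 / 4^j"
        by (simp_all only: power_one_over)
    qed
    let ?t = "\<lambda>j. block (- 2 * s) N j" and ?U = "\<lambda>j x. 1 / (2 * pi * \<i>) * block (- 2 * s - 2) N j x"
      and ?d = "\<lambda>j x. (2 * pi * \<i>) * block (- 2 * s + 2) N j x"
    have "Lp_norm p (\<lambda>x. \<Sum>j<Suc k. ?t j x) \<le> C * ((E * l) * sqrt (real (Suc k)))"
    proof (rule lac[where U = ?U and d = ?d])
      have "2 powr ta * l \<le> E * l" unfolding E_def using C1 C2 C3 l0 by (intro mult_right_mono) auto
      then show "1 \<le> E * l" using l1 by linarith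
    next
      fix j x
      have "(?U j has_vector_derivative 1 / (2 * pi * \<i>) * ((2 * pi * \<i>) * block (- 2 * s - 2 + 2) N j x)) (at x within {0..1})"
        by (intro has_vector_derivative_mult_right block_has_vector_derivative)
      then show "(?U j has_vector_derivative ?t j x) (at x within {0..1})" by simp
      show "(?t j has_vector_derivative ?d j x) (at x within {0..1})"
        by (rule block_has_vector_derivative)
    next
      fix j assume j: "j < Suc k"
      note g = powr_growth_two_power[OF N pow2[OF j] a(3)]
      have "Lp_norm p (?t j) \<le> E * l"
      proof -
        have "Lp_norm p (?t j) \<le> C1 * (2 powr ((- 2 * s) * real j) * growth sg ta (2^j))" by (rule C1)
        also have "\<dots> \<le> C1 * ((2 powr (- 2 * s + sg))^j * (3 powr ta * ln (real N) powr ta))"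
          using C1 by (intro mult_left_mono g) auto
        also have "\<dots> = (C1 * 3 powr ta) * l" using s by (simp add: l_def)
        also have "\<dots> \<le> E * l" unfolding E_def using C1 C2 C3 l0 by (intro mult_right_mono) auto
        finally show ?thesis .
      qed
      moreover have "Lp_norm p (?U j) \<le> E * l / 4^j"
      proof -
        have "Lp_norm p (?U j) = norm (1 / (2 * pi * \<i>)) * Lp_norm p (block (- 2 * s - 2) N j)"
          by (rule Lp_norm_scale) (use p0 in \<open>auto intro!: continuous_intros\<close>)
        also have "\<dots> \<le> 1 * Lp_norm p (block (- 2 * s - 2) N j)"
          using pi_gt3 by (intro mult_right_mono) (auto simp: norm_divide norm_mult divide_le_eq)
        also have "\<dots> \<le> C2 * (2 powr ((- 2 * s - 2) * real j) * growth sg ta (2^j))" using C2(2) by simp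
        also have "\<dots> \<le> C2 * ((2 powr (- 2 * s - 2 + sg))^j * (3 powr ta * ln (real N) powr ta))"
          using C2 by (intro mult_left_mono g) auto
        also have "- 2 * s - 2 + sg = -2" using s by simp
        also have "C2 * ((2 powr (- 2))^j * (3 powr ta * ln (real N) powr ta)) = (C2 * 3 powr ta) * l / 4^j"
          unfolding four by (simp add: l_def)
        also have "\<dots> \<le> E * l / 4^j" unfolding E_def using C1 C2 C3 l0 by (intro divide_right_mono mult_right_mono) auto
        finally show ?thesis .
      qed
      moreover have "Lp_norm p (?d j) \<le> E * l * 4^j"
      proof -
        have "Lp_norm p (?d j) = norm (2 * pi * \<i>) * Lp_norm p (block (- 2 * s + 2) N j)"
          by (rule Lp_norm_scale) (use p0 in \<open>auto intro!: continuous_intros\<close>)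
        also have "\<dots> = 2 * pi * Lp_norm p (block (- 2 * s + 2) N j)" by (simp add: norm_mult)
        also have "\<dots> \<le> 2 * pi * (C3 * (2 powr ((- 2 * s + 2) * real j) * growth sg ta (2^j)))"
          by (intro mult_left_mono C3) auto
        also have "\<dots> \<le> 2 * pi * (C3 * ((2 powr (- 2 * s + 2 + sg))^j * (3 powr ta * ln (real N) powr ta)))"
          using C3 by (intro mult_left_mono g) auto
        also have "- 2 * s + 2 + sg = 2" using s by simp
        also have "2 * pi * (C3 * ((2 powr 2)^j * (3 powr ta * ln (real N) powr ta))) = (2 * pi * C3 * 3 powr ta) * l * 4^j"
          unfolding four by (simp add: l_def)
        also have "\<dots> \<le> E * l * 4^j" unfolding E_def using C1 C2 C3 l0 by (intro mult_right_mono) auto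
        finally show ?thesis .
      qed
      ultimately show "Lp_norm p (?t j) \<le> E * l \<and> Lp_norm p (?U j) \<le> E * l / 4^j \<and> Lp_norm p (?d j) \<le> E * l * 4^j" by blast
    qed (auto intro!: continuous_intros simp: block_periodic)
    also have "Lp_norm p (\<lambda>x. \<Sum>j<Suc k. ?t j x) = Lp_norm p (TN s N)"
      by (rule Lp_norm_cong) (rule TN_eq_sum_blocks[OF k(3), symmetric])
    also have "C * ((E * l) * sqrt (real (Suc k))) \<le> C * ((E * l) * (2 * sqrt (ln (real N))))"
    proof -
      have "real (Suc k) \<le> 2\<^sup>2 * ln (real N)" using k(1,4) lnN by simp
      then have "sqrt (real (Suc k)) \<le> sqrt (2\<^sup>2 * ln (real N))" by (rule real_sqrt_le_mono)
      also have "\<dots> = 2 * sqrt (ln (real N))" by (simp add: real_sqrt_mult)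
      finally show ?thesis using C E l0 by (intro mult_left_mono) auto
    qed
    also have "\<dots> = (C * E * 2) * (ln (real N) powr (1/2) * ln (real N) powr ta)"
      using lnN by (simp add: l_def powr_half_sqrt)
    also have "ln (real N) powr (1/2) * ln (real N) powr ta = ln (real N) powr (1/2 + ta)"
      by (simp add: powr_add)
    finally show ?thesis .
  qed
  moreover have "C * E * 2 > 0" using C E by simp
  ultimately show ?thesis by blast
qed

section \<open>Lower bounds\<close>

lemma has_integral_trig_sum:
  fixes c :: "'i \<Rightarrow> complex" and k :: "'i \<Rightarrow> int"
  assumes "finite A"
  shows "((\<lambda>x. \<Sum>i\<in>A. c i * ee (of_int (k i) * x)) has_integral (\<Sum>i\<in>A. if k i = 0 then c i else 0)) {0..1}"
proof (intro has_integral_sum assms)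
  fix i
  have "((\<lambda>x. c i * ee (of_int (k i) * x)) has_integral c i * (if k i = 0 then 1 else 0)) {0..1}"
    by (intro has_integral_mult_right integral_ee)
  then show "((\<lambda>x. c i * ee (of_int (k i) * x)) has_integral (if k i = 0 then c i else 0)) {0..1}"
    by (cases "k i = 0") auto
qed

lemma has_integral_norm_square_trig_sum:
  fixes W :: "'i \<Rightarrow> real" and k :: "'i \<Rightarrow> int"
  assumes A: "finite A"
  shows "((\<lambda>x. (norm (\<Sum>a\<in>A. of_real (W a) * ee (of_int (k a) * x)))\<^sup>2) has_integral
     (\<Sum>(a, b)\<in>A \<times> A. if k a = k b then W a * W b else 0)) {0..1}"
proof -
  let ?F = "\<lambda>x. \<Sum>a\<in>A. complex_of_real (W a) * ee (of_int (k a) * x)"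
  have eq: "complex_of_real ((norm (?F x))\<^sup>2)
      = (\<Sum>i\<in>A \<times> A. of_real (W (fst i) * W (snd i)) * ee (of_int (k (fst i) - k (snd i)) * x))" for x
  proof -
    have "complex_of_real ((norm (?F x))\<^sup>2) = ?F x * cnj (?F x)" by (rule complex_norm_square)
    also have "\<dots> = (\<Sum>a\<in>A. \<Sum>b\<in>A. (of_real (W a) * ee (of_int (k a) * x)) * cnj (of_real (W b) * ee (of_int (k b) * x)))"
      unfolding cnj_sum by (rule sum_product)
    also have "\<dots> = (\<Sum>a\<in>A. \<Sum>b\<in>A. of_real (W a * W b) * ee (of_int (k a - k b) * x))"
      by (intro sum.cong refl) (simp add: left_diff_distrib ee_diff)
    finally show ?thesis by (simp add: sum.cartesian_product case_prod_unfold)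
  qed
  have "((\<lambda>x. complex_of_real ((norm (?F x))\<^sup>2)) has_integral
     (\<Sum>i\<in>A \<times> A. if k (fst i) - k (snd i) = 0 then of_real (W (fst i) * W (snd i)) else 0)) {0..1}"
    unfolding eq by (rule has_integral_trig_sum) (use A in auto)
  from has_integral_linear[OF this bounded_linear_Re]
  have "((\<lambda>x. (norm (?F x))\<^sup>2) has_integral
     Re (\<Sum>i\<in>A \<times> A. if k (fst i) - k (snd i) = 0 then of_real (W (fst i) * W (snd i)) else 0)) {0..1}"
    by (simp only: o_def Re_complex_of_real)
  moreover have "Re (\<Sum>i\<in>A \<times> A. if k (fst i) - k (snd i) = 0 then of_real (W (fst i) * W (snd i)) else 0)
      = (\<Sum>(a, b)\<in>A \<times> A. if k a = k b then W a * W b else 0)"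
    unfolding Re_sum by (intro sum.cong) auto
  ultimately show ?thesis by simp
qed

lemma TN_eq_trig_sum:
  "TN s N x = (\<Sum>n\<in>{1..N}. of_real (real n powr (- 2 * s)) * ee (of_int ((int n)\<^sup>2) * x))"
  by (simp add: TN_eq_ee)

lemma integral_norm_square_TN:
  "integral {0..1} (\<lambda>x. norm (TN s N x) powr 2) = (\<Sum>n=1..N. real n powr (- 4 * s))"
proof -
  let ?w = "\<lambda>n. real n powr (- 2 * s)"
  have "((\<lambda>x. (norm (TN s N x))\<^sup>2) has_integral
     (\<Sum>(a, b)\<in>{1..N} \<times> {1..N}. if (int a)\<^sup>2 = (int b)\<^sup>2 then ?w a * ?w b else 0)) {0..1}"
    unfolding TN_eq_trig_sum by (rule has_integral_norm_square_trig_sum) simp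
  also have "(\<Sum>(a, b)\<in>{1..N} \<times> {1..N}. if (int a)\<^sup>2 = (int b)\<^sup>2 then ?w a * ?w b else 0)
     = (\<Sum>a=1..N. \<Sum>b=1..N. if a = b then ?w a * ?w b else 0)"
    unfolding sum.cartesian_product by (intro sum.cong refl) (auto simp: power2_eq_iff)
  also have "\<dots> = (\<Sum>n=1..N. real n powr (- 4 * s))"
    by (simp add: sum.delta flip: powr_add)
  finally show ?thesis by (simp add: integral_unique)
qed

text \<open>Only the upper half of the range is kept; there n and N differ by at most a factor 2,
  which costs 2^(-|r|) for either sign of r.\<close>

lemma sum_powr_ge:
  fixes r :: real
  assumes "N \<ge> 1"
  shows "2 powr (- \<bar>r\<bar>) / 2 * real N powr (1 - r) \<le> (\<Sum>n=1..N. real n powr (- r))"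
proof -
  let ?A = "{N - N div 2..N}"
  have "(\<Sum>n\<in>?A. 2 powr (- \<bar>r\<bar>) * real N powr (- r)) \<le> (\<Sum>n\<in>?A. real n powr (- r))"
  proof (rule sum_mono)
    fix n assume n: "n \<in> ?A"
    have n1: "n \<ge> 1" "n \<le> N" "N \<le> 2 * n" using n assms by auto
    show "2 powr (- \<bar>r\<bar>) * real N powr (- r) \<le> real n powr (- r)"
    proof (cases "r \<ge> 0")
      case True
      have "2 powr (- \<bar>r\<bar>) * real N powr (- r) \<le> 1 * real N powr (- r)"
        by (intro mult_right_mono) (auto simp: powr_le_one_le powr_mono[of _ 0 2, simplified])
      also have "\<dots> \<le> real n powr (- r)" using True n1 by (simp add: powr_mono2')
      finally show ?thesis .
    next
      case False
      have "2 powr (- \<bar>r\<bar>) * real N powr (- r) = (real N / 2) powr (- r)"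
        using False by (simp add: powr_divide powr_minus_divide)
      also have "\<dots> \<le> real n powr (- r)" using False n1 by (intro powr_mono2) auto
      finally show ?thesis .
    qed
  qed
  also have "\<dots> \<le> (\<Sum>n=1..N. real n powr (- r))" using assms by (intro sum_mono2) auto
  finally have 1: "real (card ?A) * (2 powr (- \<bar>r\<bar>) * real N powr (- r)) \<le> (\<Sum>n=1..N. real n powr (- r))" by simp
  have "real N / 2 \<le> real (card ?A)" by simp
  then have "real N / 2 * (2 powr (- \<bar>r\<bar>) * real N powr (- r)) \<le> real (card ?A) * (2 powr (- \<bar>r\<bar>) * real N powr (- r))"
    by (intro mult_right_mono) auto
  with 1 have 2: "real N / 2 * (2 powr (- \<bar>r\<bar>) * real N powr (- r)) \<le> (\<Sum>n=1..N. real n powr (- r))" by linarith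
  have "real N * real N powr (- r) = real N powr (1 - r)"
    using assms by (simp add: powr_diff powr_minus_divide)
  then have "2 powr (- \<bar>r\<bar>) / 2 * real N powr (1 - r) = real N / 2 * (2 powr (- \<bar>r\<bar>) * real N powr (- r))"
    by (simp add: mult_ac)
  with 2 show ?thesis by (simp only:)
qed

lemma sum_inverse_ge_ln:
  assumes "N \<ge> 1"
  shows "ln (real N) \<le> (\<Sum>n=1..N. real n powr (- 1))"
proof -
  have "ln (real (Suc N)) \<le> (\<Sum>n=1..N. real n powr (- 1))"
  proof (induction N)
    case (Suc n)
    have "ln (real (Suc (Suc n)) / real (Suc n)) \<le> real (Suc (Suc n)) / real (Suc n) - 1"
      by (intro ln_le_minus_one) auto
    also have "\<dots> = real (Suc n) powr (- 1)" by (simp add: powr_minus field_simps)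
    finally have "ln (real (Suc (Suc n))) - ln (real (Suc n)) \<le> real (Suc n) powr (- 1)"
      by (auto simp only: ln_div of_nat_eq_0_iff nat.distinct not_False_eq_True simp_thms if_True)
    with Suc show ?case by (simp only: sum.cl_ivl_Suc) simp
  qed simp
  moreover have "ln (real N) \<le> ln (real (Suc N))" using assms by simp
  ultimately show ?thesis by linarith
qed

lemma L2_norm_TN: "Lp_norm 2 (TN s N) = sqrt (\<Sum>n=1..N. real n powr (- 4 * s))"
proof -
  have "Lp_norm 2 (TN s N) = (integral {0..1} (\<lambda>x. norm (TN s N x) powr 2)) powr (1/2)"
    by (rule Lp_norm_eq_integral) (auto intro: continuous_intros)
  also have "\<dots> = (\<Sum>n=1..N. real n powr (- 4 * s)) powr (1/2)"
    by (simp only: integral_norm_square_TN)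
  also have "\<dots> = sqrt (\<Sum>n=1..N. real n powr (- 4 * s))"
    by (rule powr_half_sqrt) (auto intro: sum_nonneg)
  finally show ?thesis .
qed

lemma L2_norm_TN_ge_power:
  assumes "N \<ge> 1"
  shows "sqrt (2 powr (- \<bar>4 * s\<bar>) / 2) * real N powr (1/2 - 2 * s) \<le> Lp_norm 2 (TN s N)"
proof -
  have "sqrt (2 powr (- \<bar>4 * s\<bar>) / 2) * real N powr (1/2 - 2 * s) = sqrt (2 powr (- \<bar>4 * s\<bar>) / 2 * real N powr (1 - 4 * s))"
  proof -
    have "sqrt (real N powr (1 - 4 * s)) = real N powr (1/2 - 2 * s)"
      by (simp add: powr_half_sqrt[symmetric] powr_powr algebra_simps)
    then show ?thesis by (simp only: real_sqrt_mult)
  qed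
  also have "\<dots> \<le> sqrt (\<Sum>n=1..N. real n powr (- (4 * s)))"
    by (intro real_sqrt_le_mono sum_powr_ge assms)
  finally show ?thesis by (simp add: L2_norm_TN)
qed

lemma L2_norm_TN_ge_ln:
  assumes "N \<ge> 1"
  shows "ln (real N) powr (1/2) \<le> Lp_norm 2 (TN (1/4) N)"
  using sum_inverse_ge_ln[OF assms] assms by (simp add: L2_norm_TN powr_half_sqrt)

lemma L2_norm_TN_ge_1:
  assumes "N \<ge> 1"
  shows "1 \<le> Lp_norm 2 (TN s N)"
proof -
  have "(\<Sum>n\<in>{1::nat}. real n powr (- 4 * s)) \<le> (\<Sum>n=1..N. real n powr (- 4 * s))"
    using assms by (intro sum_mono2) auto
  then show ?thesis by (simp add: L2_norm_TN)
qed

text \<open>Near 0 all terms are in phase: on an interval of length of order N^(-2) the sum has its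
  maximal order N^(1-2s), or at least that much when s is large.\<close>

lemma Lp_norm_TN_ge_peak:
  assumes p: "p > 0"
  shows "\<exists>c>0. \<forall>N\<ge>2. c * real N powr (1 - 2/p - 2 * s) \<le> Lp_norm p (TN s N)"
proof -
  define c where "c = 2 powr (- \<bar>2 * s\<bar>) / 4"
  have c: "c > 0" by (simp add: c_def)
  have "(1/8) powr (1/p) * c * real N powr (1 - 2/p - 2 * s) \<le> Lp_norm p (TN s N)" if N: "N \<ge> 2" for N
  proof (rule Lp_norm_geI)
    define A where "A = c * real N powr (1 - 2 * s)"
    \<comment> \<open>For n <= N and x <= d the angle 2 pi n^2 x is at most pi/4 < pi/3, so every
      cosine is at least 1/2.\<close>
    define d where "d = 1 / (8 * (real N)\<^sup>2)"
    have A: "A \<ge> 0" using c by (simp add: A_def)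
    have d: "0 < d" "d \<le> 1"
    proof -
      have "1 \<le> (real N)\<^sup>2" using N by (intro one_le_power) auto
      then have "1 \<le> 8 * (real N)\<^sup>2" by simp
      then show "0 < d" "d \<le> 1" using N by (auto simp: d_def divide_le_eq)
    qed
    have low: "A \<le> norm (TN s N x)" if x: "x \<in> {0..d}" for x
    proof -
      have cosb: "1/2 \<le> Re (ee ((real n)\<^sup>2 * x))" if n: "n \<in> {1..N}" for n
      proof -
        have "(real n)\<^sup>2 * x \<le> (real N)\<^sup>2 * d" using n x d by (intro mult_mono power_mono) auto
        also have "\<dots> = 1/8" using N by (simp add: d_def)
        finally have "2 * pi * ((real n)\<^sup>2 * x) \<le> 2 * pi * (1/8)" by (intro mult_left_mono) auto
        also have "\<dots> \<le> pi / 3" by simp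
        finally have "cos (pi / 3) \<le> cos (2 * pi * ((real n)\<^sup>2 * x))"
          using x by (intro cos_monotone_0_pi_le) auto
        then show ?thesis by (simp add: Re_ee cos_60)
      qed
      have "A = 1/2 * (2 powr (- \<bar>2 * s\<bar>) / 2 * real N powr (1 - 2 * s))" by (simp add: A_def c_def)
      also have "\<dots> \<le> 1/2 * (\<Sum>n=1..N. real n powr (- (2 * s)))"
        using N by (intro mult_left_mono sum_powr_ge) auto
      also have "\<dots> = (\<Sum>n=1..N. real n powr (- 2 * s) * (1/2))" by (simp add: sum_distrib_left mult.commute)
      also have "\<dots> \<le> (\<Sum>n=1..N. real n powr (- 2 * s) * Re (ee ((real n)\<^sup>2 * x)))"
        by (intro sum_mono mult_left_mono cosb) auto
      also have "\<dots> = Re (TN s N x)" by (simp add: TN_eq_ee)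
      also have "\<dots> \<le> norm (TN s N x)" by (rule complex_Re_le_cmod)
      finally show ?thesis .
    qed
    have "((1/8) powr (1/p) * c * real N powr (1 - 2/p - 2 * s)) powr p = d * A powr p"
    proof -
      have "((1/8) powr (1/p) * c * real N powr (1 - 2/p - 2 * s)) powr p = 1/8 * c powr p * real N powr ((1 - 2/p - 2 * s) * p)"
        using p by (simp only: powr_mult powr_powr) simp
      also have "(1 - 2/p - 2 * s) * p = (1 - 2 * s) * p - 2" using p by (simp add: field_simps)
      also have "real N powr ((1 - 2 * s) * p - 2) = real N powr ((1 - 2 * s) * p) / (real N)\<^sup>2"
        using N by (simp add: powr_diff)
      finally show ?thesis by (simp add: A_def d_def powr_mult powr_powr)
    qed
    also have "\<dots> = integral {0..d} (\<lambda>x. A powr p)" using d by simp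
    also have "\<dots> \<le> integral {0..d} (\<lambda>x. norm (TN s N x) powr p)"
      using A p low by (intro integral_le powr_mono2 integrable_continuous_real continuous_on_norm_powr continuous_intros) auto
    also have "\<dots> \<le> integral {0..1} (\<lambda>x. norm (TN s N x) powr p)"
      using d p by (intro integral_subset_le integrable_continuous_real continuous_on_norm_powr continuous_intros) auto
    finally show "((1/8) powr (1/p) * c * real N powr (1 - 2/p - 2 * s)) powr p \<le> integral {0..1} (\<lambda>x. norm (TN s N x) powr p)" .
  qed (use c p in \<open>auto intro!: continuous_intros\<close>)
  moreover have "(1/8) powr (1/p) * c > 0" using c by simp
  ultimately show ?thesis by blast
qed

subsection \<open>Testing against Fejer kernels\<close>

text \<open>The Fejer kernel, with Fourier coefficients 1 - |k|/M for |k| < M. Written as a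
  normalised square, it is visibly nonnegative and has nonnegative coefficients.\<close>

definition fejer :: "nat \<Rightarrow> real \<Rightarrow> real" where
  "fejer M x = (norm (\<Sum>k<M. ee (real k * x)))\<^sup>2 / real M"

lemma fejer_nonneg: "fejer M x \<ge> 0"
  by (simp add: fejer_def)

lemma continuous_on_fejer [continuous_intros]: "continuous_on A (fejer M)"
  unfolding fejer_def divide_inverse by (intro continuous_intros)

lemma fejer_le: "fejer M x \<le> real M"
proof -
  have "norm (\<Sum>k<M. ee (real k * x)) \<le> (\<Sum>k<M. 1)" by (rule sum_norm_le) simp
  then have "(norm (\<Sum>k<M. ee (real k * x)))\<^sup>2 \<le> (real M)\<^sup>2" by (intro power_mono) auto
  then show ?thesis by (cases "M = 0") (auto simp: fejer_def divide_le_eq power2_eq_square)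
qed

lemma fejer_le_decay:
  fixes j :: int
  assumes M: "M > 0" and y: "y = \<bar>x - of_int j\<bar>" "y > 0" "y \<le> 1/2"
  shows "fejer M x \<le> 1 / (real M * y\<^sup>2)"
proof -
  have "(\<Sum>k<M. ee (real k * x)) * (1 - ee x) = 1 - ee (real M * x)" for M
  proof (induction M)
    case (Suc M)
    have e: "ee (real (Suc M) * x) = ee (real M * x) * ee x"
      unfolding ee_add[symmetric] by (rule arg_cong[of _ _ ee]) (simp add: distrib_right)
    have "(\<Sum>k<Suc M. ee (real k * x)) * (1 - ee x) = (1 - ee (real M * x)) + ee (real M * x) * (1 - ee x)"
      by (simp only: sum.lessThan_Suc distrib_right Suc)
    then show ?case unfolding e by (simp add: right_diff_distrib)
  qed simp
  then have "norm (\<Sum>k<M. ee (real k * x)) * norm (1 - ee x) = norm (1 - ee (real M * x))"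
    by (simp only: norm_mult[symmetric])
  also have "\<dots> \<le> 2" using norm_triangle_ineq4[of 1 "ee (real M * x)"] by simp
  finally have 1: "norm (\<Sum>k<M. ee (real k * x)) * norm (1 - ee x) \<le> 2" .
  have "2 * y \<le> norm (1 - ee x)" unfolding y(1) by (rule norm_one_minus_ee_ge) (use y in simp)
  then have "norm (\<Sum>k<M. ee (real k * x)) * (2 * y) \<le> norm (\<Sum>k<M. ee (real k * x)) * norm (1 - ee x)"
    by (intro mult_left_mono) auto
  with 1 have "norm (\<Sum>k<M. ee (real k * x)) \<le> 1 / y" using y by (simp add: field_simps)
  then have "(norm (\<Sum>k<M. ee (real k * x)))\<^sup>2 \<le> (1 / y)\<^sup>2" by (intro power_mono) auto
  then have "fejer M x \<le> (1 / y)\<^sup>2 / real M" unfolding fejer_def by (intro divide_right_mono) auto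
  then show ?thesis by (simp add: power_divide mult.commute)
qed

lemma integral_TN_fejer_ge:
  assumes M: "M > 0" "4 * m\<^sup>2 \<le> M" and m: "m \<le> N"
  shows "3 / 4 * (\<Sum>n=1..m. real n powr (- 2 * s)) \<le> integral {0..1} (\<lambda>x. norm (TN s N x) * fejer M x)"
proof -
  let ?w = "\<lambda>n. real n powr (- 2 * s)"
  let ?I = "{1..N} \<times> ({..<M} \<times> {..<M})"
  let ?k = "\<lambda>(n, k, l). (int n)\<^sup>2 + int k - int l"
  let ?c = "\<lambda>(n, k, l). ?w n / real M"
  have eq: "TN s N x * of_real (fejer M x) = (\<Sum>i\<in>?I. of_real (?c i) * ee (of_int (?k i) * x))" for x
  proof -
    have "complex_of_real (fejer M x) = (\<Sum>k<M. ee (real k * x)) * cnj (\<Sum>k<M. ee (real k * x)) / of_real (real M)"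
      unfolding fejer_def of_real_divide by (simp only: complex_norm_square)
    also have "\<dots> = (\<Sum>k<M. \<Sum>l<M. ee (real k * x) * cnj (ee (real l * x))) / of_real (real M)"
      unfolding cnj_sum by (simp only: sum_product)
    finally have "TN s N x * of_real (fejer M x) = (\<Sum>n=1..N. of_real (?w n) * ee ((real n)\<^sup>2 * x)) * (\<Sum>k<M. \<Sum>l<M. ee (real k * x) * cnj (ee (real l * x)) / of_real (real M))"
      by (simp add: TN_eq_ee sum_divide_distrib)
    also have "\<dots> = (\<Sum>n=1..N. \<Sum>k<M. \<Sum>l<M. of_real (?w n) * ee ((real n)\<^sup>2 * x) * (ee (real k * x) * cnj (ee (real l * x)) / of_real (real M)))"
      by (simp only: sum_distrib_right) (simp only: sum_distrib_left)
    also have "\<dots> = (\<Sum>n=1..N. \<Sum>k<M. \<Sum>l<M. of_real (?w n / real M) * ee (of_int ((int n)\<^sup>2 + int k - int l) * x))"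
    proof (intro sum.cong refl)
      fix n k l
      have "ee (of_int ((int n)\<^sup>2 + int k - int l) * x) = ee ((real n)\<^sup>2 * x) * ee (real k * x) * cnj (ee (real l * x))"
        unfolding ee_add[symmetric] ee_diff[symmetric] by (simp add: algebra_simps)
      then show "of_real (?w n) * ee ((real n)\<^sup>2 * x) * (ee (real k * x) * cnj (ee (real l * x)) / of_real (real M))
        = of_real (?w n / real M) * ee (of_int ((int n)\<^sup>2 + int k - int l) * x)"
        by (simp only: of_real_divide) simp
    qed
    also have "\<dots> = (\<Sum>i\<in>?I. of_real (?c i) * ee (of_int (?k i) * x))"
      by (simp add: sum.cartesian_product case_prod_unfold)
    finally show ?thesis .
  qed
  have int: "((\<lambda>x. TN s N x * of_real (fejer M x)) has_integral (\<Sum>i\<in>?I. if ?k i = 0 then of_real (?c i) else 0)) {0..1}"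
    unfolding eq by (rule has_integral_trig_sum) auto
  \<comment> \<open>The solutions of n^2 + k - l = 0 are l = k + n^2 with k < M - n^2, so each n <=
    m occurs M - n^2 times.\<close>
  let ?A = "SIGMA n:{1..m}. {..<M - n\<^sup>2}"
  let ?f = "\<lambda>(n, k). (n, (k, k + n\<^sup>2))"
  have "3 / 4 * (\<Sum>n=1..m. ?w n) = (\<Sum>n=1..m. 3 / 4 * ?w n)" by (simp add: sum_distrib_left)
  also have "\<dots> \<le> (\<Sum>n=1..m. \<Sum>k\<in>{..<M - n\<^sup>2}. ?w n / real M)"
  proof (rule sum_mono)
    fix n assume n: "n \<in> {1..m}"
    then have "n\<^sup>2 \<le> m\<^sup>2" by (intro power_mono) auto
    then have n4: "4 * n\<^sup>2 \<le> M" using M by linarith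
    then have "4 * real (n\<^sup>2) \<le> real M" by (metis of_nat_le_iff of_nat_mult of_nat_numeral)
    moreover have "real (M - n\<^sup>2) = real M - real (n\<^sup>2)" using n4 by (intro of_nat_diff) linarith
    ultimately have "3 / 4 * real M \<le> real (M - n\<^sup>2)" by linarith
    then have "3 / 4 \<le> real (M - n\<^sup>2) / real M" using M(1) by (simp only: pos_le_divide_eq of_nat_0_less_iff)
    then have "3 / 4 * ?w n \<le> real (M - n\<^sup>2) / real M * ?w n" by (rule mult_right_mono) simp
    then show "3 / 4 * ?w n \<le> (\<Sum>k\<in>{..<M - n\<^sup>2}. ?w n / real M)"
      by (simp only: times_divide_eq_left times_divide_eq_right sum_constant card_lessThan)
  qed
  also have "\<dots> = (\<Sum>i\<in>?A. case i of (n, k) \<Rightarrow> ?w n / real M)"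
    by (rule sum.Sigma) auto
  also have "\<dots> = (\<Sum>i\<in>?f ` ?A. if ?k i = 0 then ?c i else 0)"
    by (subst sum.reindex) (auto simp: inj_on_def intro!: sum.cong)
  also have "\<dots> \<le> (\<Sum>i\<in>?I. if ?k i = 0 then ?c i else 0)"
    using m by (intro sum_mono2) auto
  also have "\<dots> = Re (\<Sum>i\<in>?I. if ?k i = 0 then of_real (?c i) else 0)"
    unfolding Re_sum by (intro sum.cong) auto
  also have "\<dots> = Re (integral {0..1} (\<lambda>x. TN s N x * of_real (fejer M x)))"
    using int by (simp only: integral_unique)
  also have "\<dots> \<le> norm (integral {0..1} (\<lambda>x. TN s N x * of_real (fejer M x)))" by (rule complex_Re_le_cmod)
  also have "\<dots> \<le> integral {0..1} (\<lambda>x. norm (TN s N x) * fejer M x)"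
    by (intro integral_norm_bound_integral integrable_continuous_real continuous_intros)
       (auto simp: norm_mult fejer_nonneg)
  finally show ?thesis .
qed

lemma sum_geometric_set_le:
  fixes r Z :: real
  assumes "finite A" "r > 1" "Z \<ge> 0" "\<And>j. j \<in> A \<Longrightarrow> r^j \<le> Z"
  shows "(\<Sum>j\<in>A. r^j) \<le> r / (r - 1) * Z"
proof (cases "A = {}")
  case False
  have "(\<Sum>j\<in>A. r^j) \<le> (\<Sum>j<Suc (Max A). r^j)"
    using assms by (intro sum_mono2) (auto simp: less_Suc_eq_le)
  also have "\<dots> = (r^Suc (Max A) - 1) / (r - 1)" using assms by (intro geometric_sum) auto
  also have "\<dots> \<le> r^Suc (Max A) / (r - 1)" using assms by (intro divide_right_mono) auto
  also have "\<dots> = r / (r - 1) * r^Max A" by simp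
  also have "\<dots> \<le> r / (r - 1) * Z" using assms False by (intro mult_left_mono) auto
  finally show ?thesis .
qed (use assms in auto)

lemma sum_geometric_set_le':
  fixes r Z :: real
  assumes "finite A" "0 < r" "r < 1" "Z \<ge> 0" "\<And>j. j \<in> A \<Longrightarrow> r^j \<le> Z"
  shows "(\<Sum>j\<in>A. r^j) \<le> 1 / (1 - r) * Z"
proof (cases "A = {}")
  case False
  have "(\<Sum>j\<in>A. r^j) \<le> (\<Sum>j\<in>{Min A..Max A}. r^j)"
    using assms by (intro sum_mono2) auto
  also have "\<dots> = (r^Min A - r^Suc (Max A)) / (1 - r)"
  proof -
    have "(Max A < Min A) = False" "(r = 1) = False" using assms False by (auto simp: not_less)
    then show ?thesis by (simp only: sum_gp if_False)
  qed
  also have "\<dots> \<le> r^Min A / (1 - r)" using assms by (intro divide_right_mono) auto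
  also have "\<dots> \<le> Z / (1 - r)" using assms False by (intro divide_right_mono) auto
  finally show ?thesis by simp
qed (use assms in auto)

text \<open>Split at 4^j = Z, with Z = 1 / max(4^(-J), y). Below, the kernel is at most 4^j and the
  terms grow with ratio 4^(1-1/p), which exceeds 1 as p > 1; above, the decay 1/(4^j y^2) makes them
  fall with ratio 4^(-1-1/p). Both geometric sums are of the order of the term at the
  crossover.\<close>

lemma sum_fejer_le:
  assumes p: "p > 1"
  defines "C \<equiv> 4 powr (1 - 1/p) / (4 powr (1 - 1/p) - 1) + 1 / (1 - 4 powr (- 1 - 1/p))"
  assumes y: "y = \<bar>x - of_int i\<bar>" "y \<le> 1/2"
  shows "(\<Sum>j=1..J. 4 powr (- real j / p) * fejer (4^j) x) \<le> C * (1 / max (1 / 4^J) y) powr (1 - 1/p)"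
proof -
  define m where "m = max (1 / 4^J) y"
  have m0: "m > 0" by (simp add: m_def less_max_iff_disj)
  define Z where "Z = 1 / m"
  have Z0: "Z > 0" using m0 by (simp add: Z_def)
  define r where "r = (4::real) powr (1 - 1/p)"
  define t where "t = (4::real) powr (- 1 - 1/p)"
  have r1: "r > 1" using p by (simp add: r_def)
  have "1/p > 0" using p by simp
  then have "- 1 - 1/p < 0" by linarith
  then have t: "0 < t" "t < 1" using powr_less_mono[of "- 1 - 1/p" 0 "4::real"] by (auto simp: t_def)
  have rj: "r^j = (4^j) powr (1 - 1/p)" and tj: "t^j = (4^j) powr (- 1 - 1/p)" for j
    by (simp_all add: r_def t_def powr_power powr_powr mult.commute flip: powr_realpow)
  let ?A = "{j\<in>{1..J}. 4^j \<le> Z}" and ?B = "{j\<in>{1..J}. \<not> 4^j \<le> Z}"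
  have fj: "4 powr (- real j / p) * 4^j = r^j" "4 powr (- real j / p) * (1 / 4^j) = t^j" for j
  proof -
    have "4 powr (- real j / p) * 4 powr (real j) = 4 powr (real j * (1 - 1/p))"
      by (simp add: algebra_simps flip: powr_add)
    then show "4 powr (- real j / p) * 4^j = r^j" by (simp add: r_def powr_power powr_realpow)
    have "4 powr (- real j / p) * 4 powr (- real j) = 4 powr (real j * (- 1 - 1/p))"
      by (simp add: algebra_simps flip: powr_add)
    then show "4 powr (- real j / p) * (1 / 4^j) = t^j" by (simp add: t_def powr_power powr_realpow powr_minus_divide)
  qed
  have "(\<Sum>j=1..J. 4 powr (- real j / p) * fejer (4^j) x)
      = (\<Sum>j\<in>?A. 4 powr (- real j / p) * fejer (4^j) x) + (\<Sum>j\<in>?B. 4 powr (- real j / p) * fejer (4^j) x)"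
    by (subst sum.union_disjoint[symmetric]) (auto intro!: sum.cong)
  also have "(\<Sum>j\<in>?A. 4 powr (- real j / p) * fejer (4^j) x) \<le> (\<Sum>j\<in>?A. r^j)"
  proof (rule sum_mono)
    fix j
    have "4 powr (- real j / p) * fejer (4^j) x \<le> 4 powr (- real j / p) * real (4^j)"
      by (intro mult_left_mono fejer_le) auto
    also have "\<dots> = r^j" using fj(1)[of j] by simp
    finally show "4 powr (- real j / p) * fejer (4^j) x \<le> r^j" .
  qed
  also have "(\<Sum>j\<in>?A. r^j) \<le> r / (r - 1) * Z powr (1 - 1/p)"
  proof (rule sum_geometric_set_le)
    fix j assume "j \<in> ?A"
    then show "r^j \<le> Z powr (1 - 1/p)" unfolding rj using p by (intro powr_mono2) auto
  qed (use r1 in auto)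
  also have "(\<Sum>j\<in>?B. 4 powr (- real j / p) * fejer (4^j) x) \<le> (\<Sum>j\<in>?B. Z\<^sup>2 * t^j)"
  proof (rule sum_mono)
    fix j assume j: "j \<in> ?B"
    have "(4::real)^j \<le> 4^J" using j by (intro power_increasing) auto
    moreover have "Z < 4^j" using j by (simp add: not_le)
    ultimately have ZJ: "Z < 4^J" by linarith
    \<comment> \<open>The second range is nonempty only if Z < 4^J, so the maximum is attained by y;
      in particular y > 0, as the decay estimate needs.\<close>
    have my: "m = y"
    proof (rule ccontr)
      assume "m \<noteq> y"
      then have "m = 1 / 4^J" by (auto simp: m_def max_def split: if_splits)
      then show False using ZJ by (simp add: Z_def)
    qed
    have "4 powr (- real j / p) * fejer (4^j) x \<le> 4 powr (- real j / p) * (1 / (real (4^j) * y\<^sup>2))"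
      using m0 my y by (intro mult_left_mono fejer_le_decay[of _ y x i]) auto
    also have "\<dots> = Z\<^sup>2 * (4 powr (- real j / p) * (1 / 4^j))"
      by (simp add: Z_def my power_divide)
    also have "\<dots> = Z\<^sup>2 * t^j" by (simp only: fj)
    finally show "4 powr (- real j / p) * fejer (4^j) x \<le> Z\<^sup>2 * t^j" .
  qed
  also have "(\<Sum>j\<in>?B. Z\<^sup>2 * t^j) \<le> Z\<^sup>2 * (1 / (1 - t) * Z powr (- 1 - 1/p))"
    unfolding sum_distrib_left[symmetric]
  proof (intro mult_left_mono sum_geometric_set_le')
    fix j assume "j \<in> ?B"
    then show "t^j \<le> Z powr (- 1 - 1/p)" unfolding tj using p Z0 by (intro powr_mono2') (auto simp: field_simps)
  qed (use t in auto)
  also have "Z\<^sup>2 * (1 / (1 - t) * Z powr (- 1 - 1/p)) = 1 / (1 - t) * Z powr (1 - 1/p)"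
  proof -
    have "Z\<^sup>2 * Z powr (- 1 - 1/p) = Z powr 2 * Z powr (- 1 - 1/p)" using Z0 by simp
    also have "\<dots> = Z powr (1 - 1/p)" unfolding powr_add[symmetric] by simp
    finally show ?thesis by simp
  qed
  finally show ?thesis by (simp add: C_def r_def t_def Z_def m_def distrib_right)
qed

text \<open>Young's inequality without its constants: compare b with a^(p-1) and bound the product
  by the dominant term.\<close>

lemma young_conjugate:
  fixes a b p :: real
  assumes "p > 1" "a \<ge> 0" "b \<ge> 0"
  shows "a * b \<le> a powr p + b powr (p / (p - 1))"
proof (cases "b \<le> a powr (p - 1)")
  case True
  have "a * b \<le> a * a powr (p - 1)" using True assms by (intro mult_left_mono) auto
  also have "\<dots> = a powr p" using assms by (cases "a = 0") (auto simp: powr_diff)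
  finally show ?thesis by (smt (verit) powr_ge_zero)
next
  case False
  then have b: "b > 0" by (smt (verit) powr_ge_zero)
  have "a = (a powr (p - 1)) powr (1 / (p - 1))" using assms by (simp add: powr_powr)
  also have "\<dots> \<le> b powr (1 / (p - 1))" using False assms by (intro powr_mono2) auto
  finally have "a * b \<le> b powr (1 / (p - 1)) * b" using b by (intro mult_right_mono) auto
  also have "\<dots> = b powr (1 / (p - 1) + 1)" using b by (simp add: powr_add)
  also have "1 / (p - 1) + 1 = p / (p - 1)" using assms by (simp add: field_simps)
  finally show ?thesis by (smt (verit) powr_ge_zero)
qed

text \<open>The conjugate exponent turns the pointwise power 1 - 1/p into exactly 1, so the
  integrand is O(1 / max(4^(-J), dist(x, Z))) and its integral is logarithmic, that is O(J).\<close>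

lemma integral_sum_fejer_powr_le:
  assumes p: "p > 1"
  shows "\<exists>C>0. \<forall>J\<ge>1. integral {0..1} (\<lambda>x. (\<Sum>j=1..J. 4 powr (- real j / p) * fejer (4^j) x) powr (p / (p - 1))) \<le> C * real J"
proof -
  define C where "C = 4 powr (1 - 1/p) / (4 powr (1 - 1/p) - 1) + 1 / (1 - 4 powr (- 1 - 1/p))"
  have C: "C > 0"
  proof -
    have "4 powr (1 - 1/p) > (1::real)" using p by simp
    moreover have "1/p > 0" using p by simp
    then have "- 1 - 1/p < 0" by linarith
    then have "4 powr (- 1 - 1/p) < (1::real)" using powr_less_mono[of "- 1 - 1/p" 0 "4::real"] by simp
    ultimately show ?thesis unfolding C_def by (intro add_pos_pos divide_pos_pos) auto
  qed
  let ?q = "p / (p - 1)"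
  have q: "?q > 0" using p by simp
  have qe: "(1 - 1/p) * ?q = 1" using p by (simp add: field_simps)
  have "integral {0..1} (\<lambda>x. (\<Sum>j=1..J. 4 powr (- real j / p) * fejer (4^j) x) powr ?q) \<le> (C powr ?q * 16) * real J" if J: "J \<ge> 1" for J
  proof -
    define e where "e = 1 / (4::real)^J"
    have e: "e > 0" by (simp add: e_def)
    let ?G = "\<lambda>x. \<Sum>j=1..J. 4 powr (- real j / p) * fejer (4^j) x"
    have G0: "?G x \<ge> 0" for x by (intro sum_nonneg mult_nonneg_nonneg fejer_nonneg) auto
    \<comment> \<open>On [0,1] the nearest integer is 0 or 1; adding a term for each endpoint avoids
      splitting the integral.\<close>
    have pt: "?G x powr ?q \<le> C powr ?q * (2 / (e + x) + 2 / (e + (1 - x)))" if x: "x \<in> {0..1}" for x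
    proof -
      obtain i :: int and y where y: "y = \<bar>x - of_int i\<bar>" "y \<le> 1/2" "y = x \<or> y = 1 - x"
      proof (cases "x \<le> 1/2")
        case True
        then show ?thesis using x that[of x 0] by simp
      next
        case False
        then show ?thesis using x that[of "1 - x" 1] by simp
      qed
      have y0: "y \<ge> 0" using y by simp
      have "?G x powr ?q \<le> (C * (1 / max e y) powr (1 - 1/p)) powr ?q"
        unfolding C_def e_def using q G0 by (intro powr_mono2 sum_fejer_le[OF p y(1,2)]) auto
      also have "\<dots> = C powr ?q * (1 / max e y)"
      proof -
        have "1 / max e y \<ge> 0" using e by (simp add: le_max_iff_disj)
        then show ?thesis by (simp only: powr_mult powr_powr qe powr_one)
      qed
      also have "\<dots> \<le> C powr ?q * (2 / (e + y))"
      proof (intro mult_left_mono)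
        have "e + y \<le> 2 * max e y" by simp
        then show "1 / max e y \<le> 2 / (e + y)" using e y0 by (simp add: divide_simps split: if_splits)
      qed auto
      also have "\<dots> \<le> C powr ?q * (2 / (e + x) + 2 / (e + (1 - x)))"
        using y(3) e x by (intro mult_left_mono) auto
      finally show ?thesis .
    qed
    have ln_int: "((\<lambda>x. 2 / (e + x)) has_integral (2 * ln (e + 1) - 2 * ln (e + 0))) {0..1}"
    proof (rule fundamental_theorem_of_calculus)
      fix x :: real assume "x \<in> {0..1}"
      then have "((\<lambda>x. 2 * ln (e + x)) has_real_derivative 2 / (e + x)) (at x within {0..1})"
        using e by (auto intro!: derivative_eq_intros)
      then show "((\<lambda>x. 2 * ln (e + x)) has_vector_derivative 2 / (e + x)) (at x within {0..1})"
        by (simp only: has_real_derivative_iff_has_vector_derivative)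
    qed simp
    have ln_int': "((\<lambda>x. 2 / (e + (1 - x))) has_integral (- 2 * ln (e + (1 - 1)) - - 2 * ln (e + (1 - 0)))) {0..1}"
    proof (rule fundamental_theorem_of_calculus)
      fix x :: real assume "x \<in> {0..1}"
      then have "((\<lambda>x. - 2 * ln (e + (1 - x))) has_real_derivative 2 / (e + (1 - x))) (at x within {0..1})"
        using e by (auto intro!: derivative_eq_intros)
      then show "((\<lambda>x. - 2 * ln (e + (1 - x))) has_vector_derivative 2 / (e + (1 - x))) (at x within {0..1})"
        by (simp only: has_real_derivative_iff_has_vector_derivative)
    qed simp
    have tot: "((\<lambda>x. C powr ?q * (2 / (e + x) + 2 / (e + (1 - x)))) has_integral
        C powr ?q * ((2 * ln (e + 1) - 2 * ln (e + 0)) + (- 2 * ln (e + (1 - 1)) - - 2 * ln (e + (1 - 0))))) {0..1}"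
      by (intro has_integral_mult_right has_integral_add ln_int ln_int')
    have "integral {0..1} (\<lambda>x. ?G x powr ?q) \<le> C powr ?q * ((2 * ln (e + 1) - 2 * ln (e + 0)) + (- 2 * ln (e + (1 - 1)) - - 2 * ln (e + (1 - 0))))"
    proof (rule has_integral_le[OF integrable_integral tot pt])
      show "(\<lambda>x. ?G x powr ?q) integrable_on {0..1}"
        using q G0 by (intro integrable_continuous_real continuous_on_powr' continuous_intros) auto
    qed
    also have "\<dots> = C powr ?q * (4 * (ln (e + 1) - ln e))" by simp
    also have "\<dots> \<le> C powr ?q * (4 * (4 * real J))"
    proof (intro mult_left_mono)
      have "ln (e + 1) \<le> e" using ln_add_one_self_le_self[of e] e by (simp add: add.commute)
      moreover have "e \<le> 1" by (simp add: e_def)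
      moreover have "ln e = - (real J * ln 4)" by (simp add: e_def ln_div ln_realpow)
      moreover have "ln (4::real) \<le> 3" using ln_le_minus_one[of "4::real"] by simp
      then have "real J * ln 4 \<le> real J * 3" by (intro mult_left_mono) auto
      ultimately show "ln (e + 1) - ln e \<le> 4 * real J" using J by linarith
    qed auto
    finally show ?thesis by simp
  qed
  moreover have "C powr ?q * 16 > 0" using C by simp
  ultimately show ?thesis by blast
qed

text \<open>Duality with G = sum of 4^(-j/p) times the Fejer kernel of order 4^j. Since 1 - 2 s =
  2/p, the weights make every scale contribute at least a constant \<open>b\<close> to the pairing,
  J b in total, while the conjugate moment of G is only O(J). Young's inequality then forces the
  p-th moment of \<open>TN\<close> to be at least of order J.\<close>

lemma Lp_norm_TN_ge_critical:
  assumes s: "s < 1/2" and p: "p = 2 / (1 - 2 * s)" "p > 1"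
  shows "\<exists>c>0. \<forall>N\<ge>2. c * ln (real N) powr (1/p) \<le> Lp_norm p (TN s N)"
proof -
  have p0: "p > 0" using p(2) by simp
  have ps: "1 - 2 * s = 2 / p" unfolding p(1) using s by simp
  obtain C where C: "C > 0" and GC: "\<And>J. J \<ge> 1 \<Longrightarrow>
     integral {0..1} (\<lambda>x. (\<Sum>j=1..J. 4 powr (- real j / p) * fejer (4^j) x) powr (p / (p - 1))) \<le> C * real J"
    using integral_sum_fejer_powr_le[OF p(2)] by blast
  let ?q = "p / (p - 1)"
  have q: "?q > 0" using p(2) by simp
  define b where "b = 3 / 4 * (2 powr (- \<bar>2 * s\<bar>) / 2) * 4 powr (- 1/p)"
  have b: "b > 0" by (simp add: b_def)
  \<comment> \<open>Scaling for Young's inequality: the term coming from G then equals half of the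
    lower bound b J and can be absorbed.\<close>
  define l where "l = (2 * C / b) powr (1 / ?q)"
  have l: "l > 0" using C b by (simp add: l_def)
  have lq: "l powr (- ?q) * C = b / 2"
  proof -
    have "l powr (- ?q) = (2 * C / b) powr (- 1)" unfolding l_def powr_powr using p(2) by simp
    then show ?thesis using C b by (simp add: powr_minus)
  qed
  have "(b / 4 * l powr (- p)) powr (1/p) * ln (real N) powr (1/p) \<le> Lp_norm p (TN s N)" if N: "N \<ge> 2" for N
  proof -
    obtain J where J: "J \<ge> 1" "2^J \<le> N" "ln (real N) \<le> 2 * real J"
      using dyadic_scale[OF N] by blast
    let ?G = "\<lambda>x. \<Sum>j=1..J. 4 powr (- real j / p) * fejer (4^j) x"
    have G0: "?G x \<ge> 0" for x by (intro sum_nonneg mult_nonneg_nonneg fejer_nonneg) auto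
    let ?T = "TN s N"
    have cG0: "continuous_on {0..1} ?G" by (intro continuous_intros)
    have cGq: "continuous_on {0..1} (\<lambda>x. ?G x powr ?q)"
      by (rule continuous_on_powr'[OF cG0 continuous_on_const]) (use q G0 in auto)
    have cTp: "continuous_on {0..1} (\<lambda>x. norm (?T x) powr p)"
      by (intro continuous_on_norm_powr continuous_on_TN p0)
    have each: "b \<le> 4 powr (- real j / p) * integral {0..1} (\<lambda>x. norm (?T x) * fejer (4^j) x)" if j: "j \<in> {1..J}" for j
    proof -
      have jj: "j = Suc (j - 1)" using j by simp
      \<comment> \<open>At order 4^j the kernel retains the frequencies n^2 with n <= 2^(j-1); this
        is the exact borderline of the hypothesis 4 m^2 <= M.\<close>
      have m: "4 * (2^(j - 1))\<^sup>2 = (4::nat)^j"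
      proof -
        have "((2::nat)^(j - 1))\<^sup>2 = 4^(j - 1)" by (simp add: power2_eq_square flip: power_mult_distrib)
        then show ?thesis using jj by (metis power_Suc)
      qed
      have "(2::nat)^(j - 1) \<le> 2^J" using j by (intro power_increasing) auto
      then have mN: "2^(j - 1) \<le> N" using J by linarith
      have "2 powr (- \<bar>2 * s\<bar>) / 2 * real (2^(j - 1)) powr (1 - 2 * s) \<le> (\<Sum>n=1..2^(j - 1). real n powr (- (2 * s)))"
        by (rule sum_powr_ge) simp
      also have "real (2^(j - 1)) powr (1 - 2 * s) = 4 powr (- 1/p) * 4 powr (real j / p)"
      proof -
        have "real (2^(j - 1)) powr (1 - 2 * s) = 2 powr (real (j - 1) * (2 / p))"
          unfolding ps by (simp add: powr_powr flip: powr_realpow)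
        also have "\<dots> = (2 powr 2) powr (real (j - 1) / p)" unfolding powr_powr by (simp add: mult.commute)
        also have "\<dots> = 4 powr (- 1/p + real j / p)"
        proof -
          have "real (j - 1) / p = - 1/p + real j / p" using j by (simp add: of_nat_diff diff_divide_distrib)
          then show ?thesis by simp
        qed
        finally show ?thesis by (simp only: powr_add)
      qed
      finally have "3 / 4 * (2 powr (- \<bar>2 * s\<bar>) / 2 * (4 powr (- 1/p) * 4 powr (real j / p))) \<le> 3 / 4 * (\<Sum>n=1..2^(j - 1). real n powr (- (2 * s)))"
        by (intro mult_left_mono) auto
      also have "\<dots> \<le> integral {0..1} (\<lambda>x. norm (?T x) * fejer (4^j) x)"
        using integral_TN_fejer_ge[of "4^j" "2^(j - 1)" N s] m mN by simp
      finally have "4 powr (- real j / p) * (3 / 4 * (2 powr (- \<bar>2 * s\<bar>) / 2 * (4 powr (- 1/p) * 4 powr (real j / p))))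
         \<le> 4 powr (- real j / p) * integral {0..1} (\<lambda>x. norm (?T x) * fejer (4^j) x)"
        by (intro mult_left_mono) auto
      moreover have "4 powr (- real j / p) * (3 / 4 * (2 powr (- \<bar>2 * s\<bar>) / 2 * (4 powr (- 1/p) * 4 powr (real j / p)))) = b"
      proof -
        have "4 powr (- real j / p) * 4 powr (real j / p) = (1::real)" by (simp flip: powr_add)
        then show ?thesis by (simp add: b_def mult_ac)
      qed
      ultimately show ?thesis by (simp only:)
    qed
    have "b * real J = (\<Sum>j=1..J. b)" by simp
    also have "\<dots> \<le> (\<Sum>j=1..J. 4 powr (- real j / p) * integral {0..1} (\<lambda>x. norm (?T x) * fejer (4^j) x))"
      by (intro sum_mono each)
    also have "\<dots> = (\<Sum>j=1..J. integral {0..1} (\<lambda>x. 4 powr (- real j / p) * (norm (?T x) * fejer (4^j) x)))"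
      by (simp only: integral_mult_right)
    also have "\<dots> = integral {0..1} (\<lambda>x. \<Sum>j=1..J. 4 powr (- real j / p) * (norm (?T x) * fejer (4^j) x))"
      by (intro integral_sum[symmetric] integrable_continuous_real continuous_intros) auto
    also have "\<dots> = integral {0..1} (\<lambda>x. norm (?T x) * ?G x)"
      by (simp add: sum_distrib_left mult_ac)
    also have "\<dots> \<le> integral {0..1} (\<lambda>x. l powr p * norm (?T x) powr p + l powr (- ?q) * ?G x powr ?q)"
    proof (rule integral_le)
      fix x
      have "norm (?T x) * ?G x = (l * norm (?T x)) * (?G x / l)" using l by simp
      also have "\<dots> \<le> (l * norm (?T x)) powr p + (?G x / l) powr ?q"
        using p(2) l G0 by (intro young_conjugate) auto
      also have "\<dots> = l powr p * norm (?T x) powr p + l powr (- ?q) * ?G x powr ?q"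
        by (simp only: powr_mult powr_divide powr_minus_divide) simp
      finally show "norm (?T x) * ?G x \<le> l powr p * norm (?T x) powr p + l powr (- ?q) * ?G x powr ?q" .
    qed (intro integrable_continuous_real continuous_on_add continuous_on_mult continuous_on_norm
        continuous_on_TN continuous_on_const cG0 cGq cTp)+
    also have "\<dots> = l powr p * integral {0..1} (\<lambda>x. norm (?T x) powr p) + l powr (- ?q) * integral {0..1} (\<lambda>x. ?G x powr ?q)"
    proof -
      have i: "(\<lambda>x. norm (?T x) powr p) integrable_on {0..1}" "(\<lambda>x. ?G x powr ?q) integrable_on {0..1}"
        by (intro integrable_continuous_real cGq cTp)+
      show ?thesis by (simp only: integral_add integral_mult_right i integrable_on_mult_right)
    qed
    also have "\<dots> \<le> l powr p * integral {0..1} (\<lambda>x. norm (?T x) powr p) + l powr (- ?q) * (C * real J)"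
      using J by (intro add_left_mono mult_left_mono GC) auto
    also have "l powr (- ?q) * (C * real J) = b / 2 * real J"
      using lq by (simp only: mult.assoc[symmetric])
    finally have "b / 2 * real J \<le> l powr p * integral {0..1} (\<lambda>x. norm (?T x) powr p)" by simp
    then have "l powr (- p) * (b / 2 * real J) \<le> l powr (- p) * (l powr p * integral {0..1} (\<lambda>x. norm (?T x) powr p))"
      by (intro mult_left_mono) auto
    also have "\<dots> = integral {0..1} (\<lambda>x. norm (?T x) powr p)"
      using l by (simp add: powr_minus)
    finally have low: "b / 2 * l powr (- p) * real J \<le> integral {0..1} (\<lambda>x. norm (?T x) powr p)" by (simp add: mult_ac)
    show ?thesis
    proof (rule Lp_norm_geI)
      have lnN: "ln (real N) \<ge> 0" using N by simp
      have "((b / 4 * l powr (- p)) powr (1/p) * ln (real N) powr (1/p)) powr p = (b / 4 * l powr (- p)) * ln (real N)"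
        using p0 b l lnN by (simp add: powr_mult powr_powr)
      also have "\<dots> \<le> (b / 4 * l powr (- p)) * (2 * real J)"
        using b J by (intro mult_left_mono) auto
      also have "\<dots> = b / 2 * l powr (- p) * real J" by simp
      finally show "((b / 4 * l powr (- p)) powr (1/p) * ln (real N) powr (1/p)) powr p \<le> integral {0..1} (\<lambda>x. norm (?T x) powr p)"
        using low by linarith
    qed (use p0 in \<open>auto intro!: continuous_intros\<close>)
  qed
  moreover have "(b / 4 * l powr (- p)) powr (1/p) > 0" using b l by simp
  ultimately show ?thesis by blast
qed

subsection \<open>The fourth moment\<close>

text \<open>Parseval for the square of \<open>TN\<close>: the fourth moment is a weighted count of
  the quadruples with equal sums of two squares. All weights are nonnegative, so any subfamily gives
  a lower bound.\<close>

lemma integral_fourth_power_TN_ge: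
  fixes S :: "((nat \<times> nat) \<times> (nat \<times> nat)) set"
  assumes S: "\<And>a b c d. ((a, b), (c, d)) \<in> S \<Longrightarrow> {a, b, c, d} \<subseteq> {1..N} \<and> a\<^sup>2 + b\<^sup>2 = c\<^sup>2 + d\<^sup>2"
    and W: "W \<ge> 0" "\<And>a b c d n. ((a, b), (c, d)) \<in> S \<Longrightarrow> n \<in> {a, b, c, d} \<Longrightarrow> W \<le> real n powr (- 2 * s)"
  shows "real (card S) * W^4 \<le> integral {0..1} (\<lambda>x. norm (TN s N x) powr 4)"
proof -
  let ?w = "\<lambda>n. real n powr (- 2 * s)"
  let ?A = "{1..N} \<times> {1..N}"
  let ?W = "\<lambda>(a, b). ?w a * ?w b"
  let ?k = "\<lambda>(a, b). (int a)\<^sup>2 + (int b)\<^sup>2"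
  have sq: "TN s N x * TN s N x = (\<Sum>i\<in>?A. of_real (?W i) * ee (of_int (?k i) * x))" for x
  proof -
    have "TN s N x * TN s N x = (\<Sum>a=1..N. \<Sum>b=1..N. (of_real (?w a) * ee ((real a)\<^sup>2 * x)) * (of_real (?w b) * ee ((real b)\<^sup>2 * x)))"
      unfolding TN_eq_ee by (rule sum_product)
    also have "\<dots> = (\<Sum>a=1..N. \<Sum>b=1..N. of_real (?w a * ?w b) * ee (of_int ((int a)\<^sup>2 + (int b)\<^sup>2) * x))"
      by (intro sum.cong refl) (simp add: distrib_right ee_add)
    finally show ?thesis by (simp add: sum.cartesian_product case_prod_unfold)
  qed
  have pw: "norm (TN s N x) powr 4 = (norm (TN s N x * TN s N x))\<^sup>2" for x
    by (simp add: norm_mult power2_eq_square eval_nat_numeral)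
  have int: "((\<lambda>x. norm (TN s N x) powr 4) has_integral
     (\<Sum>(i, j)\<in>?A \<times> ?A. if ?k i = ?k j then ?W i * ?W j else 0)) {0..1}"
    unfolding pw sq by (rule has_integral_norm_square_trig_sum) simp
  have "real (card S) * W^4 = (\<Sum>z\<in>S. W^4)" by simp
  also have "\<dots> \<le> (\<Sum>(i, j)\<in>S. if ?k i = ?k j then ?W i * ?W j else 0)"
  proof (rule sum_mono)
    fix z assume z: "z \<in> S"
    obtain a b c d where zz: "z = ((a, b), (c, d))" by (metis prod.collapse)
    have "a\<^sup>2 + b\<^sup>2 = c\<^sup>2 + d\<^sup>2" using S z zz by blast
    then have k: "(int a)\<^sup>2 + (int b)\<^sup>2 = (int c)\<^sup>2 + (int d)\<^sup>2"
      by (metis of_nat_add of_nat_power)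
    have w: "W \<le> ?w a" "W \<le> ?w b" "W \<le> ?w c" "W \<le> ?w d" using W(2) z zz by blast+
    have "W^4 = (W * W) * (W * W)" by (simp add: eval_nat_numeral)
    also have "\<dots> \<le> (?w a * ?w b) * (?w c * ?w d)" using W(1) w by (intro mult_mono) auto
    finally show "W^4 \<le> (case z of (i, j) \<Rightarrow> if ?k i = ?k j then ?W i * ?W j else 0)"
      using k by (simp add: zz)
  qed
  also have "\<dots> \<le> (\<Sum>(i, j)\<in>?A \<times> ?A. if ?k i = ?k j then ?W i * ?W j else 0)"
  proof (rule sum_mono2)
    show "S \<subseteq> ?A \<times> ?A"
    proof
      fix z assume z: "z \<in> S"
      obtain a b c d where zz: "z = ((a, b), (c, d))" by (metis prod.collapse)
      have "{a, b, c, d} \<subseteq> {1..N}" using S z zz by blast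
      then show "z \<in> ?A \<times> ?A" by (simp add: zz)
    qed
  qed auto
  finally show ?thesis using int by (simp only: integral_unique)
qed

section \<open>Counting solutions of a^2 + b^2 = c^2 + d^2\<close>

lemma totatives_upper_half:
  assumes "m \<ge> 1"
  shows "totient m \<le> 2 * card {a \<in> totatives m. m \<le> 2 * a}"
proof -
  let ?A = "{a \<in> totatives m. m \<le> 2 * a}" and ?B = "{a \<in> totatives m. \<not> m \<le> 2 * a}"
  have fin: "finite ?A" "finite ?B" by auto
  \<comment> \<open>The reflection a -> m - a preserves coprimality to m and sends the lower half
    into the upper half.\<close>
  have "card ?B \<le> card ?A"
  proof (rule card_inj_on_le[of "\<lambda>a. m - a"])
    show "inj_on (\<lambda>a. m - a) ?B" by (auto simp: inj_on_def)
    show "(\<lambda>a. m - a) ` ?B \<subseteq> ?A"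
    proof (rule image_subsetI)
      fix a assume a: "a \<in> ?B"
      then have "coprime a m" "0 < a" "2 * a < m" by (auto simp: in_totatives_iff)
      moreover have "coprime (m - a) m"
      proof (rule coprimeI)
        fix d assume d: "d dvd m - a" "d dvd m"
        have "d dvd m - (m - a)" using d(2,1) by (rule dvd_diff_nat)
        moreover have "m - (m - a) = a" using \<open>2 * a < m\<close> by simp
        ultimately have "d dvd a" by simp
        then show "is_unit d" using d(2) by (rule coprime_common_divisor[OF \<open>coprime a m\<close>])
      qed
      ultimately show "m - a \<in> ?A" by (auto simp: in_totatives_iff)
    qed
  qed (rule fin)
  moreover have "totient m = card ?A + card ?B"
    unfolding totient_def by (subst card_Un_disjoint[symmetric]) (auto intro!: arg_cong[of _ _ card])
  ultimately show ?thesis by linarith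
qed

text \<open>Write 1/n = n/n^2 with n the sum of totient d over d dividing n, and exchange the sums.
  The multiples n = d k contribute at most totient d / d^2 times the sum of 1/k^2, which is at most
  2.\<close>

lemma sum_totient_over_square_ge:
  assumes "X \<ge> 1"
  shows "ln (real X) \<le> 2 * (\<Sum>d=1..X. real (totient d) / (real d)\<^sup>2)"
proof -
  have "ln (real X) \<le> (\<Sum>n=1..X. real n powr (- 1))" by (rule sum_inverse_ge_ln[OF assms])
  also have "\<dots> = (\<Sum>n=1..X. \<Sum>d=1..X. if d dvd n then real (totient d) / (real n)\<^sup>2 else 0)"
  proof (rule sum.cong[OF refl])
    fix n assume n: "n \<in> {1..X}"
    have div: "{d. d dvd n} = {d\<in>{1..X}. d dvd n}"
      using n by (auto dest: dvd_imp_le intro: Nat.gr0I)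
    have "real n = (\<Sum>d | d dvd n. real (totient d))"
      using totient_divisor_sum[of n] by (metis of_nat_sum)
    also have "\<dots> = (\<Sum>d=1..X. if d dvd n then real (totient d) else 0)"
      unfolding div by (rule sum.inter_filter) simp
    finally have "real n / (real n)\<^sup>2 = (\<Sum>d=1..X. if d dvd n then real (totient d) else 0) / (real n)\<^sup>2" by simp
    also have "\<dots> = (\<Sum>d=1..X. if d dvd n then real (totient d) / (real n)\<^sup>2 else 0)"
      unfolding sum_divide_distrib by (intro sum.cong) auto
    also have "real n / (real n)\<^sup>2 = real n powr (- 1)" using n by (simp add: powr_minus_divide power2_eq_square)
    finally show "real n powr (- 1) = (\<Sum>d=1..X. if d dvd n then real (totient d) / (real n)\<^sup>2 else 0)" .
  qed
  also have "\<dots> = (\<Sum>d=1..X. \<Sum>n=1..X. if d dvd n then real (totient d) / (real n)\<^sup>2 else 0)"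
    by (rule sum.swap)
  also have "\<dots> \<le> (\<Sum>d=1..X. 2 * (real (totient d) / (real d)\<^sup>2))"
  proof (rule sum_mono)
    fix d assume d: "d \<in> {1..X}"
    have "(\<Sum>n=1..X. if d dvd n then real (totient d) / (real n)\<^sup>2 else 0) = (\<Sum>n\<in>{n\<in>{1..X}. d dvd n}. real (totient d) / (real n)\<^sup>2)"
      by (rule sum.inter_filter[symmetric]) simp
    also have "\<dots> \<le> (\<Sum>n\<in>(\<lambda>k. d * k) ` {1..X}. real (totient d) / (real n)\<^sup>2)"
    proof (rule sum_mono2)
      show "{n\<in>{1..X}. d dvd n} \<subseteq> (\<lambda>k. d * k) ` {1..X}"
      proof
        fix n assume n: "n \<in> {n\<in>{1..X}. d dvd n}"
        then obtain k where k: "n = d * k" by (auto elim: dvdE)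
        have "k \<ge> 1" using n k by (cases k) auto
        moreover have "k \<le> n" using d k by (cases d) auto
        then have "k \<le> X" using n by simp
        ultimately show "n \<in> (\<lambda>k. d * k) ` {1..X}" using n k by (intro image_eqI[of _ _ k]) auto
      qed
    qed auto
    also have "\<dots> = (\<Sum>k=1..X. real (totient d) / (real d)\<^sup>2 * (1 / (real k)\<^sup>2))"
      by (subst sum.reindex) (use d in \<open>auto simp: inj_on_def power_mult_distrib\<close>)
    also have "\<dots> \<le> real (totient d) / (real d)\<^sup>2 * 2"
      unfolding sum_distrib_left[symmetric] by (intro mult_left_mono sum_inverse_squares_le_2) auto
    finally show "(\<Sum>n=1..X. if d dvd n then real (totient d) / (real n)\<^sup>2 else 0) \<le> 2 * (real (totient d) / (real d)\<^sup>2)" by (simp add: mult.commute)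
  qed
  finally show ?thesis by (simp add: sum_distrib_left)
qed

text \<open>The product identity \<open>(a\<^sup>2 + m\<^sup>2) (k\<^sup>2 + l\<^sup>2)\<close> written as a sum of two squares in two ways; coprimality
  of \<open>a\<close> and \<open>m\<close> makes the parametrisation injective.\<close>

definition quad_param :: "nat \<times> nat \<times> nat \<times> nat \<Rightarrow> (nat \<times> nat) \<times> (nat \<times> nat)" where
  "quad_param = (\<lambda>(m, a, l, k). ((a * k + m * l, a * l - m * k), (m * l - a * k, m * k + a * l)))"

text \<open>With u = N div (2 m), the ranges u/2 < l <= u and k <= u/8 put m l between N/4 and N/2
  and keep 4 k <= l. Together with m/2 <= a <= m this makes both subtractions genuine on naturals
  and all four numbers comparable to N.\<close>

definition quad_params :: "nat \<Rightarrow> (nat \<times> nat \<times> nat \<times> nat) set" where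
  "quad_params N = (SIGMA m:{1..N div 16}. {a \<in> totatives m. m \<le> 2 * a} \<times>
     ({N div (2 * m) div 2 + 1..N div (2 * m)} \<times> {1..N div (2 * m) div 8}))"

lemma quad_paramsD:
  assumes "(m, a, l, k) \<in> quad_params N"
  shows "m \<ge> 1" "1 \<le> a" "a \<le> m" "m \<le> 2 * a" "coprime a m" "l \<ge> 1" "k \<ge> 1" "4 * k \<le> l" "2 * (m * l) \<le> N" "N < 4 * (m * l)"
proof -
  define u where "u = N div (2 * m)"
  have *: "m \<ge> 1" "a \<in> totatives m" "m \<le> 2 * a" "u div 2 + 1 \<le> l" "l \<le> u" "k \<ge> 1" "k \<le> u div 8"
    using assms by (auto simp: quad_params_def u_def)
  show "m \<ge> 1" "m \<le> 2 * a" "k \<ge> 1" by (rule *)+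
  show "1 \<le> a" "a \<le> m" "coprime a m" using *(2) by (auto simp: in_totatives_iff)
  show "l \<ge> 1" "4 * k \<le> l" using * by linarith+
  have "m * l \<le> m * u" using *(5) by (rule mult_le_mono2)
  moreover have "2 * m * u \<le> N" unfolding u_def by (rule times_div_less_eq_dividend)
  ultimately show "2 * (m * l) \<le> N" by linarith
  have "N < 2 * m * (u + 1)"
  proof -
    have "N mod (2 * m) < 2 * m" using *(1) by simp
    moreover have "N = 2 * m * u + N mod (2 * m)" unfolding u_def by simp
    ultimately show ?thesis by (simp only: distrib_left)
  qed
  also have "2 * m * (u + 1) \<le> 2 * m * (2 * l)" using *(4) by (intro mult_le_mono2) linarith
  finally show "N < 4 * (m * l)" by simp
qed

lemma quad_param_bounds:
  assumes "(m, a, l, k) \<in> quad_params N"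
  shows "a * k \<le> m * k" "4 * (m * k) \<le> m * l" "2 * (m * k) \<le> a * l" "m * l \<le> 2 * (a * l)" "a * l \<le> m * l"
proof -
  note D = quad_paramsD[OF assms]
  show "a * k \<le> m * k" using D(3) by simp
  have "m * (4 * k) \<le> m * l" using D(8) by (rule mult_le_mono2)
  then show "4 * (m * k) \<le> m * l" by simp
  have "m * k \<le> 2 * (a * k)" unfolding mult.assoc[symmetric] using D(4) by (rule mult_le_mono1)
  moreover have "4 * (a * k) \<le> a * l" unfolding mult.left_commute[of 4 a k] using D(8) by (rule mult_le_mono2)
  ultimately show "2 * (m * k) \<le> a * l" by linarith
  have "m * l \<le> 2 * a * l" using D(4) by (rule mult_le_mono1)
  then show "m * l \<le> 2 * (a * l)" by simp
  show "a * l \<le> m * l" using D(3) by simp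
qed

text \<open>All four numbers lie between m l / 4 and 5 m l / 4, the smallest possibility being a l -
  m k >= a l / 2 >= m l / 4; with N/4 < m l <= N/2 this gives the factor 16. The equation is checked
  over the integers, where the truncated subtractions become exact.\<close>

lemma quad_param_solution:
  assumes "z \<in> quad_params N" "quad_param z = ((n1, n2), (n3, n4))" "N \<ge> 1"
  shows "n1\<^sup>2 + n2\<^sup>2 = n3\<^sup>2 + n4\<^sup>2" "n \<in> {n1, n2, n3, n4} \<Longrightarrow> 1 \<le> n \<and> n \<le> N \<and> N \<le> 16 * n"
proof -
  obtain m a l k where z: "z = (m, a, l, k)" by (metis prod.collapse)
  note D = quad_paramsD[OF assms(1)[unfolded z]] and B = quad_param_bounds[OF assms(1)[unfolded z]]
  have n: "n1 = a * k + m * l" "n2 = a * l - m * k" "n3 = m * l - a * k" "n4 = m * k + a * l"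
    using assms(2) by (auto simp: z quad_param_def)
  have d: "int n2 = int a * int l - int m * int k" "int n3 = int m * int l - int a * int k"
  proof -
    have "m * k \<le> a * l" "a * k \<le> m * l" using B by linarith+
    then show "int n2 = int a * int l - int m * int k" "int n3 = int m * int l - int a * int k"
      unfolding n by (simp_all only: of_nat_diff of_nat_mult)
  qed
  have "(int n1)\<^sup>2 + (int n2)\<^sup>2 = (int n3)\<^sup>2 + (int n4)\<^sup>2"
    unfolding d n(1,4) by (simp add: power2_eq_square algebra_simps)
  then show "n1\<^sup>2 + n2\<^sup>2 = n3\<^sup>2 + n4\<^sup>2" by (metis of_nat_add of_nat_power of_nat_eq_iff)
  have "N < 4 * (m * l)" "2 * (m * l) \<le> N" using D by auto
  then have "N \<le> 16 * n1 \<and> n1 \<le> N" "N \<le> 16 * n2 \<and> n2 \<le> N" "N \<le> 16 * n3 \<and> n3 \<le> N" "N \<le> 16 * n4 \<and> n4 \<le> N"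
    using B n by linarith+
  then show "1 \<le> n \<and> n \<le> N \<and> N \<le> 16 * n" if "n \<in> {n1, n2, n3, n4}"
    using that assms(3) by auto
qed

text \<open>Sums and differences of the four numbers recover m l, a k and a l. The ratio of a l to m
  l is a/m in lowest terms, so a and m are determined, and then l and k.\<close>

lemma inj_on_quad_param: "inj_on quad_param (quad_params N)"
proof (rule inj_onI)
  fix z z' assume zz: "z \<in> quad_params N" "z' \<in> quad_params N" "quad_param z = quad_param z'"
  obtain m a l k where z: "z = (m, a, l, k)" by (metis prod.collapse)
  obtain m' a' l' k' where z': "z' = (m', a', l', k')" by (metis prod.collapse)
  note D = quad_paramsD[OF zz(1)[unfolded z]] and B = quad_param_bounds[OF zz(1)[unfolded z]]
  note D' = quad_paramsD[OF zz(2)[unfolded z']] and B' = quad_param_bounds[OF zz(2)[unfolded z']]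
  have eq: "a * k + m * l = a' * k' + m' * l'" "a * l - m * k = a' * l' - m' * k'"
    "m * l - a * k = m' * l' - a' * k'" "m * k + a * l = m' * k' + a' * l'"
    using zz(3) by (auto simp: z z' quad_param_def)
  have ml: "m * l = m' * l'" and ak: "a * k = a' * k'" using eq(1,3) B B' by linarith+
  have al: "a * l = a' * l'" using eq(2,4) B B' by linarith
  have "(a * m') * (l * l') = (a * l) * (m' * l')" by (simp add: mult_ac)
  also have "\<dots> = (a' * l') * (m * l)" by (simp only: al ml)
  also have "\<dots> = (a' * m) * (l * l')" by (simp add: mult_ac)
  finally have am: "a * m' = a' * m" using D D' by simp
  have "a dvd a' * m" using am by (metis dvd_triv_left)
  then have 1: "a dvd a'" using D(5) by (simp add: coprime_dvd_mult_left_iff)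
  have "a' dvd a * m'" using am by (metis dvd_triv_left)
  then have 2: "a' dvd a" using D'(5) by (simp add: coprime_dvd_mult_left_iff)
  have a: "a = a'" using 1 2 by (rule dvd_antisym)
  then have "m = m'" using am D by simp
  moreover have "l = l'" using al a D by simp
  moreover have "k = k'" using ak a D by simp
  ultimately show "z = z'" using a by (simp add: z z')
qed

text \<open>For fixed m there are at least totient m / 2 choices of a and u^2/32 choices of (l, k),
  with u >= N/(4 m). Summing N^2 totient m / (1024 m^2) over m <= N/16 yields the logarithm, and
  4096 = 4 * 1024.\<close>

lemma card_quad_params_ge:
  assumes N: "N \<ge> 1024"
  shows "real N ^ 2 * ln (real N) / 4096 \<le> real (card (quad_params N))"
proof -
  let ?u = "\<lambda>m. N div (2 * m)"
  have "real N ^ 2 * (real (totient m) / (real m)\<^sup>2) / 1024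
      \<le> real (card ({a \<in> totatives m. m \<le> 2 * a} \<times> ({?u m div 2 + 1..?u m} \<times> {1..?u m div 8})))"
    if m: "m \<in> {1..N div 16}" for m
  proof -
    define u where "u = ?u m"
    have m16: "16 * m \<le> N" "m \<ge> 1" using m by auto
    have u8: "u \<ge> 8" unfolding u_def using m16 by (subst less_eq_div_iff_mult_less_eq) auto
    have "N < 2 * m * (u + 1)"
    proof -
      have "N mod (2 * m) < 2 * m" using m16 by simp
      moreover have "N = 2 * m * u + N mod (2 * m)" unfolding u_def by simp
      ultimately show ?thesis by (simp only: distrib_left)
    qed
    also have "\<dots> \<le> 2 * m * (2 * u)" using u8 by (intro mult_le_mono2) linarith
    finally have "N \<le> 4 * (m * u)" by simp
    then have "real N \<le> real (4 * (m * u))" by (rule of_nat_mono)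
    then have "real N / (4 * real m) \<le> real u" using m16 by (simp add: divide_le_eq mult_ac)
    then have "(real N / (4 * real m))\<^sup>2 \<le> (real u)\<^sup>2" by (intro power_mono) auto
    then have u2: "real N ^ 2 / (16 * (real m)\<^sup>2) \<le> (real u)\<^sup>2"
      by (simp add: power_divide power_mult_distrib)
    have c1: "real u / 2 \<le> real (card {u div 2 + 1..u})" by simp
    have c2: "real u / 16 \<le> real (card {1..u div 8})"
    proof -
      have "u = 8 * (u div 8) + u mod 8" "u mod 8 < 8" by simp_all
      moreover have "1 \<le> u div 8" using u8 by (simp add: less_eq_div_iff_mult_less_eq)
      ultimately have "u \<le> 16 * (u div 8)" by linarith
      then have "real u \<le> real (16 * (u div 8))" by (rule of_nat_mono)
      then show ?thesis by simp
    qed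
    have c3: "real (totient m) / 2 \<le> real (card {a \<in> totatives m. m \<le> 2 * a})"
      using totatives_upper_half[OF m16(2)] by linarith
    have "real N ^ 2 * (real (totient m) / (real m)\<^sup>2) / 1024 = real (totient m) / 2 * (real N ^ 2 / (16 * (real m)\<^sup>2) / 32)"
      by (simp add: mult.commute)
    also have "\<dots> \<le> real (totient m) / 2 * ((real u)\<^sup>2 / 32)"
      using u2 by (intro mult_left_mono divide_right_mono) auto
    also have "\<dots> = real (totient m) / 2 * (real u / 2 * (real u / 16))" by (simp add: power2_eq_square)
    also have "\<dots> \<le> real (card {a \<in> totatives m. m \<le> 2 * a}) * (real (card {u div 2 + 1..u}) * real (card {1..u div 8}))"
      by (intro mult_mono c1 c2 c3) auto
    finally show ?thesis by (simp only: card_cartesian_product of_nat_mult u_def)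
  qed
  then have "(\<Sum>m=1..N div 16. real N ^ 2 * (real (totient m) / (real m)\<^sup>2) / 1024)
     \<le> (\<Sum>m=1..N div 16. real (card ({a \<in> totatives m. m \<le> 2 * a} \<times> ({?u m div 2 + 1..?u m} \<times> {1..?u m div 8}))))"
    by (rule sum_mono)
  also have "\<dots> = real (card (quad_params N))"
    unfolding quad_params_def by (subst card_SigmaI) auto
  finally have 1: "(\<Sum>m=1..N div 16. real N ^ 2 * (real (totient m) / (real m)\<^sup>2) / 1024) \<le> real (card (quad_params N))" .
  \<comment> \<open>For N >= 1024 one has N div 16 >= N/32 >= sqrt N, so shortening the range of m
    at most halves the logarithm.\<close>
  have "ln (real N) / 2 \<le> ln (real (N div 16))"
  proof -
    have "N \<le> 32 * (N div 16)" using N by linarith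
    then have X: "real N \<le> 32 * real (N div 16)" by (metis of_nat_le_iff of_nat_mult of_nat_numeral)
    have "32 * 32 \<le> real N" using N by simp
    then have "32 \<le> sqrt (real N)" by (intro real_le_rsqrt) (simp add: power2_eq_square)
    then have "32 * sqrt (real N) \<le> sqrt (real N) * sqrt (real N)" by (intro mult_right_mono) auto
    then have "32 * sqrt (real N) \<le> real N" by simp
    with X have "sqrt (real N) \<le> real (N div 16)" by linarith
    then have "ln (sqrt (real N)) \<le> ln (real (N div 16))" using N by (subst ln_le_cancel_iff) auto
    then show ?thesis using N by (simp add: ln_sqrt)
  qed
  also have "\<dots> \<le> 2 * (\<Sum>m=1..N div 16. real (totient m) / (real m)\<^sup>2)"
    using N by (intro sum_totient_over_square_ge) auto
  finally have "real N ^ 2 * (ln (real N) / 4) \<le> real N ^ 2 * (\<Sum>m=1..N div 16. real (totient m) / (real m)\<^sup>2)"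
    by (intro mult_left_mono) auto
  also have "\<dots> = 1024 * (\<Sum>m=1..N div 16. real N ^ 2 * (real (totient m) / (real m)\<^sup>2) / 1024)"
    by (simp add: sum_distrib_left)
  finally show ?thesis using 1 by linarith
qed

text \<open>The constant is the fourth root of the counting constant, 4096 = 8^4, times the loss
  16^(-2|s|) from replacing each n >= N/16 by N in the weights.\<close>

lemma L4_norm_TN_ge_large:
  assumes N: "N \<ge> 1024"
  shows "16 powr (- 2 * \<bar>s\<bar>) / 8 * (real N powr (1/2 - 2 * s) * ln (real N) powr (1/4)) \<le> Lp_norm 4 (TN s N)"
proof (rule Lp_norm_geI)
  define W where "W = 16 powr (- 2 * \<bar>s\<bar>) * real N powr (- 2 * s)"
  let ?S = "quad_param ` quad_params N"
  have W: "W \<le> real n powr (- 2 * s)" if "1 \<le> n" "n \<le> N" "N \<le> 16 * n" for n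
  proof (cases "s \<ge> 0")
    case True
    have "W \<le> 1 * real N powr (- 2 * s)"
      unfolding W_def using powr_mono[of "- 2 * \<bar>s\<bar>" 0 "16::real"] by (intro mult_right_mono) auto
    also have "\<dots> \<le> real n powr (- 2 * s)" using True that by (simp add: powr_mono2')
    finally show ?thesis .
  next
    case False
    have "W = (real N / 16) powr (- 2 * s)"
      using False by (simp add: W_def powr_divide powr_minus_divide)
    also have "\<dots> \<le> real n powr (- 2 * s)" using False that by (intro powr_mono2) auto
    finally show ?thesis .
  qed
  have "(16 powr (- 2 * \<bar>s\<bar>) / 8 * (real N powr (1/2 - 2 * s) * ln (real N) powr (1/4))) powr 4
     = real N ^ 2 * ln (real N) / 4096 * W^4"
  proof -
    have "(16 powr (- 2 * \<bar>s\<bar>) / 8 * (real N powr (1/2 - 2 * s) * ln (real N) powr (1/4))) powr 4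
      = (16 powr (- 2 * \<bar>s\<bar>)) powr 4 / 8 powr 4 * ((real N powr (1/2 - 2 * s)) powr 4 * (ln (real N) powr (1/4)) powr 4)"
      by (simp only: powr_mult powr_divide)
    also have "(ln (real N) powr (1/4)) powr 4 = ln (real N)" using N by (simp add: powr_powr)
    also have "(real N powr (1/2 - 2 * s)) powr 4 = real N ^ 2 * (real N powr (- 2 * s)) powr 4"
    proof -
      have "(real N powr (1/2 - 2 * s)) powr 4 = real N powr (2 + (- 2 * s) * 4)"
        unfolding powr_powr by (simp add: algebra_simps)
      then show ?thesis unfolding powr_add powr_powr using N by simp
    qed
    also have "(8::real) powr 4 = 4096" by simp
    finally show ?thesis by (simp add: W_def power_mult_distrib)
  qed
  also have "\<dots> \<le> real (card ?S) * W^4"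
    using card_quad_params_ge[OF N] card_image[OF inj_on_quad_param, of N]
    by (intro mult_right_mono) auto
  also have "\<dots> \<le> integral {0..1} (\<lambda>x. norm (TN s N x) powr 4)"
  proof (rule integral_fourth_power_TN_ge)
    fix a b c d assume "((a, b), (c, d)) \<in> ?S"
    then obtain z where z: "z \<in> quad_params N" "quad_param z = ((a, b), (c, d))" by auto
    note Q = quad_param_solution[OF z]
    show "{a, b, c, d} \<subseteq> {1..N} \<and> a\<^sup>2 + b\<^sup>2 = c\<^sup>2 + d\<^sup>2"
      using Q N by auto
    show "W \<le> real n powr (- 2 * s)" if "n \<in> {a, b, c, d}" for n
      using Q(2)[OF _ that] N by (intro W) auto
  qed (simp add: W_def)
  finally show "(16 powr (- 2 * \<bar>s\<bar>) / 8 * (real N powr (1/2 - 2 * s) * ln (real N) powr (1/4))) powr 4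
     \<le> integral {0..1} (\<lambda>x. norm (TN s N x) powr 4)" .
qed (use N in \<open>auto intro!: continuous_intros\<close>)

text \<open>For N < 1024 the logarithm is bounded, so the second-moment bound already
  suffices.\<close>

lemma L4_norm_TN_ge:
  "\<exists>c>0. \<forall>N\<ge>2. c * (real N powr (1/2 - 2 * s) * ln (real N) powr (1/4)) \<le> Lp_norm 4 (TN s N)"
proof -
  define c1 where "c1 = 16 powr (- 2 * \<bar>s\<bar>) / 8"
  define c0 where "c0 = sqrt (2 powr (- \<bar>4 * s\<bar>) / 2)"
  define c2 where "c2 = c0 / (2 powr (1/2) * ln 1024 powr (1/4))"
  have c: "c1 > 0" "c0 > 0" "c2 > 0" by (auto simp: c1_def c0_def c2_def)
  have "min c1 c2 * (real N powr (1/2 - 2 * s) * ln (real N) powr (1/4)) \<le> Lp_norm 4 (TN s N)" if N: "N \<ge> 2" for N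
  proof (cases "N \<ge> 1024")
    case True
    have "min c1 c2 * (real N powr (1/2 - 2 * s) * ln (real N) powr (1/4)) \<le> c1 * (real N powr (1/2 - 2 * s) * ln (real N) powr (1/4))"
      by (intro mult_right_mono) auto
    then show ?thesis using L4_norm_TN_ge_large[OF True, of s] by (simp add: c1_def)
  next
    case False
    have "ln (real N) \<le> ln 1024" using False N by simp
    then have "ln (real N) powr (1/4) \<le> ln 1024 powr (1/4)" using N by (intro powr_mono2) auto
    then have "min c1 c2 * (real N powr (1/2 - 2 * s) * ln (real N) powr (1/4)) \<le> c2 * (real N powr (1/2 - 2 * s) * ln 1024 powr (1/4))"
      using c by (intro mult_mono) auto
    also have "\<dots> = (c0 * real N powr (1/2 - 2 * s)) / 2 powr (1/2)"
      by (simp add: c2_def)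
    also have "\<dots> \<le> Lp_norm 2 (TN s N) / 2 powr (1/2)"
      unfolding c0_def using N by (intro divide_right_mono L2_norm_TN_ge_power) auto
    also have "\<dots> \<le> Lp_norm 4 (TN s N)"
      using Lp_norm_mono_exponent[of "TN s N" 2 4] by (simp add: continuous_on_TN divide_le_eq mult.commute)
    finally show ?thesis .
  qed
  moreover have "min c1 c2 > 0" using c by simp
  ultimately show ?thesis by blast
qed

section \<open>Comparison of exponents\<close>

lemma simeqI:
  assumes "\<exists>c>0. \<forall>N\<ge>2. c * g N \<le> f N" "\<exists>C>0. \<forall>N\<ge>2. f N \<le> C * g N"
  shows "simeq f g"
  using assms unfolding simeq_def by blast

lemma lesssim_lowerI:
  assumes "\<exists>c>0. \<forall>N\<ge>2. c * f N \<le> g N"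
  shows "lesssim f g"
proof -
  obtain c where c: "c > 0" "\<And>N. N \<ge> 2 \<Longrightarrow> c * f N \<le> g N" using assms by blast
  have "f N \<le> 1 / c * g N" if "N \<ge> 2" for N using c(2)[OF that] c(1) by (simp add: field_simps)
  then show ?thesis unfolding lesssim_def using c(1) by (intro exI[of _ "1 / c"]) auto
qed

lemma Lp_norm_TN_upper_mono:
  assumes "\<exists>C>0. \<forall>N\<ge>2. Lp_norm r (TN s N) \<le> C * g N" and "0 < p" "p \<le> r"
  shows "\<exists>C>0. \<forall>N\<ge>2. Lp_norm p (TN s N) \<le> C * g N"
proof -
  obtain C where C: "C > 0" "\<And>N. N \<ge> 2 \<Longrightarrow> Lp_norm r (TN s N) \<le> C * g N" using assms(1) by blast
  have "Lp_norm p (TN s N) \<le> (2 powr (1/p) * C) * g N" if "N \<ge> 2" for N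
  proof -
    have "Lp_norm p (TN s N) \<le> 2 powr (1/p) * Lp_norm r (TN s N)"
      by (intro Lp_norm_mono_exponent continuous_intros assms)
    also have "\<dots> \<le> 2 powr (1/p) * (C * g N)" by (intro mult_left_mono C that) auto
    finally show ?thesis by simp
  qed
  then show ?thesis using C(1) by (intro exI[of _ "2 powr (1/p) * C"]) auto
qed

text \<open>If the lower bound for the L2 norm and the upper bound for some L^r norm with r > 2 have
  the same order, then so do all norms with p <= r: by interpolation for p <= 2 and by monotonicity
  above.\<close>

lemma Lp_norm_TN_simeq_L2:
  assumes r: "r > 2" "p \<le> r" and p: "0 < p" and X: "\<And>N. N \<ge> 2 \<Longrightarrow> X N > 0"
    and lower: "\<exists>c>0. \<forall>N\<ge>2. c * X N \<le> Lp_norm 2 (TN s N)"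
    and upper: "\<exists>C>0. \<forall>N\<ge>2. Lp_norm r (TN s N) \<le> C * X N"
  shows "simeq (\<lambda>N. Lp_norm p (TN s N)) X"
proof (rule simeqI)
  show "\<exists>C>0. \<forall>N\<ge>2. Lp_norm p (TN s N) \<le> C * X N"
    by (rule Lp_norm_TN_upper_mono[OF upper p r(2)])
  obtain c where c: "c > 0" "\<And>N. N \<ge> 2 \<Longrightarrow> c * X N \<le> Lp_norm 2 (TN s N)" using lower by blast
  obtain C where C: "C > 0" "\<And>N. N \<ge> 2 \<Longrightarrow> Lp_norm r (TN s N) \<le> C * X N" using upper by blast
  show "\<exists>c>0. \<forall>N\<ge>2. c * X N \<le> Lp_norm p (TN s N)"
  proof (cases "p \<le> 2")
    case True
    define l where "l = (2 * C powr r / c\<^sup>2) powr (1 / (r - 2))"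
    have "(c\<^sup>2 / 2 * l powr (p - 2)) powr (1/p) * X N \<le> Lp_norm p (TN s N)" if N: "N \<ge> 2" for N
      unfolding l_def
      by (rule Lp_norm_lower_interpolation[OF continuous_on_TN p True r(1) X[OF N] c(1) C(1) c(2)[OF N] C(2)[OF N]])
    moreover have "(c\<^sup>2 / 2 * l powr (p - 2)) powr (1/p) > 0" using c(1) C(1) by (simp add: l_def)
    ultimately show ?thesis by blast
  next
    case False
    have "(c / 2 powr (1/2)) * X N \<le> Lp_norm p (TN s N)" if N: "N \<ge> 2" for N
    proof -
      have "c * X N \<le> 2 powr (1/2) * Lp_norm p (TN s N)"
        using c(2)[OF N] Lp_norm_mono_exponent[of "TN s N" 2 p] False by (simp add: continuous_on_TN)
      then show ?thesis by (simp add: divide_le_eq mult.commute)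
    qed
    moreover have "c / 2 powr (1/2) > 0" using c(1) by simp
    ultimately show ?thesis by blast
  qed
qed

theorem theorem4p4:
  fixes s p :: real
  assumes "p > 0"
  shows
  "(s < 1/4 \<longrightarrow>
      (p < 4 \<longrightarrow> simeq (\<lambda>N. Lp_norm p (TN s N)) (\<lambda>N. real N powr (1/2 - 2 * s))) \<and>
      (p = 4 \<longrightarrow> simeq (\<lambda>N. Lp_norm p (TN s N))
                        (\<lambda>N. real N powr (1/2 - 2 * s) * ln (real N) powr (1/4))) \<and>
      (p > 4 \<longrightarrow> simeq (\<lambda>N. Lp_norm p (TN s N)) (\<lambda>N. real N powr (1 - 2/p - 2 * s)))) \<and>
   (s = 1/4 \<longrightarrow>
      (p < 4 \<longrightarrow> simeq (\<lambda>N. Lp_norm p (TN s N)) (\<lambda>N. ln (real N) powr (1/2))) \<and>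
      (p > 4 \<longrightarrow> simeq (\<lambda>N. Lp_norm p (TN s N)) (\<lambda>N. real N powr (1/2 - 2/p))) \<and>
      (p = 4 \<longrightarrow> lesssim (\<lambda>N. ln (real N) powr (1/2)) (\<lambda>N. Lp_norm p (TN s N)) \<and>
                  lesssim (\<lambda>N. Lp_norm p (TN s N)) (\<lambda>N. ln (real N) powr (3/4)))) \<and>
   (1/4 < s \<and> s < 1/2 \<longrightarrow>
      (p < 2 / (1 - 2 * s) \<longrightarrow> simeq (\<lambda>N. Lp_norm p (TN s N)) (\<lambda>N. 1)) \<and>
      (p > 2 / (1 - 2 * s) \<longrightarrow> simeq (\<lambda>N. Lp_norm p (TN s N)) (\<lambda>N. real N powr (1 - 2/p - 2 * s))) \<and>
      (p = 2 / (1 - 2 * s) \<longrightarrow> lesssim (\<lambda>N. ln (real N) powr (1/p)) (\<lambda>N. Lp_norm p (TN s N)) \<and>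
                  lesssim (\<lambda>N. Lp_norm p (TN s N)) (\<lambda>N. ln (real N) powr (1/2)))) \<and>
   (s \<ge> 1/2 \<longrightarrow> simeq (\<lambda>N. Lp_norm p (TN s N)) (\<lambda>N. 1))"
proof -
  have ln0: "ln (real N) > 0" if "N \<ge> 2" for N using that by simp
  have lnp: "ln (real N) powr 0 = 1" if "N \<ge> 2" for N using ln0[OF that] by simp
  have sup: "\<exists>C>0. \<forall>N\<ge>2. Lp_norm r (TN s N) \<le> C * real N powr (sg - 2 * s)" if "admissible r sg 0" "sg > 2 * s" for r sg
    using Lp_norm_TN_le_supercritical[OF that] lnp by simp
  have large: "simeq (\<lambda>N. Lp_norm p (TN s N)) (\<lambda>N. real N powr (1 - 2/p - 2 * s))" if "p > 4" "1 - 2/p > 2 * s"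
    using sup[of p "1 - 2/p"] that Lp_norm_TN_ge_peak[OF assms, of s] by (intro simeqI) (auto simp: admissible_def)
  have bounded: "simeq (\<lambda>N. Lp_norm p (TN s N)) (\<lambda>N. 1)" if "r > 4" "p \<le> r" "1 - 2/r < 2 * s" for r
  proof (rule Lp_norm_TN_simeq_L2[of r])
    have "admissible r (1 - 2/r) 0" using that by (simp add: admissible_def)
    then show "\<exists>C>0. \<forall>N\<ge>2. Lp_norm r (TN s N) \<le> C * 1"
      using that(3) by (rule Lp_norm_TN_le_subcritical)
    show "\<exists>c>0. \<forall>N\<ge>2. c * 1 \<le> Lp_norm 2 (TN s N)"
      using L2_norm_TN_ge_1[of _ s] by (intro exI[of _ 1]) auto
  qed (use that assms in auto)
  \<comment> \<open>An auxiliary exponent: for p < 4 it satisfies 2 < r < 4, where unweighted sums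
    have square-root size, even if p itself is at most 2.\<close>
  define r where "r = max p 3"
  have adm: "admissible r (1/2) 0" if "p < 4" using that by (auto simp: r_def admissible_def)
  have r: "r > 2" "p \<le> r" by (auto simp: r_def)
  have c1: "simeq (\<lambda>N. Lp_norm p (TN s N)) (\<lambda>N. real N powr (1/2 - 2 * s))" if "s < 1/4" "p < 4"
  proof (rule Lp_norm_TN_simeq_L2[OF r assms])
    show "\<exists>C>0. \<forall>N\<ge>2. Lp_norm r (TN s N) \<le> C * real N powr (1/2 - 2 * s)"
      by (rule sup[OF adm]) (use that in auto)
    show "\<exists>c>0. \<forall>N\<ge>2. c * real N powr (1/2 - 2 * s) \<le> Lp_norm 2 (TN s N)"
      using L2_norm_TN_ge_power[of _ s] by (intro exI[of _ "sqrt (2 powr (- \<bar>4 * s\<bar>) / 2)"]) auto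
  qed auto
  have c2: "simeq (\<lambda>N. Lp_norm p (TN s N)) (\<lambda>N. real N powr (1/2 - 2 * s) * ln (real N) powr (1/4))" if "s < 1/4" "p = 4"
  proof (rule simeqI)
    show "\<exists>c>0. \<forall>N\<ge>2. c * (real N powr (1/2 - 2 * s) * ln (real N) powr (1/4)) \<le> Lp_norm p (TN s N)"
      unfolding that(2) by (rule L4_norm_TN_ge)
    show "\<exists>C>0. \<forall>N\<ge>2. Lp_norm p (TN s N) \<le> C * (real N powr (1/2 - 2 * s) * ln (real N) powr (1/4))"
      by (rule Lp_norm_TN_le_supercritical) (use that in \<open>auto simp: admissible_def\<close>)
  qed
  have p4: "2 / p < 1/2" if "p > 4" using that by (simp add: field_simps)
  have c3: "simeq (\<lambda>N. Lp_norm p (TN s N)) (\<lambda>N. real N powr (1 - 2/p - 2 * s))" if "s < 1/4" "p > 4"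
    using p4[OF that(2)] that by (intro large) linarith+
  have c4: "simeq (\<lambda>N. Lp_norm p (TN s N)) (\<lambda>N. ln (real N) powr (1/2))" if "s = 1/4" "p < 4"
  proof (rule Lp_norm_TN_simeq_L2[OF r assms])
    show "\<exists>C>0. \<forall>N\<ge>2. Lp_norm r (TN s N) \<le> C * ln (real N) powr (1/2)"
    proof -
      have "1/2 = 2 * s" using that(1) by simp
      from Lp_norm_TN_le_critical[OF adm[OF that(2)] this] show ?thesis by (simp only: add_0_right)
    qed
    show "\<exists>c>0. \<forall>N\<ge>2. c * ln (real N) powr (1/2) \<le> Lp_norm 2 (TN s N)"
      unfolding that(1) using L2_norm_TN_ge_ln by (intro exI[of _ 1]) auto
  qed (use ln0 in auto)
  have c5: "simeq (\<lambda>N. Lp_norm p (TN s N)) (\<lambda>N. real N powr (1/2 - 2/p))" if "s = 1/4" "p > 4"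
  proof -
    have e: "1 - 2/p - 2 * s = 1/2 - 2/p" using that by simp
    have "1 - 2/p > 2 * s" using p4[OF that(2)] that(1) by linarith
    from large[OF that(2) this] show ?thesis unfolding e .
  qed
  have c6: "lesssim (\<lambda>N. ln (real N) powr (1/2)) (\<lambda>N. Lp_norm p (TN s N))"
    "lesssim (\<lambda>N. Lp_norm p (TN s N)) (\<lambda>N. ln (real N) powr (3/4))" if "s = 1/4" "p = 4"
  proof -
    have "1 / 2 powr (1/2) * ln (real N) powr (1/2) \<le> Lp_norm p (TN s N)" if N: "N \<ge> 2" for N
    proof -
      have "ln (real N) powr (1/2) \<le> Lp_norm 2 (TN s N)" unfolding \<open>s = 1/4\<close> using L2_norm_TN_ge_ln N by simp
      also have "\<dots> \<le> 2 powr (1/2) * Lp_norm p (TN s N)"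
        using Lp_norm_mono_exponent[of "TN s N" 2 p] \<open>p = 4\<close> by (simp add: continuous_on_TN)
      finally show ?thesis by (simp add: divide_le_eq mult.commute)
    qed
    then show "lesssim (\<lambda>N. ln (real N) powr (1/2)) (\<lambda>N. Lp_norm p (TN s N))"
      by (intro lesssim_lowerI exI[of _ "1 / 2 powr (1/2)"]) auto
    have "admissible p (1/2) (1/4)" using that by (simp add: admissible_def)
    moreover have "1/2 = 2 * s" using that(1) by simp
    ultimately have "\<exists>C>0. \<forall>N\<ge>2. Lp_norm p (TN s N) \<le> C * ln (real N) powr (1/2 + 1/4)"
      by (rule Lp_norm_TN_le_critical)
    moreover have "(1/2 + 1/4 :: real) = 3/4" by simp
    ultimately show "lesssim (\<lambda>N. Lp_norm p (TN s N)) (\<lambda>N. ln (real N) powr (3/4))"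
      by (simp only: lesssim_def)
  qed
  have mid: "simeq (\<lambda>N. Lp_norm p (TN s N)) (\<lambda>N. 1)" if s: "1/4 < s" "s < 1/2" and p: "p < 2 / (1 - 2 * s)"
  proof -
    define q where "q = 2 / (1 - 2 * s)"
    have q: "4 < q" unfolding q_def using s by (simp add: field_simps)
    \<comment> \<open>Any exponent strictly between max p 4 and the critical q would do; r' < q is
      equivalent to the subcritical condition 1 - 2/r' < 2 s.\<close>
    define r' where "r' = (max p 4 + q) / 2"
    have r': "4 < r'" "p \<le> r'" "r' < q" using q p by (auto simp: r'_def q_def[symmetric] max_def)
    have "2 / q < 2 / r'" using r' by (intro divide_strict_left_mono) auto
    moreover have "2 / q = 1 - 2 * s" using s by (simp add: q_def)
    ultimately show ?thesis by (intro bounded[of r'] r') auto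
  qed
  have c7: "simeq (\<lambda>N. Lp_norm p (TN s N)) (\<lambda>N. real N powr (1 - 2/p - 2 * s))"
    if s: "1/4 < s" "s < 1/2" and p: "p > 2 / (1 - 2 * s)"
  proof (rule large)
    have "4 < 2 / (1 - 2 * s)" using s by (simp add: field_simps)
    then show "p > 4" using p by linarith
    show "1 - 2/p > 2 * s" using p s assms by (simp add: field_simps)
  qed
  have c8: "lesssim (\<lambda>N. ln (real N) powr (1/p)) (\<lambda>N. Lp_norm p (TN s N))"
    "lesssim (\<lambda>N. Lp_norm p (TN s N)) (\<lambda>N. ln (real N) powr (1/2))"
    if s: "1/4 < s" "s < 1/2" and p: "p = 2 / (1 - 2 * s)"
  proof -
    have p4': "p > 4" unfolding p using s by (simp add: field_simps)
    show "lesssim (\<lambda>N. ln (real N) powr (1/p)) (\<lambda>N. Lp_norm p (TN s N))"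
      by (intro lesssim_lowerI Lp_norm_TN_ge_critical s p) (use p4' in linarith)
    have "admissible p (1 - 2/p) 0" using p4' by (simp add: admissible_def)
    moreover have "2/p = 1 - 2 * s" using s by (simp add: p)
    then have "1 - 2/p = 2 * s" by linarith
    ultimately show "lesssim (\<lambda>N. Lp_norm p (TN s N)) (\<lambda>N. ln (real N) powr (1/2))"
      using Lp_norm_TN_le_critical[of p "1 - 2/p" 0 s] by (simp add: lesssim_def)
  qed
  have c9: "simeq (\<lambda>N. Lp_norm p (TN s N)) (\<lambda>N. 1)" if "s \<ge> 1/2"
  \<comment> \<open>As 2 s >= 1 > 1 - 2/r for every finite r, any exponent above 4 and at least p
    works.\<close>
  proof (rule bounded[of "max p 5"])
    have "2 / max p 5 > 0" by (simp add: less_max_iff_disj)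
    then show "1 - 2 / max p 5 < 2 * s" using that by linarith
  qed auto
  show ?thesis
    by (intro conjI impI; (elim conjE)?; rule c1 c2 c3 c4 c5 c6 mid c7 c8 c9; assumption)
qed

end
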